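(* Let $\mathfrak g$ be a Lie algebra of classical type over $\mathbb C$, identified with a subset of $\operatorname{End}(V)$ ($V$ the natural module), and let $f\in\mathfrak g$ be a nilpotent element with Jordan type having all parts of the same parity. Embed $f$ in an $\mathfrak{sl}_2$-triple $(f,2x,e)$ in $\mathfrak g$. Let $k\in\frac12\mathbb Z_{\ge0}$, and let $U$ be the subspace of $V$ spanned by the $\mathfrak{sl}_2$-submodules of $V$ of highest weight $k$ (weight meaning $x$-eigenvalue). Let $m\in\frac12\mathbb Z$ be the largest number such that $m<k$ and $m$ is the weight of a highest weight vector in $V$. Let $b\in\frac12\mathbb Z$ be such that $b>k-m$. Let $W$ be the subspace spanned by the lowest weight vectors of weight $-m$ in $V$. Then the coefficients of $z^{-b}$ in $\Pi_WL_{k;R}(z)\Psi_U\,\bar1$ are in the finite $W$-algebra $U(\mathfrak g,f)$. Here $L_{k;R}(z)$ is the right handed Lax type operator of the subalgebra $\mathfrak g^k$ and nilpotent element $f_k$ defined in the context.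
   Context: Finite $W$-algebra: $\mathfrak g$ carries a symmetric non-degenerate invariant bilinear form $\langle\cdot\mid\cdot\rangle$. $\mathfrak g_j$ is the $j$-eigenspace of $\operatorname{ad}x$ on $\mathfrak g$. $J$ is the left ideal of $U(\mathfrak g)$ generated by $\{y-\langle f\mid y\rangle:y\in\mathfrak g_{\ge1}\}$, and $U(\mathfrak g,f)=(U(\mathfrak g)/J)^{\mathfrak g_{\ge1/2}}$ (invariants for the action induced by the adjoint action). $\bar1$ is the image of $1$ in $U(\mathfrak g)/J$; $A\bar1$ means replacing each $U(\mathfrak g)$-coefficient of $A$ by its image in $U(\mathfrak g)/J$. Weight spaces: $V[j]$ is the $j$-eigenspace of $x$ on $V$; $V[<j]$, $V[>j]$, etc. are the obvious sums. $\Pi_{<j}$, $\Pi_{[-k,k]}$ denote the projections of $V$ onto $V[<j]$, $\bigoplus_{-k\le i\le k}V[i]$ along the remaining weight spaces, and $\Psi_{j},\Psi_{>j},\Psi_{[-k,k]}$ the corresponding inclusions. $\Psi_U$ means restriction to $U\cap V[-k]$. $\Pi_W$ is the projection onto $W$ along all weight spaces $V[j]$, $j\neq-m$, and the intersection of $V[-m]$ with the sum of the $\mathfrak{sl}_2$-isotypic components of highest weight different from $m$. General right handed Lax type operator: let $\mathfrak a$ be a reductive Lie algebra with a symmetric non-degenerate invariant form, a nilpotent element $f_{\mathfrak a}$ in an $\mathfrak{sl}_2$-triple $(f_{\mathfrak a},2x_{\mathfrak a},e_{\mathfrak a})$, and a faithful finite-dimensional representation $\phi$ on $M$. Let $\{u_i\}$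 be a basis of $\mathfrak a$ of $\operatorname{ad}x_{\mathfrak a}$-eigenvectors with eigenvalues $\delta(u_i)$, $\{u^i\}$ the dual basis, $U_i=\phi(u_i)$, $U^i=\phi(u^i)$, $F=\phi(f_{\mathfrak a})$, $D=\sum_{u_i\in\mathfrak a_{\ge1}}U^iU_i$, and $$Y=\mathbb 1_M+F+\sum_{u_i\in\mathfrak a_{\le1/2}}z^{\delta(u_i)-1}u_i\otimes U^i+z^{-1}D\in U(\mathfrak a)[[z^{-1/2}]]\otimes\operatorname{End}(M).$$ With $h$ the largest eigenvalue of $x_{\mathfrak a}$ on $M$, the operator $\Pi_{<h}Y\Psi_{>-h}$ is invertible and $$L_R(z)=\left(\Pi_{<h}Y\Psi_{>-h}\right)^{-1}\Pi_{<h}Y\Psi_{-h},$$ an operator from $M[-h]$ to $M[>-h]$ with coefficients power series over $U(\mathfrak a)$ (matrix products over a noncommutative ring). Definition of $L_{k;R}(z)$: let $\mathfrak g^k=\{\Pi_{[-k,k]}X\Psi_{[-k,k]}:X\in\mathfrak g\}$, regarded (extending by zero on the other weight spaces) as a Lie subalgebra of $\mathfrak g$, and $f_k=\Pi_{[-k,k]}f\Psi_{[-k,k]}$, a nilpotent element of $\mathfrak g^k$, with grading element $x_k=\Pi_{[-k,k]}x\Psi_{[-k,k]}$. $L_{k;R}(z)$ is the operator $L_R(z)$ above for $\mathfrak a=\mathfrak g^k$, $f_{\mathfrak a}=f_k$, $x_{\mathfrak a}=x_k$, the restricted form, and $M=\bigoplus_{-k\le i\le k}V[i]$ (in particular $D$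 is computed in $\mathfrak g^k$). Its coefficients lie in $U(\mathfrak g^k)\subset U(\mathfrak g)$.
   Formalization: D is taken with a minus sign (with plus the claim fails for gl_4, Jordan type (3,1)); for sl_N, g^k is assumed to lie in g (else undefined); for gl_N with k below the top weight, the form is a multiple of the trace form (else the claim fails). *)

theory Defs
  imports "HOL-Analysis.Analysis" "HOL-Library.Poly_Mapping"
    "HOL-Computational_Algebra.Formal_Power_Series"
begin

section \<open>Complex Lie algebras\<close>

class complex_lie_algebra = ab_group_add +
  fixes lie_scale :: "complex \<Rightarrow> 'a \<Rightarrow> 'a"  (infixr \<open>*\<^sub>L\<close> 75)
    and lie_bracket :: "'a \<Rightarrow> 'a \<Rightarrow> 'a"
  assumes lie_scale_add_right: "c *\<^sub>L (a + b) = c *\<^sub>L a + c *\<^sub>L b"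
    and lie_scale_add_left: "(c + d) *\<^sub>L a = c *\<^sub>L a + d *\<^sub>L a"
    and lie_scale_scale: "c *\<^sub>L d *\<^sub>L a = (c * d) *\<^sub>L a"
    and lie_scale_one: "1 *\<^sub>L a = a"
    and lie_bracket_add_left: "lie_bracket (a + b) y = lie_bracket a y + lie_bracket b y"
    and lie_bracket_add_right: "lie_bracket y (a + b) = lie_bracket y a + lie_bracket y b"
    and lie_bracket_scale_left: "lie_bracket (c *\<^sub>L a) b = c *\<^sub>L lie_bracket a b"
    and lie_bracket_scale_right: "lie_bracket a (c *\<^sub>L b) = c *\<^sub>L lie_bracket a b"
    and lie_bracket_self: "lie_bracket a a = 0"
    and lie_jacobi: "lie_bracket a (lie_bracket b y) + lie_bracket b (lie_bracket y a)
           + lie_bracket y (lie_bracket a b) = 0"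

interpretation lie: vector_space "lie_scale :: complex \<Rightarrow> 'a::complex_lie_algebra \<Rightarrow> 'a"
  by unfold_locales
    (simp_all add: lie_scale_add_right lie_scale_add_left lie_scale_scale lie_scale_one)

section \<open>The universal enveloping algebra\<close>

text \<open>Words in the elements of the Lie algebra, with concatenation written additively so that
  \<^typ>\<open>_ \<Rightarrow>\<^sub>0 complex\<close> becomes the free associative algebra.\<close>

datatype 'a lie_word = Lie_Word (letters: "'a list")

instantiation lie_word :: (type) monoid_add
begin

definition zero_lie_word :: "'a lie_word" where "0 = Lie_Word []"

definition plus_lie_word :: "'a lie_word \<Rightarrow> 'a lie_word \<Rightarrow> 'a lie_word"
  where "v + w = Lie_Word (letters v @ letters w)"

instance
  by standard (simp_all add: zero_lie_word_def plus_lie_word_def)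

end

lemma lie_word_add_eq_0_iff: "v + w = 0 \<longleftrightarrow> v = 0 \<and> w = (0 :: 'a lie_word)"
  by (cases v; cases w) (auto simp: zero_lie_word_def plus_lie_word_def)

type_synonym 'a free_alg = "'a lie_word \<Rightarrow>\<^sub>0 complex"

definition free_const :: "complex \<Rightarrow> 'a free_alg"
  where "free_const c = Poly_Mapping.single 0 c"

definition free_gen :: "'a \<Rightarrow> 'a free_alg"
  where "free_gen y = Poly_Mapping.single (Lie_Word [y]) 1"

inductive_set uea_ideal :: "'a::complex_lie_algebra free_alg set" where
  linear: "free_gen (c *\<^sub>L y + y') - free_const c * free_gen y - free_gen y' \<in> uea_ideal"
| bracket: "free_gen y * free_gen y' - free_gen y' * free_gen y - free_gen (lie_bracket y y')
    \<in> uea_ideal"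
| zero: "0 \<in> uea_ideal"
| add: "a \<in> uea_ideal \<Longrightarrow> b \<in> uea_ideal \<Longrightarrow> a + b \<in> uea_ideal"
| mult_left: "a \<in> uea_ideal \<Longrightarrow> c * a \<in> uea_ideal"
| mult_right: "a \<in> uea_ideal \<Longrightarrow> a * c \<in> uea_ideal"

lemma uea_ideal_uminus: "a \<in> uea_ideal \<Longrightarrow> - a \<in> uea_ideal"
  using uea_ideal.mult_left[of a "- 1"] by simp

lemma lookup_mult_0_lie_word:
  "Poly_Mapping.lookup (a * b) (0 :: 'a lie_word)
     = Poly_Mapping.lookup a 0 * Poly_Mapping.lookup (b :: 'a free_alg) 0"
proof -
  have "(\<Sum>q. Poly_Mapping.lookup b q when 0 = l + q) = (Poly_Mapping.lookup b 0 when l = 0)"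
    for l :: "'a lie_word"
  proof -
    have "(\<lambda>q. Poly_Mapping.lookup b q when 0 = l + q)
        = (\<lambda>q. (Poly_Mapping.lookup b q when l = 0) when q = 0)"
      by (rule ext) (use lie_word_add_eq_0_iff[of l] in \<open>auto simp: when_def eq_commute[of 0]\<close>)
    from arg_cong[OF this, of Sum_any] show ?thesis by (simp only: Sum_any_when_equal)
  qed
  then show ?thesis
    by (simp only: lookup_mult mult_when Sum_any_when_equal)
qed

lemma lookup_free_gen_0: "Poly_Mapping.lookup (free_gen y) 0 = 0"
  unfolding free_gen_def by (rule lookup_single_not_eq) (simp add: zero_lie_word_def)

lemma uea_ideal_augmentation: "a \<in> uea_ideal \<Longrightarrow> Poly_Mapping.lookup a 0 = 0"
proof (induction rule: uea_ideal.induct)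
  case (linear c y y')
  show ?case by (simp only: lookup_minus lookup_mult_0_lie_word lookup_free_gen_0) simp
next
  case (bracket y y')
  show ?case by (simp only: lookup_minus lookup_mult_0_lie_word lookup_free_gen_0) simp
next
  case zero
  show ?case by simp
next
  case (add a b)
  then show ?case by (simp only: lookup_add) simp
next
  case (mult_left a c)
  then show ?case by (simp only: lookup_mult_0_lie_word) simp
next
  case (mult_right a c)
  then show ?case by (simp only: lookup_mult_0_lie_word) simp
qed

definition uea_rel :: "'a::complex_lie_algebra free_alg \<Rightarrow> 'a free_alg \<Rightarrow> bool"
  where "uea_rel a b \<longleftrightarrow> a - b \<in> uea_ideal"

lemma equivp_uea_rel: "equivp (uea_rel :: 'a::complex_lie_algebra free_alg \<Rightarrow> 'a free_alg \<Rightarrow> bool)"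
proof (rule equivpI)
  show "reflp (uea_rel :: 'a free_alg \<Rightarrow> _)"
    by (rule reflpI) (simp add: uea_rel_def uea_ideal.zero)
  show "symp (uea_rel :: 'a free_alg \<Rightarrow> _)"
  proof (rule sympI)
    show "uea_rel b a" if "uea_rel a b" for a b :: "'a free_alg"
      using uea_ideal_uminus[of "a - b"] that by (simp add: uea_rel_def)
  qed
  show "transp (uea_rel :: 'a free_alg \<Rightarrow> _)"
  proof (rule transpI)
    show "uea_rel a c" if "uea_rel a b" "uea_rel b c" for a b c :: "'a free_alg"
      using uea_ideal.add[of "a - b" "b - c"] that by (simp add: uea_rel_def)
  qed
qed

quotient_type (overloaded) 'a uea = "'a::complex_lie_algebra free_alg" / uea_rel
  by (rule equivp_uea_rel)

instantiation uea :: (complex_lie_algebra) ring_1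
begin

lift_definition zero_uea :: "'a uea" is 0 .
lift_definition one_uea :: "'a uea" is 1 .

lift_definition plus_uea :: "'a uea \<Rightarrow> 'a uea \<Rightarrow> 'a uea" is "(+)"
proof -
  fix a a' b b' :: "'a free_alg"
  assume "uea_rel a a'" "uea_rel b b'"
  then have "(a - a') + (b - b') \<in> uea_ideal"
    unfolding uea_rel_def by (rule uea_ideal.add)
  then show "uea_rel (a + b) (a' + b')"
    by (simp add: uea_rel_def algebra_simps)
qed

lift_definition uminus_uea :: "'a uea \<Rightarrow> 'a uea" is uminus
proof -
  fix a a' :: "'a free_alg"
  assume "uea_rel a a'"
  then have "- (a - a') \<in> uea_ideal"
    unfolding uea_rel_def by (rule uea_ideal_uminus)
  then show "uea_rel (- a) (- a')"
    by (simp add: uea_rel_def)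
qed

lift_definition minus_uea :: "'a uea \<Rightarrow> 'a uea \<Rightarrow> 'a uea" is "(-)"
proof -
  fix a a' b b' :: "'a free_alg"
  assume "uea_rel a a'" "uea_rel b b'"
  then have "(a - a') + - (b - b') \<in> uea_ideal"
    unfolding uea_rel_def by (intro uea_ideal.add uea_ideal_uminus)
  then show "uea_rel (a - b) (a' - b')"
    by (simp add: uea_rel_def algebra_simps)
qed

lift_definition times_uea :: "'a uea \<Rightarrow> 'a uea \<Rightarrow> 'a uea" is "(*)"
proof -
  fix a a' b b' :: "'a free_alg"
  assume "uea_rel a a'" "uea_rel b b'"
  then have "(a - a') * b + a' * (b - b') \<in> uea_ideal"
    unfolding uea_rel_def by (intro uea_ideal.add uea_ideal.mult_left uea_ideal.mult_right)
  then show "uea_rel (a * b) (a' * b')"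
    by (simp add: uea_rel_def algebra_simps)
qed

instance
proof
  fix a b c :: "'a uea"
  show "a * b * c = a * (b * c)"
    by transfer (simp add: uea_rel_def uea_ideal.zero mult.assoc)
  show "1 * a = a" by transfer (simp add: uea_rel_def uea_ideal.zero)
  show "a * 1 = a" by transfer (simp add: uea_rel_def uea_ideal.zero)
  show "a + b + c = a + (b + c)"
    by transfer (simp add: uea_rel_def uea_ideal.zero add.assoc)
  show "a + b = b + a"
    by transfer (simp add: uea_rel_def uea_ideal.zero add.commute)
  show "0 + a = a" by transfer (simp add: uea_rel_def uea_ideal.zero)
  show "- a + a = 0" by transfer (simp add: uea_rel_def uea_ideal.zero)
  show "a - b = a + - b" by transfer (simp add: uea_rel_def uea_ideal.zero)
  show "(a + b) * c = a * c + b * c"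
    by transfer (simp add: uea_rel_def uea_ideal.zero distrib_right)
  show "a * (b + c) = a * b + a * c"
    by transfer (simp add: uea_rel_def uea_ideal.zero distrib_left)
  show "(0 :: 'a uea) \<noteq> 1"
    by transfer (use uea_ideal_augmentation[of "0 - 1"] in \<open>auto simp: uea_rel_def lookup_one\<close>)
qed

end

lift_definition uea_const :: "complex \<Rightarrow> 'a::complex_lie_algebra uea" is free_const .

lift_definition uea_gen :: "'a::complex_lie_algebra \<Rightarrow> 'a uea" is free_gen .

section \<open>Classical Lie algebras and their nilpotent elements\<close>

definition orthosymplectic :: "complex^'n^'n \<Rightarrow> (complex^'n^'n) set"
  where "orthosymplectic Q = {A. transpose A ** Q + Q ** A = 0}"

definition classical_type :: "(complex^'n^'n) set \<Rightarrow> bool"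
  where "classical_type S \<longleftrightarrow> S = UNIV \<or> S = {A. trace A = 0}
    \<or> (\<exists>Q. invertible Q \<and> transpose Q = Q \<and> S = orthosymplectic Q)
    \<or> (\<exists>Q. invertible Q \<and> transpose Q = - Q \<and> S = orthosymplectic Q)"

definition faithful_rep :: "('g::complex_lie_algebra \<Rightarrow> complex^'n^'n) \<Rightarrow> bool"
  where "faithful_rep \<phi> \<longleftrightarrow> inj \<phi>
    \<and> (\<forall>y y'. \<phi> (y + y') = \<phi> y + \<phi> y')
    \<and> (\<forall>c y. \<phi> (c *\<^sub>L y) = mat c ** \<phi> y)
    \<and> (\<forall>y y'. \<phi> (lie_bracket y y') = \<phi> y ** \<phi> y' - \<phi> y' ** \<phi> y)"

definition invariant_form :: "('g::complex_lie_algebra \<Rightarrow> 'g \<Rightarrow> complex) \<Rightarrow> bool"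
  where "invariant_form B \<longleftrightarrow>
      (\<forall>y y'. B y y' = B y' y)
    \<and> (\<forall>y y' w. B (y + y') w = B y w + B y' w)
    \<and> (\<forall>c y w. B (c *\<^sub>L y) w = c * B y w)
    \<and> (\<forall>y w v. B (lie_bracket y w) v = B y (lie_bracket w v))
    \<and> (\<forall>y. (\<forall>w. B y w = 0) \<longrightarrow> y = 0)"

text \<open>The triple is \<open>(f, 2x, e)\<close>.\<close>

definition sl2_triple :: "'g::complex_lie_algebra \<Rightarrow> 'g \<Rightarrow> 'g \<Rightarrow> bool"
  where "sl2_triple f x e \<longleftrightarrow>
    (let h = 2 *\<^sub>L x in
       lie_bracket h e = 2 *\<^sub>L e \<and> lie_bracket h f = - (2 *\<^sub>L f) \<and> lie_bracket e f = h)"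

text \<open>Composition powers; the power operation on \<^typ>\<open>complex^'n^'n\<close> would be entrywise.\<close>

definition nilpotent_matrix :: "complex^'n^'n \<Rightarrow> bool"
  where "nilpotent_matrix A \<longleftrightarrow> (\<exists>N. ((**) A ^^ N) (mat 1) = 0)"

text \<open>A basis of Jordan chains \<open>F\<^sup>j v\<^sub>i\<close> with \<open>j < p\<^sub>i\<close>, the list \<open>ps\<close> being the multiset of parts.\<close>

definition jordan_type :: "complex^'n^'n \<Rightarrow> nat list \<Rightarrow> bool"
  where "jordan_type F ps \<longleftrightarrow> (\<forall>p\<in>set ps. p > 0) \<and>
    (\<exists>v. let I = Sigma {..<length ps} (\<lambda>i. {..<ps ! i}); b = (\<lambda>(i, j). ((*v) F ^^ j) (v i)) in
       inj_on b I \<and> vec.independent (b ` I) \<and> vec.span (b ` I) = UNIV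
       \<and> (\<forall>i<length ps. ((*v) F ^^ (ps ! i)) (v i) = 0))"

section \<open>The finite W-algebra\<close>

definition ad_eigenspace :: "'g::complex_lie_algebra \<Rightarrow> real \<Rightarrow> 'g set"
  where "ad_eigenspace x j = {y. lie_bracket x y = complex_of_real j *\<^sub>L y}"

definition ad_ge :: "'g::complex_lie_algebra \<Rightarrow> real \<Rightarrow> 'g set"
  where "ad_ge x j = lie.span (\<Union>i\<in>{j..}. ad_eigenspace x i)"

inductive_set left_ideal :: "'r::ring_1 set \<Rightarrow> 'r set" for S where
  gen: "s \<in> S \<Longrightarrow> s \<in> left_ideal S"
| zero: "0 \<in> left_ideal S"
| add: "a \<in> left_ideal S \<Longrightarrow> b \<in> left_ideal S \<Longrightarrow> a + b \<in> left_ideal S"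
| mult: "a \<in> left_ideal S \<Longrightarrow> r * a \<in> left_ideal S"

definition W_J :: "('g::complex_lie_algebra \<Rightarrow> 'g \<Rightarrow> complex) \<Rightarrow> 'g \<Rightarrow> 'g \<Rightarrow> 'g uea set"
  where "W_J B f x = left_ideal {uea_gen y - uea_const (B f y) | y. y \<in> ad_ge x 1}"

text \<open>The image of \<open>a\<close> in \<open>U(\<gg>)/J\<close>, as a coset.\<close>

definition W_bar :: "('g::complex_lie_algebra \<Rightarrow> 'g \<Rightarrow> complex) \<Rightarrow> 'g \<Rightarrow> 'g \<Rightarrow> 'g uea \<Rightarrow> 'g uea set"
  where "W_bar B f x a = {a'. a' - a \<in> W_J B f x}"

text \<open>The element \<open>y\<close> acts by \<open>a + J \<mapsto> [y, a] + J\<close>.\<close>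

definition W_algebra :: "('g::complex_lie_algebra \<Rightarrow> 'g \<Rightarrow> complex) \<Rightarrow> 'g \<Rightarrow> 'g \<Rightarrow> 'g uea set set"
  where "W_algebra B f x = {W_bar B f x a | a.
    \<forall>y\<in>ad_ge x (1/2). W_bar B f x (uea_gen y * a - a * uea_gen y) = W_bar B f x 0}"

section \<open>Weight spaces and projections\<close>

text \<open>A subspace \<open>M\<close> of \<^typ>\<open>complex^'n\<close> with a chosen complement is given by the projection \<open>P\<close>
  onto \<open>M\<close>. Operators between subspaces of \<open>M\<close> are matrices on the whole space, extended by zero
  on the complements. Inclusions and restrictions thus become multiplication by projections.\<close>

definition proj_along :: "(complex^'n) set \<Rightarrow> (complex^'n) set \<Rightarrow> complex^'n^'n"
  where "proj_along R K = (THE P. (\<forall>v\<in>R. P *v v = v) \<and> (\<forall>v\<in>K. P *v v = 0))"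

definition weight_space :: "complex^'n^'n \<Rightarrow> complex^'n^'n \<Rightarrow> real \<Rightarrow> (complex^'n) set"
  where "weight_space P X j = {v. P *v v = v \<and> X *v v = complex_of_real j *s v}"

definition weight_proj :: "complex^'n^'n \<Rightarrow> complex^'n^'n \<Rightarrow> real set \<Rightarrow> complex^'n^'n"
  where "weight_proj P X I = proj_along
    (vec.span (\<Union>j\<in>I. weight_space P X j))
    (vec.span ((\<Union>j\<in>-I. weight_space P X j) \<union> {v. P *v v = 0}))"

definition top_weight :: "complex^'n^'n \<Rightarrow> complex^'n^'n \<Rightarrow> real"
  where "top_weight P X = Max {j. weight_space P X j \<noteq> {0}}"

section \<open>The right handed Lax type operator\<close>

text \<open>A power series \<open>S\<close> over \<open>'g uea\<close> is a series in \<open>z\<^sup>-\<^sup>1\<^sup>/\<^sup>2 =\<close> \<^const>\<open>fps_X\<close>;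
  \<open>zinv r\<close> is \<open>z\<^sup>-\<^sup>r\<close> and \<open>zinv_coeff r S\<close> is the coefficient of \<open>z\<^sup>-\<^sup>r\<close>, for \<open>r\<close> a half-integer with
  \<open>r \<ge> 0\<close>.\<close>

definition zinv :: "real \<Rightarrow> 'g::complex_lie_algebra uea fps"
  where "zinv r = fps_X ^ nat \<lfloor>2 * r\<rfloor>"

definition zinv_coeff :: "real \<Rightarrow> 'g::complex_lie_algebra uea fps \<Rightarrow> 'g uea"
  where "zinv_coeff r S = fps_nth S (nat \<lfloor>2 * r\<rfloor>)"

definition tensor_mat :: "'g::complex_lie_algebra uea fps \<Rightarrow> complex^'n^'n \<Rightarrow> ('g uea fps)^'n^'n"
  where "tensor_mat s A = (\<chi> i j. s * fps_const (uea_const (A $ i $ j)))"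

abbreviation scal_mat :: "complex^'n^'n \<Rightarrow> ('g::complex_lie_algebra uea fps)^'n^'n"
  where "scal_mat \<equiv> tensor_mat 1"

definition scal_vec :: "complex^'n \<Rightarrow> ('g::complex_lie_algebra uea fps)^'n"
  where "scal_vec v = (\<chi> i. fps_const (uea_const (v $ i)))"

text \<open>\<open>\<aa>\<close> is a Lie subalgebra of \<open>\<gg>\<close>; \<open>u\<^sub>0, \<dots>, u\<^sub>d\<^sub>-\<^sub>1\<close> is a basis of \<open>\<aa>\<close> with \<open>ad x\<close>-eigenvalues \<open>\<delta>\<close>,
  and \<open>u'\<close> the basis dual to \<open>u\<close> for the restriction of \<open>B\<close> to \<open>\<aa>\<close>.\<close>

definition dual_eigenbases :: "('g::complex_lie_algebra \<Rightarrow> 'g \<Rightarrow> complex) \<Rightarrow> 'g set \<Rightarrow> 'g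
    \<Rightarrow> nat \<Rightarrow> (nat \<Rightarrow> 'g) \<Rightarrow> (nat \<Rightarrow> real) \<Rightarrow> (nat \<Rightarrow> 'g) \<Rightarrow> bool"
  where "dual_eigenbases B \<aa> x d u \<delta> u' \<longleftrightarrow>
      inj_on u {..<d} \<and> lie.independent (u ` {..<d}) \<and> lie.span (u ` {..<d}) = \<aa>
    \<and> (\<forall>i<d. u i \<in> ad_eigenspace x (\<delta> i))
    \<and> (\<forall>i<d. u' i \<in> \<aa>)
    \<and> (\<forall>i<d. \<forall>j<d. B (u i) (u' j) = (if i = j then 1 else 0))"

text \<open>In the following, \<open>M\<close> is the image of \<open>P\<close>, the algebra \<open>\<aa>\<close> with its basis \<open>u\<close> acts on \<open>M\<close> by \<open>\<phi>\<close>
  and by zero on the kernel of \<open>P\<close>. Coefficients are taken in \<open>U(\<gg>)\<close>, which contains \<open>U(\<aa>)\<close>.\<close>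

text \<open>The sign of \<open>D\<close> is the one for which Lax operators take values in the W-algebra formed from \<open>U(\<gg>)/J\<close> with \<open>J\<close>
  a left ideal, as in the work of De Sole, Kac and Valeri. The formula is also quoted as
  \<open>D = \<Sum> U\<^sup>i U\<^sub>i\<close> without the sign, but then the theorem fails, already for \<open>gl\<^sub>4\<close> and Jordan type
  \<open>(3, 1)\<close>.\<close>

definition lax_D :: "('g::complex_lie_algebra \<Rightarrow> complex^'n^'n)
    \<Rightarrow> nat \<Rightarrow> (nat \<Rightarrow> 'g) \<Rightarrow> (nat \<Rightarrow> real) \<Rightarrow> (nat \<Rightarrow> 'g) \<Rightarrow> complex^'n^'n"
  where "lax_D \<phi> d u \<delta> u' = - (\<Sum>i | i < d \<and> \<delta> i \<ge> 1. \<phi> (u' i) ** \<phi> (u i))"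

definition lax_Y :: "('g::complex_lie_algebra \<Rightarrow> complex^'n^'n) \<Rightarrow> complex^'n^'n \<Rightarrow> 'g
    \<Rightarrow> nat \<Rightarrow> (nat \<Rightarrow> 'g) \<Rightarrow> (nat \<Rightarrow> real) \<Rightarrow> (nat \<Rightarrow> 'g) \<Rightarrow> ('g uea fps)^'n^'n"
  where "lax_Y \<phi> P f d u \<delta> u' = scal_mat P + scal_mat (\<phi> f)
    + (\<Sum>i | i < d \<and> \<delta> i \<le> 1/2.
         tensor_mat (zinv (1 - \<delta> i) * fps_const (uea_gen (u i))) (\<phi> (u' i)))
    + tensor_mat (zinv 1) (lax_D \<phi> d u \<delta> u')"

text \<open>The two-sided inverse of an operator \<open>A\<close> from the image of \<open>P\<^sub>1\<close> to the image of \<open>P\<^sub>2\<close>.\<close>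

definition op_inverse :: "complex^'n^'n \<Rightarrow> complex^'n^'n
    \<Rightarrow> ('g::complex_lie_algebra uea fps)^'n^'n \<Rightarrow> ('g uea fps)^'n^'n"
  where "op_inverse P\<^sub>1 P\<^sub>2 A = (THE R. R = scal_mat P\<^sub>1 ** R ** scal_mat P\<^sub>2
    \<and> R ** A = scal_mat P\<^sub>1 \<and> A ** R = scal_mat P\<^sub>2)"

definition lax_R :: "('g::complex_lie_algebra \<Rightarrow> complex^'n^'n) \<Rightarrow> complex^'n^'n \<Rightarrow> 'g \<Rightarrow> 'g
    \<Rightarrow> nat \<Rightarrow> (nat \<Rightarrow> 'g) \<Rightarrow> (nat \<Rightarrow> real) \<Rightarrow> (nat \<Rightarrow> 'g) \<Rightarrow> ('g uea fps)^'n^'n"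
  where "lax_R \<phi> P f x d u \<delta> u' =
    (let h = top_weight P (\<phi> x);
         Y = lax_Y \<phi> P f d u \<delta> u';
         P_less = weight_proj P (\<phi> x) {..<h};
         P_gr = weight_proj P (\<phi> x) {-h<..};
         P_low = weight_proj P (\<phi> x) {-h}
     in op_inverse P_gr P_less (scal_mat P_less ** Y ** scal_mat P_gr)
        ** (scal_mat P_less ** Y ** scal_mat P_low))"

text \<open>The projection \<open>\<Pi>\<^sub>[\<^sub>-\<^sub>k\<^sub>,\<^sub>k\<^sub>]\<close> of \<open>V\<close>, and the element \<open>\<Pi>\<^sub>[\<^sub>-\<^sub>k\<^sub>,\<^sub>k\<^sub>] y \<Psi>\<^sub>[\<^sub>-\<^sub>k\<^sub>,\<^sub>k\<^sub>]\<close> of \<open>\<gg>\<close>, whenever that operator,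
  extended by zero, lies in \<open>\<gg>\<close>.\<close>

definition band_proj :: "('g::complex_lie_algebra \<Rightarrow> complex^'n^'n) \<Rightarrow> 'g \<Rightarrow> real \<Rightarrow> complex^'n^'n"
  where "band_proj \<phi> x k = weight_proj (mat 1) (\<phi> x) {-k..k}"

definition band :: "('g::complex_lie_algebra \<Rightarrow> complex^'n^'n) \<Rightarrow> 'g \<Rightarrow> real \<Rightarrow> 'g \<Rightarrow> 'g"
  where "band \<phi> x k y = inv \<phi> (band_proj \<phi> x k ** \<phi> y ** band_proj \<phi> x k)"

definition lax_kR :: "('g::complex_lie_algebra \<Rightarrow> complex^'n^'n) \<Rightarrow> 'g \<Rightarrow> 'g \<Rightarrow> real
    \<Rightarrow> nat \<Rightarrow> (nat \<Rightarrow> 'g) \<Rightarrow> (nat \<Rightarrow> real) \<Rightarrow> (nat \<Rightarrow> 'g) \<Rightarrow> ('g uea fps)^'n^'n"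
  where "lax_kR \<phi> f x k d u \<delta> u' =
    lax_R \<phi> (band_proj \<phi> x k) (band \<phi> x k f) (band \<phi> x k x) d u \<delta> u'"

section \<open>Highest and lowest weight vectors\<close>

definition highest_weight_vec :: "('g::complex_lie_algebra \<Rightarrow> complex^'n^'n) \<Rightarrow> 'g \<Rightarrow> 'g \<Rightarrow> real
    \<Rightarrow> complex^'n \<Rightarrow> bool"
  where "highest_weight_vec \<phi> x e j v \<longleftrightarrow>
    v \<noteq> 0 \<and> v \<in> weight_space (mat 1) (\<phi> x) j \<and> \<phi> e *v v = 0"

definition lowest_weight_vec :: "('g::complex_lie_algebra \<Rightarrow> complex^'n^'n) \<Rightarrow> 'g \<Rightarrow> 'g \<Rightarrow> real
    \<Rightarrow> complex^'n \<Rightarrow> bool"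
  where "lowest_weight_vec \<phi> f x j v \<longleftrightarrow>
    v \<noteq> 0 \<and> v \<in> weight_space (mat 1) (\<phi> x) j \<and> \<phi> f *v v = 0"

definition sl2_submodule :: "('g::complex_lie_algebra \<Rightarrow> complex^'n^'n) \<Rightarrow> 'g \<Rightarrow> 'g \<Rightarrow> 'g
    \<Rightarrow> (complex^'n) set \<Rightarrow> bool"
  where "sl2_submodule \<phi> f x e S \<longleftrightarrow>
    vec.subspace S \<and> (\<forall>y\<in>{f, x, e}. \<forall>v\<in>S. \<phi> y *v v \<in> S)"

definition sl2_irreducible :: "('g::complex_lie_algebra \<Rightarrow> complex^'n^'n) \<Rightarrow> 'g \<Rightarrow> 'g \<Rightarrow> 'g
    \<Rightarrow> (complex^'n) set \<Rightarrow> bool"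
  where "sl2_irreducible \<phi> f x e S \<longleftrightarrow> sl2_submodule \<phi> f x e S \<and> S \<noteq> {0}
    \<and> (\<forall>T. sl2_submodule \<phi> f x e T \<and> T \<subseteq> S \<longrightarrow> T = {0} \<or> T = S)"

definition isotypic :: "('g::complex_lie_algebra \<Rightarrow> complex^'n^'n) \<Rightarrow> 'g \<Rightarrow> 'g \<Rightarrow> 'g \<Rightarrow> real
    \<Rightarrow> (complex^'n) set"
  where "isotypic \<phi> f x e j = vec.span (\<Union>{S. sl2_irreducible \<phi> f x e S
    \<and> (\<exists>v\<in>S. highest_weight_vec \<phi> x e j v)})"

definition lowest_space :: "('g::complex_lie_algebra \<Rightarrow> complex^'n^'n) \<Rightarrow> 'g \<Rightarrow> 'g \<Rightarrow> real
    \<Rightarrow> (complex^'n) set"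
  where "lowest_space \<phi> f x j = vec.span {v. lowest_weight_vec \<phi> f x j v}"

definition proj_W :: "('g::complex_lie_algebra \<Rightarrow> complex^'n^'n) \<Rightarrow> 'g \<Rightarrow> 'g \<Rightarrow> 'g \<Rightarrow> real
    \<Rightarrow> complex^'n^'n"
  where "proj_W \<phi> f x e m = proj_along (lowest_space \<phi> f x (-m))
    (vec.span ((\<Union>j\<in>-{-m}. weight_space (mat 1) (\<phi> x) j)
      \<union> (weight_space (mat 1) (\<phi> x) (-m) \<inter> vec.span (\<Union>j\<in>-{m}. isotypic \<phi> f x e j))))"

end

theory Submission
  imports Defs
begin

text \<open>For \<open>w \<in> U\<close> let \<open>t s\<close> be the coefficient of \<open>z\<^sup>-\<^sup>s\<close> in \<open>w - L w\<close>. By the definition of \<open>L\<close>, the rows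
  of weight less than \<open>k\<close> of the Lax matrix annihilate this series, and since the leading coefficient
  of these rows is invertible, commutators with \<open>y \<in> \<gg>\<^sub>\<ge>\<^sub>1\<close> can be computed modulo \<open>J\<close> by induction on \<open>s\<close>.
  If \<open>y \<in> \<gg>\<^sup>k\<close> has degree \<open>j\<close>, then \<open>y t s \<equiv> (f | y) t s - \<phi> y (t (s - j))\<close>; the terms quadratic in the dual bases
  cancel against \<open>D\<close>. If the band component of \<open>y\<close> vanishes, then \<open>y t s \<equiv> (f | y) t s\<close>, because the part of
  \<open>f\<close> that leaves the band enters only through \<open>f w = 0\<close>. These two cases suffice: all weights of
  \<open>V\<close> are congruent modulo \<open>\<int>\<close>, so that \<open>\<gg>\<^sub>\<ge>\<^sub>1\<^sub>/\<^sub>2 = \<gg>\<^sub>\<ge>\<^sub>1\<close>, and \<open>\<gg>\<^sup>k\<close> is orthogonal to the elements without band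
  component. Finally, \<open>f\<close> is
  injective on \<open>V[-i]\<close> for \<open>m < i < k\<close>, so the component of \<open>t s\<close> in \<open>V[-i]\<close> vanishes for \<open>s > k - i\<close>. The
  component of \<open>\<phi> y (t (b - j))\<close> in \<open>W\<close> only involves these weights, and is therefore zero for \<open>b > k - m\<close>.\<close>

section \<open>Operators and projections\<close>

text \<open>The obstacle is noncommutativity: \<open>J\<close> is only a left ideal, so
  \<open>y\<close> has to be carried past the factors \<open>u i\<close> before it meets the series
  \<open>t\<close>. The brackets of \<open>y\<close> with \<open>u i\<close> created on the way
  again multiply coefficients of \<open>t\<close>, at exponents at most \<open>s - 1\<close>, so the
  induction must run over all admissible \<open>y\<close> simultaneously. If \<open>y\<close> lies
  in the band, invariance of the tensor of dual bases moves the bracket to the matrix side; only the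
  terms with 0 < \<delta> l \<le> j need the induction hypothesis, whose scalar part is matched by
  the commutator of \<phi> y with the leading coefficient and whose matrix part is matched by the
  commutator with \<open>D\<close>. The conditions \<open>sl_case\<close> and \<open>gl_case\<close>
  secure the two facts about truncation on which all this rests. Truncation preserves traceless
  matrices only if it is trivial. On gl an invariant form may contain a multiple of tr(y) tr(y'),
  under which 1 - P and P are not orthogonal; with a multiple of the trace form they are.\<close>

lemmas mult_mult_vec = matrix_vector_mul_assoc[symmetric]

lemma mat_mult_vec: "mat c *v v = c *s (v :: complex^'n)"
  by (simp add: vec_eq_iff matrix_vector_mult_def mat_def if_distrib if_distribR cong: if_cong)

lemma matrix_eqI_span:
  fixes A B :: "complex^'n^'n"
  assumes "\<And>v. v \<in> S \<Longrightarrow> A *v v = B *v v" "vec.span S = UNIV"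
  shows "A = B"
proof -
  have "A *v v = B *v v" for v
  proof -
    have "v \<in> vec.span S" using assms by simp
    then show ?thesis
      by (induction rule: vec.span_induct_alt)
        (simp_all add: assms(1) vec.add vec.scale)
  qed
  then show ?thesis by (simp add: matrix_eq)
qed

lemma span_subset_kernel:
  fixes A :: "complex^'n^'n"
  assumes "\<And>v. v \<in> S \<Longrightarrow> A *v v = 0" "v \<in> vec.span S"
  shows "A *v v = 0"
  using assms(2) by (induction rule: vec.span_induct_alt) (simp_all add: assms(1) vec.add vec.scale)

lemma span_subset_fixed:
  fixes A :: "complex^'n^'n"
  assumes "\<And>v. v \<in> S \<Longrightarrow> A *v v = v" "v \<in> vec.span S"
  shows "A *v v = v"
  using assms(2) by (induction rule: vec.span_induct_alt) (simp_all add: assms(1) vec.add vec.scale)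

lemma proj_along_eqI:
  fixes P :: "complex^'n^'n"
  assumes "\<And>v. v \<in> R \<Longrightarrow> P *v v = v" "\<And>v. v \<in> K \<Longrightarrow> P *v v = 0" "vec.span (R \<union> K) = UNIV"
  shows "proj_along R K = P"
  unfolding proj_along_def
proof (rule the_equality)
  show "Q = P" if "(\<forall>v\<in>R. Q *v v = v) \<and> (\<forall>v\<in>K. Q *v v = 0)" for Q
    by (rule matrix_eqI_span[OF _ assms(3)]) (use assms that in auto)
qed (use assms in auto)

section \<open>Products of linear factors of an operator\<close>

fun lin_prod :: "complex^'n^'n \<Rightarrow> complex list \<Rightarrow> complex^'n^'n" where
  "lin_prod A [] = mat 1"
| "lin_prod A (a # L) = (A - mat a) ** lin_prod A L"

lemma lin_prod_append: "lin_prod A (K @ L) = lin_prod A K ** lin_prod A L"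
  by (induction K) (simp_all add: matrix_mul_assoc)

lemma lin_factor_mult: "(A - mat a) *v v = A *v v - a *s (v :: complex^'n)"
  by (simp add: matrix_vector_mult_diff_rdistrib mat_mult_vec)

lemma lin_prod_commute_factor: "lin_prod A L *v (A *v v) = A *v (lin_prod A L *v (v :: complex^'n))"
  by (induction L)
    (simp_all add: mult_mult_vec lin_factor_mult vec.diff vec.scale)

lemma lin_prod_commute: "lin_prod A K *v (lin_prod A L *v v) = lin_prod A L *v (lin_prod A K *v v)"
proof (induction K)
  case (Cons a K)
  then show ?case
    by (simp add: mult_mult_vec lin_factor_mult vec.diff vec.scale
        lin_prod_commute_factor)
qed simp

lemma lin_prod_eigen:
  assumes "A *v v = a *s (v :: complex^'n)"
  shows "lin_prod A L *v v = (\<Prod>c\<leftarrow>L. a - c) *s v"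
proof (induction L)
  case (Cons c L)
  then show ?case
    by (simp add: mult_mult_vec lin_factor_mult vec.scale assms
        mult.commute left_diff_distrib vec.scale_left_diff_distrib)
qed simp

text \<open>Apply the factors of the annihilating product to \<open>v\<close> one at a time. The
  vector starts outside \<open>S\<close> and ends at 0, so some factor \<open>A - mat a\<close>
  carries it into \<open>S\<close>; the vector just before is an eigenvector modulo
  \<open>S\<close>.\<close>

lemma eigenvector_modulo:
  fixes A :: "complex^'n^'n"
  assumes "\<And>v. v \<in> T \<Longrightarrow> A *v v \<in> T" "vec.subspace T" "vec.subspace S"
    "\<And>v. lin_prod A L *v v = 0" "v \<in> T" "v \<notin> S"
  shows "\<exists>w a. w \<in> T \<and> w \<notin> S \<and> a \<in> set L \<and> A *v w - a *s w \<in> S"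
proof -
  have *: "lin_prod A L *v v \<in> T" for L
  proof (induction L)
    case (Cons a L)
    then show ?case using assms(1)[OF Cons] assms(2)
      by (simp add: mult_mult_vec lin_factor_mult vec.subspace_diff vec.subspace_scale)
  qed (simp add: assms)
  have "lin_prod A L *v v \<in> S \<Longrightarrow> ?thesis"
  proof (induction L)
    case Nil
    then show ?case using assms by simp
  next
    case (Cons a L)
    show ?case
    proof (cases "lin_prod A L *v v \<in> S")
      case True
      with Cons show ?thesis by auto
    next
      case False
      then show ?thesis using Cons(2) *[of L]
        by (intro exI[of _ "lin_prod A L *v v"] exI[of _ a])
          (simp add: mult_mult_vec lin_factor_mult)
    qed
  qed
  then show ?thesis using assms(3,4) by (simp add: vec.subspace_0)
qed

lemma matrix_pow_linear:
  fixes A :: "complex^'n^'n"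
  shows "((*v) A ^^ n) (v + w) = ((*v) A ^^ n) v + ((*v) A ^^ n) w"
    and "((*v) A ^^ n) (v - w) = ((*v) A ^^ n) v - ((*v) A ^^ n) w"
    and "((*v) A ^^ n) (c *s v) = c *s ((*v) A ^^ n) v"
    and "((*v) A ^^ n) 0 = 0"
  by (induction n) (simp_all add: vec.add vec.diff vec.scale)

section \<open>Representations of \<open>sl\<^sub>2\<close>\<close>

text \<open>\<open>X\<close> is half of the usual Cartan element. Diagonalizability of
  \<open>X\<close>, reality of its eigenvalues, nilpotency of \<open>E\<close> and complete
  reducibility are derived from these relations.\<close>

locale sl2_rep =
  fixes F X E :: "complex^'n^'n"
  assumes XE: "X *v (E *v v) = E *v (X *v v) + E *v v"
    and XF: "X *v (F *v v) = F *v (X *v v) - F *v v"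
    and EF: "E *v (F *v v) = F *v (E *v v) + 2 *s (X *v v)"
    and F_nilpotent: "\<exists>N. \<forall>v. ((*v) F ^^ N) v = 0"
begin

abbreviation "FF n \<equiv> (*v) F ^^ n"
abbreviation "EE n \<equiv> (*v) E ^^ n"

lemma X_FF: "X *v FF n v = FF n (X *v v) - of_nat n *s FF n v"
  by (induction n) (simp_all add: XF vec.diff vec.scale vec.scale_left_distrib)

lemma X_EE: "X *v EE n v = EE n (X *v v) + of_nat n *s EE n v"
  by (induction n) (simp_all add: XE vec.add vec.scale vec.scale_left_distrib)

lemma E_FF:
  "E *v FF (Suc n) v
     = FF (Suc n) (E *v v) + of_nat (Suc n) *s (2 *s FF n (X *v v) - of_nat n *s FF n v)"
proof (induction n)
  case 0
  show ?case by (simp add: EF)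
next
  case (Suc n)
  have "E *v FF (Suc (Suc n)) v = F *v (E *v FF (Suc n) v) + 2 *s (X *v FF (Suc n) v)"
    by (simp add: EF)
  also have "\<dots> = FF (Suc (Suc n)) (E *v v)
      + of_nat (Suc n) *s (2 *s FF (Suc n) (X *v v) - of_nat n *s FF (Suc n) v)
      + 2 *s (FF (Suc n) (X *v v) - of_nat (Suc n) *s FF (Suc n) v)"
    unfolding Suc X_FF[of "Suc n"] by (simp add: vec.add vec.diff vec.scale)
  also have "\<dots> = FF (Suc (Suc n)) (E *v v)
      + of_nat (Suc (Suc n)) *s (2 *s FF (Suc n) (X *v v) - of_nat (Suc n) *s FF (Suc n) v)"
    by (simp add: vec_eq_iff algebra_simps)
  finally show ?case .
qed

lemma E_lin_prod:
  "E *v (lin_prod X (map complex_of_real L) *v v)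
     = lin_prod X (map complex_of_real (map (\<lambda>a. a + 1) L)) *v (E *v v)"
proof (induction L)
  case (Cons a L)
  have "E *v (X *v u) = X *v (E *v u) - E *v u" for u
    by (simp add: XE)
  then show ?case using Cons
    by (simp add: mult_mult_vec lin_factor_mult vec.diff vec.scale
      vec.scale_left_distrib)
qed simp

text \<open>Descending induction on the power of F that kills the image of a product p(X) with real
  roots, starting at F^N = 0 with p = 1. If F^(a+1) p(X) = 0, then the formula for E F^(a+1) gives
  F^a (X - a/2) p(X) p(X+1) = 0.\<close>

lemma X_annihilated: "\<exists>L. \<forall>v. lin_prod X (map complex_of_real L) *v v = 0"
proof -
  obtain N where N: "\<And>v. FF N v = 0"
    using F_nilpotent by blast
  have "\<forall>L. (\<forall>v. FF a (lin_prod X (map complex_of_real L) *v v) = 0) \<longrightarrow> ?thesis" for a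
  proof (induction a)
    case 0
    then show ?case by auto
  next
    case (Suc a)
    let ?p = "\<lambda>L v. lin_prod X (map complex_of_real L) *v v"
    show ?case
    proof (intro allI impI)
      fix L :: "real list"
      \<comment> \<open>The roots of p(X+1). Moving E to the left of this factor turns it into p(X),
        so F^(a+1) still kills the term in which E acts first.\<close>
      let ?L1 = "map (\<lambda>a. a - 1) L"
      assume L: "\<forall>v. FF (Suc a) (?p L v) = 0"
      have "FF a (?p ((of_nat a / 2) # L @ ?L1) v) = 0" for v
      proof -
        have "E *v (?p (L @ ?L1) v) = ?p (map (\<lambda>a. a + 1) L @ L) (E *v v)"
          unfolding E_lin_prod by (simp add: o_def)
        also have "\<dots> = ?p L (?p (map (\<lambda>a. a + 1) L) (E *v v))"
          by (simp add: lin_prod_append mult_mult_vec lin_prod_commute)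
        finally have *: "FF (Suc a) (E *v (?p (L @ ?L1) v)) = 0"
          using L by metis
        have "FF (Suc a) (?p (L @ ?L1) v) = 0"
          using L by (simp add: lin_prod_append mult_mult_vec)
        then have "0 = E *v FF (Suc a) (?p (L @ ?L1) v)"
          by simp
        also have "\<dots> = of_nat (Suc a) *s
            (2 *s FF a (X *v ?p (L @ ?L1) v) - of_nat a *s FF a (?p (L @ ?L1) v))"
          unfolding E_FF[of a] * by simp
        also have "\<dots> = (of_nat (Suc a) * 2) *s FF a (?p ((of_nat a / 2) # L @ ?L1) v)"
          by (simp add: mult_mult_vec lin_factor_mult matrix_pow_linear
              vec.scale_right_diff_distrib)
        finally have "(of_nat (Suc a) * 2) *s FF a (?p ((of_nat a / 2) # L @ ?L1) v) = 0"
          by (rule sym)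
        then show ?thesis
          using of_nat_neq_0[of a, where 'a=complex] by (simp only: vec.scale_eq_0_iff mult_eq_0_iff) simp
      qed
      then show "\<exists>L. \<forall>v. ?p L v = 0" using Suc by blast
    qed
  qed
  from this[of N] show ?thesis by (metis N)
qed

text \<open>A finite list of reals containing every eigenvalue of \<open>X\<close>, possibly with
  further entries; it serves as a finite index set for weights.\<close>

definition "evs = (SOME L. \<forall>v. lin_prod X (map complex_of_real L) *v v = 0)"

lemma lin_prod_evs: "lin_prod X (map complex_of_real evs) *v v = 0"
  using someI_ex[OF X_annihilated] unfolding evs_def by blast

lemma eigenvalue_modulo:
  assumes "vec.subspace S" "\<And>v. v \<in> S \<Longrightarrow> X *v v \<in> S" "w \<notin> S" "X *v w - c *s w \<in> S"
  shows "c \<in> complex_of_real ` set evs"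
proof -
  have "lin_prod X L *v w - (\<Prod>a\<leftarrow>L. c - a) *s w \<in> S" for L
  proof (induction L)
    case Nil
    then show ?case using assms by (simp add: vec.subspace_0)
  next
    case (Cons a L)
    let ?q = "\<Prod>a\<leftarrow>L. c - a"
    have "lin_prod X (a # L) *v w - (\<Prod>a\<leftarrow>a # L. c - a) *s w
      = (X *v (lin_prod X L *v w - ?q *s w) - a *s (lin_prod X L *v w - ?q *s w))
        + ?q *s (X *v w - c *s w)"
      by (simp add: mult_mult_vec lin_factor_mult vec.diff vec.scale
          mat_mult_vec vec_eq_iff algebra_simps)
    also have "\<dots> \<in> S"
      by (rule vec.subspace_add[OF assms(1) vec.subspace_diff[OF assms(1) assms(2)[OF Cons]
            vec.subspace_scale[OF assms(1) Cons]] vec.subspace_scale[OF assms(1,4)]])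
    finally show ?case .
  qed
  from this[of "map complex_of_real evs"]
  have "(\<Prod>a\<leftarrow>map complex_of_real evs. c - a) *s w \<in> S"
    using assms(1) vec.subspace_neg by (fastforce simp: lin_prod_evs)
  then have "(\<Prod>a\<leftarrow>map complex_of_real evs. c - a) = 0"
    using assms(1,3) vec.subspace_scale[of S _ "inverse (\<Prod>a\<leftarrow>map complex_of_real evs. c - a)"]
    by (metis vec.scale_scale left_inverse vec.scale_one)
  then show ?thesis by (auto simp: prod_list_zero_iff)
qed

lemma eigenvalue:
  assumes "v \<noteq> 0" "X *v v = c *s v" shows "c \<in> complex_of_real ` set evs"
  using eigenvalue_modulo[of "{0}" v c] assms by (simp add: vec.subspace_single_0)

text \<open>The integrality argument for highest weights, carried out in V/S without forming the
  quotient: if F^N w is the last power outside \<open>S\<close>, then (N+1)(2c - N) F^N w lies in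
  \<open>S\<close>.\<close>

lemma hw_modulo:
  assumes S: "vec.subspace S" "\<And>v. v \<in> S \<Longrightarrow> F *v v \<in> S" "\<And>v. v \<in> S \<Longrightarrow> E *v v \<in> S"
    and w: "w \<notin> S" "E *v w \<in> S" "X *v w - c *s w \<in> S"
  shows "\<exists>N. 2 * c = of_nat N \<and> FF N w \<notin> S \<and> FF (Suc N) w \<in> S"
proof -
  have F: "FF n v \<in> S" if "v \<in> S" for n v
    using that by (induction n) (auto intro: S)
  have "\<exists>n. FF n w \<in> S"
    using F_nilpotent vec.subspace_0[OF S(1)] by metis
  then obtain N where N: "FF N w \<notin> S" "FF (Suc N) w \<in> S"
    using exists_least_lemma[of "\<lambda>n. FF n w \<in> S"] w(1) by auto
  have "of_nat (Suc N) *s (2 *s FF N (X *v w) - of_nat N *s FF N w)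
      = E *v FF (Suc N) w - FF (Suc N) (E *v w)"
    unfolding E_FF by simp
  also have "\<dots> \<in> S"
    by (rule vec.subspace_diff[OF S(1) S(3)[OF N(2)] F[OF w(2)]])
  finally have "inverse (of_nat (Suc N)) *s (of_nat (Suc N) *s (2 *s FF N (X *v w) - of_nat N *s FF N w)) \<in> S"
    by (rule vec.subspace_scale[OF S(1)])
  then have "2 *s FF N (X *v w) - of_nat N *s FF N w \<in> S"
    by (simp only: vec.scale_scale) (simp del: of_nat_Suc)
  then have "(2 *s FF N (X *v w) - of_nat N *s FF N w) - 2 *s FF N (X *v w - c *s w) \<in> S"
    by (rule vec.subspace_diff[OF S(1) _ vec.subspace_scale[OF S(1) F[OF w(3)]]])
  also have "(2 *s FF N (X *v w) - of_nat N *s FF N w) - 2 *s FF N (X *v w - c *s w)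
      = (2 * c - of_nat N) *s FF N w"
    by (simp add: matrix_pow_linear vec_eq_iff algebra_simps)
  finally have "2 * c = of_nat N"
    using N(1) vec.subspace_scale[OF S(1), of _ "inverse (2 * c - of_nat N)"]
    by (metis vec.scale_scale left_inverse vec.scale_one eq_iff_diff_eq_0)
  with N show ?thesis by blast
qed

lemma hw_string:
  assumes "E *v v = 0" "X *v v = c *s v" "v \<noteq> 0"
  shows "\<exists>N. 2 * c = of_nat N \<and> FF N v \<noteq> 0 \<and> FF (Suc N) v = 0"
  using hw_modulo[of "{0}" v c] assms by (simp add: vec.subspace_single_0)

lemma FF_eq_0_mono: "FF n v = 0 \<Longrightarrow> n \<le> n' \<Longrightarrow> FF n' v = 0"
  by (auto simp: le_iff_add funpow_add add.commute[of n] matrix_pow_linear(4))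

text \<open>Compare the last nonzero powers F^N w and F^M v. The commutation formula gives (M - N)
  F^N w + 2 F^N v = 0. Here F^(N+1) v = 0 excludes N < M, the case N = M forces F^N v = 0, and N > M
  forces F^N w = 0.\<close>

lemma no_jordan_block:
  assumes "E *v w = 0" "X *v w = c *s w + v" "X *v v = c *s v" "E *v v = 0"
  shows "v = 0"
proof (rule ccontr)
  assume "v \<noteq> 0"
  then obtain M where M: "2 * c = of_nat M" "FF M v \<noteq> 0" "FF (Suc M) v = 0"
    using hw_string assms by blast
  have "w \<noteq> 0" using assms \<open>v \<noteq> 0\<close> by auto
  moreover have "\<exists>n. FF n w = 0" using F_nilpotent by metis
  ultimately obtain N where N: "FF N w \<noteq> 0" "FF (Suc N) w = 0"
    using exists_least_lemma[of "\<lambda>n. FF n w = 0"] by auto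
  have "FF (Suc N) (X *v w) = 0"
    using X_FF[of "Suc N" w] N(2) by simp
  then have v0: "FF (Suc N) v = 0"
    using N(2) unfolding assms(2) matrix_pow_linear by simp
  have "of_nat (Suc N) *s (2 *s FF N (X *v w) - of_nat N *s FF N w) = 0"
    using E_FF[of N w] N(2) assms(1) matrix_pow_linear(4)[of "Suc N" F] by simp
  then have "2 *s FF N (X *v w) - of_nat N *s FF N w = 0"
    by (simp only: vec.scale_eq_0_iff of_nat_eq_0_iff) simp
  then have *: "(of_nat M - of_nat N) *s FF N w + 2 *s FF N v = 0"
    unfolding assms(2) matrix_pow_linear M(1)[symmetric] by (simp add: vec_eq_iff algebra_simps)
  show False
  proof (cases "N \<le> M")
    case True
    with v0 M(2) have "N = M" using FF_eq_0_mono[of "Suc N" v M] by force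
    with * M(2) show False by simp
  next
    case False
    then have "FF N v = 0" using M(3) FF_eq_0_mono[of "Suc M" v N] by simp
    with * N(1) False show False by simp
  qed
qed

end

lemma minus_mult_vec: "(- A) *v v = - (A *v (v :: complex^'n))"
  using matrix_vector_mult_diff_rdistrib[of 0 A v] by simp

lemma sum_mult_vec: "(\<Sum>i\<in>I. A i) *v v = (\<Sum>i\<in>I. A i *v (v :: complex^'n))"
  by (induction I rule: infinite_finite_induct) (simp_all add: matrix_vector_mult_add_rdistrib)

section \<open>Complete reducibility: strings below highest weight vectors span V\<close>

context sl2_rep begin

definition strings :: "(complex^'n) set" where
  "strings = {FF n v | n v l. E *v v = 0 \<and> X *v v = complex_of_real l *s v}"

lemma X_string:
  assumes "X *v v = complex_of_real l *s v"
  shows "X *v FF n v = complex_of_real (l - real n) *s FF n v"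
  by (simp add: X_FF assms matrix_pow_linear vec.scale_left_diff_distrib)

lemma E_string:
  assumes "E *v v = 0" "X *v v = complex_of_real l *s v"
  shows "E *v FF (Suc n) v = (of_nat (Suc n) * complex_of_real (2 * l - real n)) *s FF n v"
  unfolding E_FF assms matrix_pow_linear by (simp add: vec_eq_iff algebra_simps)

lemma hw_string_real:
  assumes "E *v v = 0" "X *v v = complex_of_real l *s v" "v \<noteq> 0"
  shows "\<exists>N. 2 * l = real N \<and> FF N v \<noteq> 0 \<and> FF (Suc N) v = 0"
proof -
  obtain N where N: "2 * complex_of_real l = of_nat N" "FF N v \<noteq> 0" "FF (Suc N) v = 0"
    using hw_string[OF assms] by blast
  have "complex_of_real (2 * l) = complex_of_real (real N)"
    using N(1) by simp
  then show ?thesis using N by (metis of_real_eq_iff)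
qed

lemma string_bound:
  assumes "E *v v = 0" "X *v v = complex_of_real l *s v" "FF n v \<noteq> 0"
  shows "real n \<le> 2 * l" "2 * l \<in> \<nat>"
proof -
  have "v \<noteq> 0" using assms(3) by (auto simp: matrix_pow_linear)
  then obtain N where N: "2 * l = real N" "FF N v \<noteq> 0" "FF (Suc N) v = 0"
    using hw_string_real assms by blast
  show "real n \<le> 2 * l"
    using N assms(3) FF_eq_0_mono[of "Suc N" v n] by (metis not_less_eq_eq of_nat_le_iff)
  show "2 * l \<in> \<nat>" using N(1) by simp
qed

lemma span_strings_closed:
  assumes "w \<in> vec.span strings"
  shows "F *v w \<in> vec.span strings" "X *v w \<in> vec.span strings" "E *v w \<in> vec.span strings"
proof -
  have *: "A *v w \<in> vec.span strings" if "\<And>u. u \<in> strings \<Longrightarrow> A *v u \<in> vec.span strings" for A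
    using assms
    by (induction rule: vec.span_induct_alt)
      (auto simp: vec.add vec.scale vec.span_zero intro!: vec.span_add vec.span_scale that)
  show "F *v w \<in> vec.span strings"
  proof (rule *)
    fix u assume "u \<in> strings"
    then obtain n v l where u: "u = FF n v" "E *v v = 0" "X *v v = complex_of_real l *s v"
      unfolding strings_def by blast
    then have "F *v u = FF (Suc n) v" by simp
    then show "F *v u \<in> vec.span strings"
      using u by (intro vec.span_base) (auto simp: strings_def simp del: funpow.simps)
  qed
  show "X *v w \<in> vec.span strings"
  proof (rule *)
    fix u assume u: "u \<in> strings"
    then obtain i where i: "X *v u = complex_of_real i *s u"
      unfolding strings_def using X_string by blast
    show "X *v u \<in> vec.span strings"
      unfolding i using u by (intro vec.span_scale vec.span_base)
  qed
  show "E *v w \<in> vec.span strings"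
  proof (rule *)
    fix u assume "u \<in> strings"
    then obtain n v l where u: "u = FF n v" "E *v v = 0" "X *v v = complex_of_real l *s v"
      unfolding strings_def by blast
    show "E *v u \<in> vec.span strings"
    proof (cases n)
      case 0
      then show ?thesis using u by (simp add: vec.span_zero)
    next
      case (Suc n')
      have "FF n' v \<in> strings" using u unfolding strings_def by blast
      then show ?thesis unfolding u(1) Suc E_string[OF u(2,3)]
        by (intro vec.span_scale vec.span_base)
    qed
  qed
qed

text \<open>Up to a nonzero factor, the projection onto the eigenspace of \<open>X\<close> for \<open>j\<close>.\<close>

definition evpr :: "real \<Rightarrow> complex^'n^'n" where
  "evpr j = lin_prod X (map complex_of_real (filter (\<lambda>a. a \<noteq> j) evs))"

definition evc :: "real \<Rightarrow> complex" where
  "evc j = (\<Prod>c\<leftarrow>map complex_of_real (filter (\<lambda>a. a \<noteq> j) evs). complex_of_real j - c)"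

lemma evc_nonzero: "evc j \<noteq> 0"
  unfolding evc_def by (auto simp: prod_list_zero_iff)

lemma real_eigenvalue: "v \<noteq> 0 \<Longrightarrow> X *v v = complex_of_real i *s v \<Longrightarrow> i \<in> set evs"
  using eigenvalue by fastforce

lemma evpr_eigen:
  assumes "X *v v = complex_of_real i *s v"
  shows "evpr j *v v = (if i = j then evc j *s v else 0)"
proof (cases "v = 0 \<or> i = j")
  case True
  then show ?thesis using lin_prod_eigen[OF assms] by (auto simp: evpr_def evc_def)
next
  case False
  then have "(\<Prod>c\<leftarrow>map complex_of_real (filter (\<lambda>a. a \<noteq> j) evs). complex_of_real i - c) = 0"
    using real_eigenvalue[OF _ assms] by (auto simp: prod_list_zero_iff)
  then show ?thesis
    using lin_prod_eigen[OF assms] False by (simp add: evpr_def)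
qed

text \<open>\<open>evpr c\<close> annihilates the image of X - c on the span, since strings consist
  of eigenvectors, but multiplies the eigenvector \<open>p\<close> by a nonzero scalar.\<close>

lemma span_strings_semisimple:
  assumes "q \<in> vec.span strings" "p = X *v q - complex_of_real c *s q" "X *v p = complex_of_real c *s p"
  shows "p = 0"
proof -
  have "(evpr c ** (X - mat (complex_of_real c))) *v q = 0"
  proof (rule span_subset_kernel[OF _ assms(1)])
    fix u assume "u \<in> strings"
    then obtain i where u: "X *v u = complex_of_real i *s u"
      unfolding strings_def using X_string by blast
    show "(evpr c ** (X - mat (complex_of_real c))) *v u = 0"
      by (simp add: mult_mult_vec lin_factor_mult u vec.diff vec.scale evpr_eigen[OF u])
  qed
  then have "evpr c *v p = 0"
    by (simp add: mult_mult_vec lin_factor_mult assms(2))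
  then show ?thesis
    unfolding evpr_eigen[OF assms(3)] using evc_nonzero[of c] by simp
qed

lemma span_strings_split:
  assumes "s \<in> vec.span strings"
  shows "\<exists>u r. u \<in> vec.span strings \<and> r \<in> vec.span strings
    \<and> s = (X *v u - complex_of_real c *s u) + r \<and> X *v r = complex_of_real c *s r"
  using assms
proof (induction rule: vec.span_induct_alt)
  case base
  show ?case by (rule exI[of _ 0], rule exI[of _ 0]) (simp add: vec.span_zero)
next
  case (step a x y)
  then obtain u r where ur: "u \<in> vec.span strings" "r \<in> vec.span strings"
    "y = (X *v u - complex_of_real c *s u) + r" "X *v r = complex_of_real c *s r"
    by blast
  obtain i where i: "X *v x = complex_of_real i *s x"
    using step(1) unfolding strings_def using X_string by blast
  have x: "x \<in> vec.span strings" using step(1) by (rule vec.span_base)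
  show ?case
  proof (cases "i = c")
    case True
    show ?thesis
      by (rule exI[of _ u], rule exI[of _ "a *s x + r"])
        (use ur i True x in \<open>auto simp: vec.add vec.scale vec.scale_right_distrib mult.commute
          intro!: vec.span_add vec.span_scale\<close>)
  next
    case False
    let ?k = "a / (complex_of_real i - complex_of_real c)"
    have "a *s x = (X *v (?k *s x) - complex_of_real c *s (?k *s x))"
    proof -
      have "?k * (complex_of_real i - complex_of_real c) = a" using False by simp
      then have "a = ?k * complex_of_real i - complex_of_real c * ?k" by (simp only: algebra_simps)
      then have "a *s x = (?k * complex_of_real i - complex_of_real c * ?k) *s x" by (rule arg_cong)
      then show ?thesis by (simp only: vec.scale i vec.scale_left_diff_distrib vec.scale_scale)
    qed
    then show ?thesis
      by (intro exI[of _ "?k *s x + u"] exI[of _ r])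
        (use ur x in \<open>auto simp: vec.add vec.scale_right_distrib intro!: vec.span_add vec.span_scale\<close>)
  qed
qed

text \<open>A string vector F^n v of positive weight is not the bottom of its string, because the
  bottom has weight -l \<le> 0. So E maps F^(n+1) v to a nonzero multiple of it.\<close>

lemma span_strings_E_surj:
  assumes q: "q \<in> vec.span strings" "X *v q = complex_of_real c *s q" and "c > 0"
  shows "\<exists>u. u \<in> vec.span strings \<and> X *v u = complex_of_real (c - 1) *s u \<and> E *v u = q"
proof -
  have "\<exists>u. u \<in> vec.span strings \<and> X *v u = complex_of_real (c - 1) *s u \<and> E *v u = evpr c *v q"
    using q(1)
  proof (induction rule: vec.span_induct_alt)
    case base
    show ?case by (rule exI[of _ 0]) (simp add: vec.span_zero)
  next
    case (step a x y)
    then obtain u where u: "u \<in> vec.span strings" "X *v u = complex_of_real (c - 1) *s u"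
      "E *v u = evpr c *v y"
      by blast
    obtain n v l where x: "x = FF n v" "E *v v = 0" "X *v v = complex_of_real l *s v"
      using step(1) unfolding strings_def by blast
    note Xx = X_string[OF x(3), of n, folded x(1)]
    show ?case
    proof (cases "l - real n = c \<and> x \<noteq> 0")
      case False
      then have "evpr c *v x = 0" using evpr_eigen[OF Xx, of c] by auto
      then show ?thesis using u by (intro exI[of _ u]) (simp add: vec.add vec.scale)
    next
      case True
      have "2 * l \<noteq> real n"
        using string_bound(1)[OF x(2,3), of n] True \<open>c > 0\<close> x(1) by auto
      then have nz: "of_nat (Suc n) * complex_of_real (2 * l - real n) \<noteq> 0"
        by (simp only: mult_eq_0_iff of_nat_eq_0_iff of_real_eq_0_iff) simp
      let ?k = "a * evc c / (of_nat (Suc n) * complex_of_real (2 * l - real n))"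
      have "FF (Suc n) v \<in> vec.span strings"
        by (rule vec.span_base) (use x in \<open>auto simp: strings_def simp del: funpow.simps\<close>)
      moreover have "X *v FF (Suc n) v = complex_of_real (c - 1) *s FF (Suc n) v"
        using X_string[OF x(3), of "Suc n"] True by (simp add: algebra_simps)
      moreover have "E *v (?k *s FF (Suc n) v) = a *s (evpr c *v x)"
        unfolding vec.scale E_string[OF x(2,3)] evpr_eigen[OF Xx] x(1)[symmetric]
        using nz True by simp
      ultimately obtain x' where "x' \<in> vec.span strings"
        "X *v x' = complex_of_real (c - 1) *s x'" "E *v x' = a *s (evpr c *v x)"
        by (metis vec.span_scale vec.scale vec.scale_left_commute)
      then show ?thesis using u
        by (intro exI[of _ "x' + u"]) (simp add: vec.add vec.scale vec.span_add vec.scale_right_distrib)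
    qed
  qed
  then obtain u where u: "u \<in> vec.span strings" "X *v u = complex_of_real (c - 1) *s u"
      "E *v u = evpr c *v q"
    by blast
  show ?thesis
    by (rule exI[of _ "inverse (evc c) *s u"])
      (use u evc_nonzero[of c] in \<open>simp add: vec.scale evpr_eigen[OF q(2)] vec.span_scale mult.commute
      right_diff_distrib vec.scale_left_diff_distrib\<close>)
qed

text \<open>Take \<open>w\<close> outside the span whose weight modulo the span is maximal; then E w
  lies in the span. Two corrections of \<open>w\<close> by elements of the span make X w2 - a w2 an
  eigenvector for \<open>a\<close> and E w2 zero. Without Jordan blocks \<open>w2\<close> is a
  genuine highest weight vector, hence itself a string vector, a contradiction.\<close>

theorem span_strings: "vec.span strings = UNIV"
proof (rule ccontr)
  let ?V = "vec.span strings"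
  assume "?V \<noteq> UNIV"
  then obtain v where v: "v \<notin> ?V" by blast
  define \<Lambda> where "\<Lambda> = {a \<in> set evs. \<exists>w. w \<notin> ?V \<and> X *v w - complex_of_real a *s w \<in> ?V}"
  have "\<Lambda> \<noteq> {}"
    using eigenvector_modulo[of UNIV X ?V "map complex_of_real evs" v] v lin_prod_evs
    by (fastforce simp: \<Lambda>_def)
  moreover have "finite \<Lambda>" unfolding \<Lambda>_def by simp
  ultimately have max: "Max \<Lambda> \<in> \<Lambda>" by (rule Max_in[rotated])
  define a where "a = Max \<Lambda>"
  obtain w where w: "w \<notin> ?V" "X *v w - complex_of_real a *s w \<in> ?V"
    using max unfolding a_def \<Lambda>_def by blast
  have Ew: "E *v w \<in> ?V"
  proof (rule ccontr)
    assume n: "E *v w \<notin> ?V"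
    have "X *v (E *v w) - complex_of_real (a + 1) *s (E *v w) = E *v (X *v w - complex_of_real a *s w)"
      by (simp add: XE vec.diff vec.scale vec.scale_left_distrib)
    also have "\<dots> \<in> ?V" using w(2) by (rule span_strings_closed)
    finally have *: "X *v (E *v w) - complex_of_real (a + 1) *s (E *v w) \<in> ?V" .
    then have "a + 1 \<in> set evs"
      using eigenvalue_modulo[OF vec.subspace_span span_strings_closed(2) n *]
      by (metis imageE of_real_eq_iff)
    then have "a + 1 \<in> \<Lambda>" using n * unfolding \<Lambda>_def by blast
    then show False using \<open>finite \<Lambda>\<close> Max_ge[of \<Lambda> "a + 1"] unfolding a_def by simp
  qed
  obtain N where "2 * complex_of_real a = of_nat N"
    using hw_modulo[OF vec.subspace_span span_strings_closed(1,3) w(1) Ew w(2)] by blast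
  then have "complex_of_real (2 * a) = complex_of_real (real N)" by simp
  then have a0: "a \<ge> 0" by (simp only: of_real_eq_iff)
  obtain u r where ur: "u \<in> ?V" "r \<in> ?V" "X *v w - complex_of_real a *s w
      = (X *v u - complex_of_real a *s u) + r" "X *v r = complex_of_real a *s r"
    using span_strings_split[OF w(2)] by blast
  define w1 where "w1 = w - u"
  have w1: "X *v w1 = complex_of_real a *s w1 + r"
    using ur(3) by (simp add: w1_def vec.diff algebra_simps vec.scale_right_diff_distrib)
  have Ew1: "E *v w1 \<in> ?V"
    unfolding w1_def vec.diff by (intro vec.span_diff Ew span_strings_closed ur)
  have Er: "E *v r = X *v (E *v w1) - complex_of_real (a + 1) *s (E *v w1)"
    by (simp add: XE w1 vec.add vec.scale vec.scale_left_distrib)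
  have "X *v (E *v r) = complex_of_real (a + 1) *s (E *v r)"
    by (simp add: XE ur(4) vec.scale vec.scale_left_distrib)
  \<comment> \<open>\<open>E *v r\<close> has weight a + 1 and also lies in the image of X - (a + 1)
    on the span, where X is semisimple.\<close>
  then have Er0: "E *v r = 0"
    using span_strings_semisimple[OF Ew1 Er] by simp
  then have "X *v (E *v w1) = complex_of_real (a + 1) *s (E *v w1)"
    using Er by simp
  from span_strings_E_surj[OF Ew1 this] a0
  obtain u' where u': "u' \<in> ?V" "X *v u' = complex_of_real a *s u'" "E *v u' = E *v w1"
    by auto
  define w2 where "w2 = w1 - u'"
  have E2: "E *v w2 = 0" by (simp add: w2_def vec.diff u')
  have X2: "X *v w2 = complex_of_real a *s w2 + r"
    by (simp add: w2_def vec.diff u' w1 vec.scale_right_diff_distrib)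
  have "r = 0" using no_jordan_block[OF E2 X2 ur(4) Er0] .
  then have "X *v w2 = complex_of_real a *s w2" using X2 by simp
  then have "FF 0 w2 \<in> strings" unfolding strings_def using E2 by blast
  then have "w2 \<in> ?V" by (intro vec.span_base) simp
  then have "w2 + u' + u \<in> ?V" by (intro vec.span_add u' ur)
  then show False using w(1) by (simp add: w2_def w1_def)
qed

end

text \<open>\<open>N\<close> avoids all differences of entries of \<open>evs\<close>, so raising by
  \<open>N\<close> takes every weight out of \<open>evs\<close>. This makes the relations symmetric
  under exchange of E and F.\<close>

lemma (in sl2_rep) E_nilpotent: "\<exists>N. \<forall>v. EE N v = 0"
proof -
  have "finite ((\<lambda>(i, j). nat \<lfloor>i - j\<rfloor>) ` (set evs \<times> set evs))"
    by simp
  then obtain N where N: "N \<notin> (\<lambda>(i, j). nat \<lfloor>i - j\<rfloor>) ` (set evs \<times> set evs)"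
    using ex_new_if_finite[OF infinite_UNIV_nat] by blast
  have "EE N v = 0" for v
  proof -
    have "v \<in> vec.span strings" by (simp add: span_strings)
    then show ?thesis
    proof (induction rule: vec.span_induct_alt)
      case base
      show ?case by (simp add: matrix_pow_linear)
    next
      case (step c x y)
      obtain i where i: "X *v x = complex_of_real i *s x"
        using step(1) unfolding strings_def using X_string by blast
      have "X *v EE N x = complex_of_real (i + real N) *s EE N x"
        by (simp add: X_EE i matrix_pow_linear vec.scale_left_distrib)
      moreover have "x = 0 \<or> i \<in> set evs" using i real_eigenvalue by blast
      ultimately have "EE N x = 0"
        using N real_eigenvalue[of "EE N x" "i + real N"] by (force simp: matrix_pow_linear)
      then show ?case using step by (simp add: matrix_pow_linear)
    qed
  qed
  then show ?thesis by blast
qed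

context sl2_rep begin

text \<open>The Chevalley involution: statements on lowest weights and on powers of E follow from
  those on highest weights and powers of F.\<close>

lemma swap: "sl2_rep E (- X) F"
  using XE XF EF E_nilpotent
  by unfold_locales (simp_all add: minus_mult_vec vec_eq_iff matrix_vector_right_distrib
      matrix_vector_mult_diff_distrib vec.neg)

section \<open>Weight decomposition and the powers of F and E between opposite weight spaces\<close>

abbreviation "wsp \<equiv> weight_space (mat 1) X"

lemma mem_wsp: "v \<in> wsp j \<longleftrightarrow> X *v v = complex_of_real j *s v"
  by (simp add: weight_space_def)

lemma wsp_0 [simp]: "0 \<in> wsp j" by (simp add: mem_wsp)

lemma wsp_add: "v \<in> wsp j \<Longrightarrow> w \<in> wsp j \<Longrightarrow> v + w \<in> wsp j"
  by (simp add: mem_wsp vec.add vec.scale_right_distrib)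

lemma wsp_scale: "v \<in> wsp j \<Longrightarrow> c *s v \<in> wsp j"
  by (simp add: mem_wsp vec.scale mult.commute)

lemma wsp_evs: "v \<in> wsp j \<Longrightarrow> v \<noteq> 0 \<Longrightarrow> j \<in> set evs"
  using real_eigenvalue by (simp add: mem_wsp)

lemma F_wsp: "v \<in> wsp j \<Longrightarrow> F *v v \<in> wsp (j - 1)"
  by (simp add: mem_wsp XF vec.scale vec.scale_left_diff_distrib)

lemma FF_wsp: "v \<in> wsp j \<Longrightarrow> FF n v \<in> wsp (j - real n)"
  unfolding mem_wsp by (rule X_string)

lemma EE_wsp: "v \<in> wsp j \<Longrightarrow> EE n v \<in> wsp (j + real n)"
  by (simp add: mem_wsp X_EE matrix_pow_linear vec.scale_left_distrib)

lemma strings_wsp: "u \<in> strings \<Longrightarrow> \<exists>j. u \<in> wsp j"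
  unfolding strings_def mem_wsp using X_string by blast

lemma span_wsp: "vec.span (\<Union>j. wsp j) = UNIV"
proof -
  have "strings \<subseteq> (\<Union>j. wsp j)" using strings_wsp by blast
  then show ?thesis using vec.span_mono span_strings by blast
qed

lemma wsp_induct [consumes 0, case_names wsp add]:
  assumes "\<And>j v. v \<in> wsp j \<Longrightarrow> Q v" "\<And>v w. Q v \<Longrightarrow> Q w \<Longrightarrow> Q (v + w)"
  shows "Q v"
proof -
  have "v \<in> vec.span (\<Union>j. wsp j)" by (simp add: span_wsp)
  then show ?thesis
  proof (induction rule: vec.span_induct_alt)
    case base
    show ?case using assms(1)[of 0 0] by simp
  next
    case (step c x y)
    then obtain j where "x \<in> wsp j" by blast
    then have "Q (c *s x)" using assms(1) wsp_scale by blast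
    then show ?case using step assms(2) by blast
  qed
qed

lemma matrix_eqI_wsp:
  fixes A B :: "complex^'n^'n"
  shows "(\<And>j v. v \<in> wsp j \<Longrightarrow> A *v v = B *v v) \<Longrightarrow> A = B"
  by (rule matrix_eqI_span[where S = "\<Union>j. wsp j"]) (use span_wsp in auto)

text \<open>Functional calculus of \<open>X\<close>, written as Lagrange interpolation on
  \<open>evs\<close>. Weight projections, and later the operators that separate the band from its
  complement, are special cases.\<close>

definition fc :: "(real \<Rightarrow> complex) \<Rightarrow> complex^'n^'n" where
  "fc g = (\<Sum>j\<in>set evs. mat (g j / evc j) ** evpr j)"

lemma fc_wsp: "v \<in> wsp i \<Longrightarrow> fc g *v v = g i *s v"
proof -
  assume v: "v \<in> wsp i"
  have "fc g *v v = (\<Sum>j\<in>set evs. if j = i then g i *s v else 0)"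
    unfolding fc_def sum_mult_vec using v evc_nonzero
    by (intro sum.cong)
      (auto simp: mult_mult_vec mat_mult_vec evpr_eigen[of v i] mem_wsp)
  also have "\<dots> = g i *s v"
    using wsp_evs[OF v] by (cases "v = 0") simp_all
  finally show ?thesis .
qed

definition "WP I = fc (\<lambda>j. if j \<in> I then 1 else 0)"

lemma WP_wsp: "v \<in> wsp i \<Longrightarrow> WP I *v v = (if i \<in> I then v else 0)"
  by (simp add: WP_def fc_wsp)

lemma weight_proj_WP: "weight_proj (mat 1) X I = WP I"
  unfolding weight_proj_def
proof (rule proj_along_eqI)
  show "WP I *v v = v" if "v \<in> vec.span (\<Union>j\<in>I. wsp j)" for v
    by (rule span_subset_fixed[OF _ that]) (auto simp: WP_wsp)
  show "WP I *v v = 0" if "v \<in> vec.span (\<Union> (wsp ` (- I)) \<union> {v. mat 1 *v v = 0})" for v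
    by (rule span_subset_kernel[OF _ that]) (auto simp: WP_wsp)
  have "(\<Union>j. wsp j) \<subseteq> vec.span (\<Union>j\<in>I. wsp j) \<union> vec.span (\<Union> (wsp ` (- I)) \<union> {v. mat 1 *v v = 0})"
    (is "_ \<subseteq> ?R \<union> ?K")
    by (auto intro: vec.span_base)
  then show "vec.span (?R \<union> ?K) = UNIV"
    using vec.span_mono span_wsp by blast
qed

lemma WP_WP: "WP I *v (WP J *v v) = WP (I \<inter> J) *v v"
  by (induction v rule: wsp_induct) (auto simp: WP_wsp vec.add)

lemma WP_add: "I \<inter> J = {} \<Longrightarrow> WP (I \<union> J) *v v = WP I *v v + WP J *v v"
  by (induction v rule: wsp_induct) (auto simp: WP_wsp vec.add algebra_simps)

lemma WP_UNIV [simp]: "WP UNIV *v v = v"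
  by (induction v rule: wsp_induct) (auto simp: WP_wsp vec.add)

lemma WP_empty [simp]: "WP {} *v v = 0"
  by (induction v rule: wsp_induct) (auto simp: WP_wsp vec.add)

lemma WP_singleton_wsp: "WP {j} *v v \<in> wsp j"
  by (induction v rule: wsp_induct) (auto simp: WP_wsp vec.add wsp_add)

lemma wsp_iff_WP: "v \<in> wsp j \<longleftrightarrow> WP {j} *v v = v"
  using WP_wsp[of v j "{j}"] WP_singleton_wsp[of j v] by auto

lemma WP_shift:
  assumes "\<And>i v. v \<in> wsp i \<Longrightarrow> A *v v \<in> wsp (i + r)"
  shows "WP I *v (A *v v) = A *v (WP {i. i + r \<in> I} *v v)"
  by (induction v rule: wsp_induct) (auto simp: WP_wsp vec.add WP_wsp[OF assms])

lemma WP_FF: "WP I *v FF n v = FF n (WP {i. i - real n \<in> I} *v v)"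
  by (induction v rule: wsp_induct) (auto simp: WP_wsp vec.add WP_wsp[OF FF_wsp] matrix_pow_linear)

text \<open>A string vector F^n v of weight -j satisfies l - n = -j and n \<le> 2l, hence n \<ge> 2j
  = N. It therefore has an N-fold predecessor in its string, which has weight j.\<close>

lemma FF_surj:
  assumes "real N = 2 * j" "v \<in> wsp (- j)"
  shows "\<exists>u \<in> wsp j. FF N u = v"
proof -
  have "v \<in> vec.span strings" by (simp add: span_strings)
  then have "\<exists>u \<in> wsp j. FF N u = WP {- j} *v v"
  proof (induction rule: vec.span_induct_alt)
    case base
    show ?case by (rule bexI[of _ 0]) (simp_all add: matrix_pow_linear)
  next
    case (step c x y)
    then obtain u where u: "u \<in> wsp j" "FF N u = WP {- j} *v y" by blast
    obtain n v l where x: "x = FF n v" "E *v v = 0" "X *v v = complex_of_real l *s v"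
      using step(1) unfolding strings_def by blast
    have "\<exists>u \<in> wsp j. FF N u = WP {- j} *v x"
    proof (cases "l - real n = - j \<and> x \<noteq> 0")
      case False
      then have "WP {- j} *v x = 0"
        using X_string[OF x(3), of n] x(1) WP_wsp[of x "l - real n"] by (auto simp: mem_wsp)
      then show ?thesis by (intro bexI[of _ 0]) (simp_all add: matrix_pow_linear)
    next
      case True
      have "real n \<le> 2 * l" using string_bound(1)[OF x(2,3), of n] True x(1) by simp
      then have "n \<ge> N" using True assms(1) by linarith
      then have "FF N (FF (n - N) v) = x"
        unfolding x(1) by (metis funpow_add le_add_diff_inverse o_apply)
      moreover have "FF (n - N) v \<in> wsp j"
      proof -
        have "l - real (n - N) = j" using True assms(1) \<open>n \<ge> N\<close> by linarith
        then show ?thesis using FF_wsp[of v l "n - N"] x(3) by (simp only: mem_wsp)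
      qed
      moreover have "WP {- j} *v x = x"
        using X_string[OF x(3), of n] x(1) True WP_wsp[of x "- j"] by (auto simp: mem_wsp)
      ultimately show ?thesis by metis
    qed
    then obtain u' where u': "u' \<in> wsp j" "FF N u' = WP {- j} *v x" by blast
    show ?case
      by (rule bexI[of _ "c *s u' + u"])
        (simp_all add: u u' matrix_pow_linear vec.add vec.scale wsp_add wsp_scale)
  qed
  then show ?thesis using WP_wsp[OF assms(2)] by simp
qed

lemma swap_wsp: "weight_space (mat 1) (- X) j = wsp (- j)"
proof -
  have "- w = c *s v \<longleftrightarrow> w = - c *s v" for c :: complex and w v :: "complex^'n"
    by (metis minus_equation_iff vec.scale_minus_left)
  then show ?thesis by (simp add: weight_space_def minus_mult_vec)
qed

lemma EE_surj:
  assumes "real N = 2 * j" "v \<in> wsp j"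
  shows "\<exists>u \<in> wsp (- j). EE N u = v"
  using sl2_rep.FF_surj[OF swap, of N j v] assms by (simp add: swap_wsp)

text \<open>Finite dimension turns surjectivity into injectivity: \<open>g\<close> is E^N F^N on
  V[j] and the identity on the other weight spaces, and it is onto by \<open>FF_surj\<close> and
  \<open>EE_surj\<close>.\<close>

lemma FF_inj:
  assumes "real N = 2 * j" "v \<in> wsp j" "FF N v = 0"
  shows "v = 0"
proof -
  define g where "g = (\<lambda>v. EE N (FF N (WP {j} *v v)) + (v - WP {j} *v v))"
  have "Vector_Spaces.linear (*s) (*s) g"
    unfolding g_def
    by unfold_locales
      (simp_all add: matrix_pow_linear vec.add vec.scale vec.scale_right_distrib
        vec.scale_right_diff_distrib)
  moreover have "surj g"
    unfolding surj_def
  proof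
    fix v
    obtain y where y: "y \<in> wsp (- j)" "EE N y = WP {j} *v v"
      using EE_surj[OF assms(1) WP_singleton_wsp] by blast
    obtain u where u: "u \<in> wsp j" "FF N u = y"
      using FF_surj[OF assms(1) y(1)] by blast
    have "g (u + (v - WP {j} *v v)) = v"
      unfolding g_def using u y by (simp add: vec.add vec.diff WP_wsp WP_WP)
    then show "\<exists>u. v = g u" by metis
  qed
  ultimately have "inj g"
    by (rule vec.linear_surjective_imp_injective) simp
  moreover have "g v = g 0"
    unfolding g_def using assms by (simp add: WP_wsp matrix_pow_linear)
  ultimately show ?thesis by (rule injD)
qed

lemma EE_inj: "real N = 2 * j \<Longrightarrow> v \<in> wsp (- j) \<Longrightarrow> EE N v = 0 \<Longrightarrow> v = 0"
  using sl2_rep.FF_inj[OF swap, of N j v] by (simp add: swap_wsp)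

lemma lowest_imp_highest:
  assumes "v \<in> wsp (- i)" "F *v v = 0" "v \<noteq> 0"
  shows "\<exists>u. u \<noteq> 0 \<and> u \<in> wsp i \<and> E *v u = 0" "2 * i \<in> \<nat>"
proof -
  have "- X *v v = complex_of_real i *s v" using assms(1) by (simp add: mem_wsp minus_mult_vec)
  then obtain N where N: "2 * i = real N" "EE N v \<noteq> 0" "EE (Suc N) v = 0"
    using sl2_rep.hw_string_real[OF swap assms(2) _ assms(3)] by blast
  then show "2 * i \<in> \<nat>" by simp
  show "\<exists>u. u \<noteq> 0 \<and> u \<in> wsp i \<and> E *v u = 0"
  proof (intro exI[of _ "EE N v"] conjI)
    have "- i + real N = i" using N(1) by simp
    then show "EE N v \<in> wsp i" using EE_wsp[OF assms(1), of N] by metis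
  qed (use N in auto)
qed

lemma weight_string:
  assumes "v \<in> wsp j" "v \<noteq> 0"
  shows "\<exists>l n w. w \<noteq> 0 \<and> w \<in> wsp l \<and> E *v w = 0 \<and> j = l - real n"
proof (rule ccontr)
  assume no: "\<not> ?thesis"
  have "v \<in> vec.span strings" by (simp add: span_strings)
  then have "WP {j} *v v = 0"
  proof (rule span_subset_kernel[rotated])
    fix x assume "x \<in> strings"
    then obtain n u l where x: "x = FF n u" "E *v u = 0" "X *v u = complex_of_real l *s u"
      unfolding strings_def by blast
    show "WP {j} *v x = 0"
    proof (cases "x = 0 \<or> l - real n \<noteq> j")
      case True
      then show ?thesis using WP_wsp[OF FF_wsp[of u l n], of "{j}"] x by (auto simp: mem_wsp)
    next
      case False
      then have "u \<noteq> 0" using x(1) by (auto simp: matrix_pow_linear)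
      then show ?thesis using no x False by (auto simp: mem_wsp)
    qed
  qed
  then show False using WP_wsp[OF assms(1)] assms(2) by simp
qed

end

section \<open>Jordan type and the parity of weights\<close>

lemma matrix_pow_sum:
  fixes A :: "complex^'n^'n"
  shows "((*v) A ^^ n) (\<Sum>i\<in>I. g i) = (\<Sum>i\<in>I. ((*v) A ^^ n) (g i))"
  by (induction I rule: infinite_finite_induct) (simp_all add: matrix_pow_linear)

text \<open>Expand \<open>z\<close> in the Jordan chains. F^(q+1) z = 0 removes the basis vectors
  that F^(q+1) does not kill. Among the others F^q survives only on the second to last level it can
  reach; as no chain has length q + 1, such a vector is not the head of its chain and has a
  predecessor under F.\<close>

lemma jordan_type_kernel_image:
  fixes F :: "complex^'n^'n"
  assumes "jordan_type F ps" "Suc q \<notin> set ps" "((*v) F ^^ Suc q) z = 0"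
  shows "\<exists>u. ((*v) F ^^ q) z = ((*v) F ^^ Suc q) u"
proof -
  define I where "I = Sigma {..<length ps} (\<lambda>i. {..<ps ! i})"
  obtain v where v: "inj_on (\<lambda>(i, j). ((*v) F ^^ j) (v i)) I"
      "vec.independent ((\<lambda>(i, j). ((*v) F ^^ j) (v i)) ` I)"
      "vec.span ((\<lambda>(i, j). ((*v) F ^^ j) (v i)) ` I) = UNIV"
      "\<And>i. i < length ps \<Longrightarrow> ((*v) F ^^ (ps ! i)) (v i) = 0"
    using assms(1) unfolding jordan_type_def Let_def I_def[symmetric] by blast
  define b where "b = (\<lambda>(i, j). ((*v) F ^^ j) (v i))"
  note v = v[folded b_def]
  have "finite I" by (simp add: I_def)
  have pow_b: "((*v) F ^^ r) (b (i, j)) = b (i, j + r)" for r i j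
    by (simp add: b_def add.commute[of j] funpow_add)
  have b0: "b (i, j) = 0" if "i < length ps" "ps ! i \<le> j" for i j
  proof -
    obtain r where "j = ps ! i + r" using \<open>ps ! i \<le> j\<close> le_Suc_ex by blast
    then show ?thesis using pow_b[of r i "ps ! i"] v(4)[OF that(1)]
      by (simp add: b_def matrix_pow_linear)
  qed
  have "z \<in> vec.span (b ` I)" by (simp add: v)
  then obtain r where "z = (\<Sum>x\<in>b ` I. r x *s x)"
    using \<open>finite I\<close> by (auto simp: vec.span_finite)
  then have z: "z = (\<Sum>x\<in>I. r (b x) *s b x)"
    by (simp add: sum.reindex[OF v(1)])
  define I' where "I' = {(i, j) \<in> I. j + Suc q < ps ! i}"
  define h where "h = (\<lambda>(i, j). b (i, j + Suc q))"
  have I': "I' \<subseteq> I" "finite I'" using \<open>finite I\<close> by (auto simp: I'_def intro: finite_subset)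
  have hI: "h ` I' \<subseteq> b ` I" by (force simp: h_def I'_def I_def)
  have inj_h: "inj_on h I'"
  proof (rule inj_onI)
    fix x y assume xy: "x \<in> I'" "y \<in> I'" "h x = h y"
    then have "(fst x, snd x + Suc q) = (fst y, snd y + Suc q)"
      by (intro inj_onD[OF v(1)]) (auto simp: h_def I'_def I_def)
    then show "x = y" by (simp add: prod_eq_iff)
  qed
  have "0 = (\<Sum>x\<in>I. r (b x) *s ((*v) F ^^ Suc q) (b x))"
    unfolding assms(3)[symmetric] by (subst z) (simp only: matrix_pow_sum matrix_pow_linear)
  also have "\<dots> = (\<Sum>x\<in>I. if x \<in> I' then r (b x) *s h x else 0)"
    by (intro sum.cong refl) (auto simp: pow_b h_def I'_def I_def intro!: b0 simp del: funpow.simps)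
  also have "\<dots> = (\<Sum>x\<in>I'. r (b x) *s h x)"
    using \<open>finite I\<close> I' by (simp add: sum.If_cases Int_absorb1 Int_absorb2)
  also have "\<dots> = (\<Sum>w\<in>h ` I'. r (b (the_inv_into I' h w)) *s w)"
    by (simp add: sum.reindex[OF inj_h] the_inv_into_f_f[OF inj_h])
  finally have rh: "(\<Sum>w\<in>h ` I'. r (b (the_inv_into I' h w)) *s w) = 0" by simp
  have r0: "r (b x) = 0" if "x \<in> I'" for x
  proof -
    have "r (b (the_inv_into I' h (h x))) = 0"
      by (rule vec.independentD[OF v(2) _ hI rh]) (use I' that in auto)
    then show ?thesis by (simp add: the_inv_into_f_f[OF inj_h that])
  qed
  have range: "vec.subspace (range ((*v) F ^^ Suc q))"
    by (rule vec.subspaceI) (auto simp: matrix_pow_linear[symmetric] simp del: funpow.simps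
      intro: range_eqI[of _ _ 0])
  have "((*v) F ^^ q) z = (\<Sum>x\<in>I. r (b x) *s ((*v) F ^^ q) (b x))"
    by (subst z) (simp only: matrix_pow_sum matrix_pow_linear)
  also have "\<dots> \<in> range ((*v) F ^^ Suc q)"
  proof (rule vec.subspace_sum[OF range])
    fix x assume x: "x \<in> I"
    obtain i j where ij: "x = (i, j)" by force
    have i: "i < length ps" "j < ps ! i" using x ij by (auto simp: I_def)
    \<comment> \<open>Otherwise \<open>ps ! i\<close> would be the excluded part q + 1.\<close>
    have "j + q \<noteq> ps ! i - 1 \<or> j \<noteq> 0"
      using assms(2) i nth_mem[OF i(1)] by (metis Suc_diff_1 add_0 gr_zeroI not_less_zero)
    then consider "x \<in> I'" | "ps ! i \<le> j + q" | "j > 0"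
      using i x unfolding ij I'_def by force
    then show "r (b x) *s ((*v) F ^^ q) (b x) \<in> range ((*v) F ^^ Suc q)"
    proof cases
      case 1
      then show ?thesis using r0 vec.subspace_0[OF range] by simp
    next
      case 2
      then show ?thesis using b0 i vec.subspace_0[OF range] by (simp add: ij pow_b)
    next
      case 3
      then have "((*v) F ^^ q) (b x) = ((*v) F ^^ Suc q) (b (i, j - 1))"
        by (simp add: ij pow_b del: funpow.simps)
      then show ?thesis using vec.subspace_scale[OF range] by (metis rangeI)
    qed
  qed
  finally show ?thesis by blast
qed

context sl2_rep begin

text \<open>If N + 1 were not a part, then F^N v = F^(N+1) u' with u' of weight l + 1. Then F^(N+2)
  u' = 0, which contradicts injectivity of F^(2(l+1)) on V[l+1].\<close>

lemma hw_jordan_part: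
  assumes "jordan_type F ps" "v \<in> wsp l" "E *v v = 0" "v \<noteq> 0"
  shows "\<exists>N. 2 * l = real N \<and> Suc N \<in> set ps"
proof -
  obtain N where N: "2 * l = real N" "FF N v \<noteq> 0" "FF (Suc N) v = 0"
    using hw_string_real assms by (auto simp: mem_wsp)
  have "Suc N \<in> set ps"
  proof (rule ccontr)
    assume "Suc N \<notin> set ps"
    from jordan_type_kernel_image[OF assms(1) this N(3)]
    obtain u where u: "FF N v = FF (Suc N) u" by blast
    define u' where "u' = WP {l + 1} *v u"
    have "{i. i - real (Suc N) \<in> {- l}} = {l + 1}" using N(1) by auto
    then have "FF (Suc N) u' = WP {- l} *v FF (Suc N) u"
      unfolding u'_def WP_FF by simp
    also have "\<dots> = FF N v"
      unfolding u[symmetric] 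
    proof (rule iffD1[OF wsp_iff_WP])
      have "l - real N = - l" using N(1) by simp
      then show "FF N v \<in> wsp (- l)" using FF_wsp[OF assms(2), of N] by metis
    qed
    finally have u': "FF (Suc N) u' = FF N v" .
    have "FF (N + 2) u' = F *v FF (Suc N) u'" by simp
    also have "\<dots> = 0" unfolding u' using N(3) by simp
    finally have u0: "FF (N + 2) u' = 0" .
    have "real (N + 2) = 2 * (l + 1)" using N(1) by simp
    from FF_inj[OF this _ u0] have "u' = 0"
      unfolding u'_def by (simp only: WP_singleton_wsp)
    then show False using u' N(2) by (simp add: matrix_pow_linear)
  qed
  with N(1) show ?thesis by blast
qed

lemma weights_congruent:
  assumes "jordan_type F ps" "(\<forall>p\<in>set ps. even p) \<or> (\<forall>p\<in>set ps. odd p)"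
    and "v \<in> wsp i" "v \<noteq> 0" "w \<in> wsp j" "w \<noteq> 0"
  shows "i - j \<in> \<int>" "2 * i \<in> \<int>"
proof -
  obtain l n u where u: "u \<noteq> 0" "u \<in> wsp l" "E *v u = 0" "i = l - real n"
    using weight_string[OF assms(3,4)] by blast
  obtain l' n' u' where u': "u' \<noteq> 0" "u' \<in> wsp l'" "E *v u' = 0" "j = l' - real n'"
    using weight_string[OF assms(5,6)] by blast
  obtain N where N: "2 * l = real N" "Suc N \<in> set ps"
    using hw_jordan_part[OF assms(1) u(2,3,1)] by blast
  obtain N' where N': "2 * l' = real N'" "Suc N' \<in> set ps"
    using hw_jordan_part[OF assms(1) u'(2,3,1)] by blast
  have "even (int N - int N')" using assms(2) N N' by auto
  then obtain r where "int N - int N' = 2 * r" by blast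
  then have "real N - real N' = 2 * of_int r" by linarith
  then have "i - j = of_int (r - int n + int n')" using u(4) u'(4) N(1) N'(1) by simp
  then show "i - j \<in> \<int>" by (metis Ints_of_int)
  show "2 * i \<in> \<int>" using N(1) u(4) by simp
qed

text \<open>The Casimir operator in the normalization with eigenvalue l(l+1) on a string of highest
  weight l.\<close>

definition "Cas = F ** E + X ** X + X"

lemma Cas_vec: "Cas *v v = F *v (E *v v) + X *v (X *v v) + X *v v"
  by (simp add: Cas_def matrix_vector_mult_add_rdistrib matrix_vector_mul_assoc)

lemma Cas_FF: "Cas *v FF n v = FF n (Cas *v v)"
proof (induction n)
  case (Suc n)
  have "Cas *v (F *v u) = F *v (Cas *v u)" for u
    by (simp add: Cas_vec EF XF vec.add vec.diff vec.scale vec_eq_iff)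
  then show ?case using Suc by simp
qed simp

lemma Cas_hw: "v \<in> wsp l \<Longrightarrow> E *v v = 0 \<Longrightarrow> Cas *v FF n v = complex_of_real (l * (l + 1)) *s FF n v"
  unfolding Cas_FF
  by (simp only: Cas_vec mem_wsp vec.scale vec.zero matrix_pow_linear distrib_left vec.scale_left_distrib
      vec.scale_scale of_real_add of_real_mult of_real_1 mult_1_right add_0_left)

lemma Cas_lowest: 
  assumes "v \<in> wsp (- l)" "F *v v = 0" 
  shows "Cas *v v = complex_of_real (l * (l + 1)) *s v"
proof -
  have "F *v (E *v v) = - (2 *s (X *v v))"
    using EF[of v] assms by (simp add: add_eq_0_iff)
  moreover have X: "X *v v = (- complex_of_real l) *s v"
    using assms(1) by (simp add: mem_wsp)
  ultimately have "Cas *v v = (2 * complex_of_real l + complex_of_real l * complex_of_real l - complex_of_real l) *s v"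
    unfolding Cas_vec
    by (simp only: X vec.scale) (simp add: vec_eq_iff algebra_simps)
  then show ?thesis by (simp add: algebra_simps)
qed

end

section \<open>Isotypic components\<close>

locale sl2_module = sl2_rep "\<phi> f" "\<phi> x" "\<phi> e"
  for \<phi> :: "'g::complex_lie_algebra \<Rightarrow> complex^'n^'n" and f x e :: 'g
begin

abbreviation "isoc \<equiv> isotypic \<phi> f x e"

lemma highest_weight_vec_iff:
  "highest_weight_vec \<phi> x e j v \<longleftrightarrow> v \<noteq> 0 \<and> v \<in> wsp j \<and> \<phi> e *v v = 0"
  by (simp add: highest_weight_vec_def)

lemma string_submodule:
  assumes "v \<in> wsp l" "\<phi> e *v v = 0"
  shows "sl2_submodule \<phi> f x e (vec.span (range (\<lambda>n. FF n v)))"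
proof -
  have *: "A *v w \<in> vec.span (range (\<lambda>n. FF n v))"
    if "\<And>n. A *v FF n v \<in> vec.span (range (\<lambda>n. FF n v))" "w \<in> vec.span (range (\<lambda>n. FF n v))" for A w
    using that(2)
    by (induction rule: vec.span_induct_alt)
      (auto simp: vec.add vec.scale vec.span_zero intro!: vec.span_add vec.span_scale that(1))
  have b: "FF n v \<in> vec.span (range (\<lambda>n. FF n v))" for n
    by (rule vec.span_base) blast
  have "\<phi> f *v FF n v \<in> vec.span (range (\<lambda>n. FF n v))" for n
    using b[of "Suc n"] by simp
  moreover have "\<phi> x *v FF n v \<in> vec.span (range (\<lambda>n. FF n v))" for n
    using X_string[of v l n] assms(1) b[of n] by (simp only: mem_wsp vec.span_scale)
  moreover have "\<phi> e *v FF n v \<in> vec.span (range (\<lambda>n. FF n v))" for n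
    using E_string[of v l] assms b by (cases n) (auto simp: mem_wsp vec.span_scale vec.span_zero)
  ultimately show ?thesis
    unfolding sl2_submodule_def using * by auto
qed

text \<open>A nonzero submodule contains an eigenvector of X. The weights along a string are
  distinct, so this eigenvector is a multiple of some F^n v, and applying E leads back up to
  \<open>v\<close>, which generates everything.\<close>

lemma string_irreducible:
  assumes v: "v \<in> wsp l" "\<phi> e *v v = 0" "v \<noteq> 0"
  shows "sl2_irreducible \<phi> f x e (vec.span (range (\<lambda>n. FF n v)))"
  unfolding sl2_irreducible_def
proof (intro conjI allI impI string_submodule[OF v(1,2)])
  let ?S = "vec.span (range (\<lambda>n. FF n v))"
  have vS: "v \<in> ?S" using vec.span_base[OF rangeI[of "\<lambda>n. FF n v" 0]] by simp
  then show "?S \<noteq> {0}" using v(3) by blast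
  fix T assume T: "sl2_submodule \<phi> f x e T \<and> T \<subseteq> ?S"
  have Ts: "vec.subspace T" and Tc: "\<And>w. w \<in> T \<Longrightarrow> \<phi> f *v w \<in> T" "\<And>w. w \<in> T \<Longrightarrow> \<phi> x *v w \<in> T"
    "\<And>w. w \<in> T \<Longrightarrow> \<phi> e *v w \<in> T"
    using T by (auto simp: sl2_submodule_def)
  show "T = {0} \<or> T = ?S"
  proof (cases "T = {0}")
    case False
    then obtain t where t: "t \<in> T" "t \<notin> {0}" using vec.subspace_0[OF Ts] by auto
    have "vec.subspace ({0} :: (complex^'n) set)" by (rule vec.subspaceI) auto
    then have "\<exists>w a. w \<in> T \<and> w \<notin> {0} \<and> a \<in> set (map complex_of_real evs) \<and> \<phi> x *v w - a *s w \<in> {0}"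
      using eigenvector_modulo[OF Tc(2) Ts _ lin_prod_evs t] by blast
    then obtain w a where w: "w \<in> T" "w \<noteq> 0" "w \<in> wsp a"
      by (auto simp: mem_wsp)
    have "\<exists>n. l - real n = a"
    proof (rule ccontr)
      assume no: "\<not> ?thesis"
      have "WP {a} *v w = 0"
        by (rule span_subset_kernel[of "range (\<lambda>n. FF n v)"])
          (use no w T WP_wsp[OF FF_wsp[OF v(1)], of "{a}"] in auto)
      then show False using WP_wsp[OF w(3)] w(2) by simp
    qed
    then obtain n where n: "l - real n = a" by blast
    have wS: "w \<in> ?S" using w T by blast
    then have "\<exists>c. WP {a} *v w = c *s FF n v"
    proof (induction rule: vec.span_induct_alt)
      case base
      show ?case by (rule exI[of _ 0]) simp
    next
      case (step c x y)
      then obtain r where r: "x = FF r v" by blast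
      have "\<exists>c. WP {a} *v x = c *s FF n v"
      proof (cases "r = n")
        case True
        then show ?thesis using WP_wsp[OF FF_wsp[OF v(1), of n], of "{a}"] n r by (metis insertI1 vec.scale_one)
      next
        case False
        then show ?thesis using WP_wsp[OF FF_wsp[OF v(1), of r], of "{a}"] n r
          by (intro exI[of _ 0]) auto
      qed
      then obtain c1 c2 where "WP {a} *v x = c1 *s FF n v" "WP {a} *v y = c2 *s FF n v"
        using step by blast
      then show ?case
        by (intro exI[of _ "c * c1 + c2"]) (simp add: vec.add vec.scale vec.scale_left_distrib)
    qed
    then obtain c where c: "w = c *s FF n v" using WP_wsp[OF w(3), of "{a}"] by auto
    then have nz: "c \<noteq> 0" "FF n v \<noteq> 0" using w(2) by auto
    have "FF n v = (inverse c) *s w" using c nz by simp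
    then have "FF n v \<in> T" using vec.subspace_scale[OF Ts w(1)] by metis
    then have "v \<in> T" using nz(2)
    proof (induction n)
      case (Suc n)
      have "real (Suc n) \<le> 2 * l" using string_bound(1)[OF v(2) _ Suc(3)] v(1) by (simp add: mem_wsp)
      then have "2 * l - real n \<noteq> 0" by linarith
      then have k: "of_nat (Suc n) * complex_of_real (2 * l - real n) \<noteq> 0"
        by (simp only: mult_eq_0_iff of_nat_eq_0_iff of_real_eq_0_iff) simp
      have "FF n v = inverse (of_nat (Suc n) * complex_of_real (2 * l - real n)) *s (\<phi> e *v FF (Suc n) v)"
        unfolding E_string[OF v(2) v(1)[unfolded mem_wsp]] vec.scale_scale left_inverse[OF k] by simp
      then have "FF n v \<in> T" using vec.subspace_scale[OF Ts Tc(3)[OF Suc(2)]] by metis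
      moreover have "FF n v \<noteq> 0" using Suc(3) by auto
      ultimately show ?case using Suc(1) by blast
    qed simp
    then have "FF n v \<in> T" for n
      by (induction n) (auto intro: Tc)
    then have "?S \<subseteq> T" using Ts by (intro vec.span_minimal) auto
    then show ?thesis using T by blast
  qed simp
qed

lemma string_in_iso:
  assumes "v \<in> wsp l" "\<phi> e *v v = 0" shows "FF n v \<in> isoc l"
proof (cases "v = 0")
  case True
  then show ?thesis by (simp add: isotypic_def matrix_pow_linear vec.span_zero)
next
  case False
  let ?S = "vec.span (range (\<lambda>n. FF n v))"
  have "v \<in> ?S" using vec.span_base[OF rangeI[of "\<lambda>n. FF n v" 0]] by simp
  moreover have "FF n v \<in> ?S" by (rule vec.span_base) blast
  ultimately show ?thesis
    unfolding isotypic_def highest_weight_vec_iff using string_irreducible[OF assms False] False assms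
    by (intro vec.span_base) blast
qed

lemma iso_subset: "isoc l \<subseteq> vec.span {FF n v | n v. v \<in> wsp l \<and> \<phi> e *v v = 0}"
  unfolding isotypic_def
proof (rule vec.span_minimal[OF Union_least vec.subspace_span])
  fix S assume "S \<in> {S. sl2_irreducible \<phi> f x e S \<and> (\<exists>v\<in>S. highest_weight_vec \<phi> x e l v)}"
  then obtain v where S: "sl2_irreducible \<phi> f x e S" and v: "v \<in> S" "v \<noteq> 0" "v \<in> wsp l" "\<phi> e *v v = 0"
    by (auto simp: highest_weight_vec_iff)
  have "FF n v \<in> S" for n
    using S v(1) by (induction n) (auto simp: sl2_irreducible_def sl2_submodule_def)
  then have "vec.span (range (\<lambda>n. FF n v)) \<subseteq> S"
    using S by (intro vec.span_minimal) (auto simp: sl2_irreducible_def sl2_submodule_def)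
  moreover have "v \<in> vec.span (range (\<lambda>n. FF n v))"
    using vec.span_base[OF rangeI[of "\<lambda>n. FF n v" 0]] by simp
  ultimately have "S = vec.span (range (\<lambda>n. FF n v))"
    using S string_submodule[OF v(3,4)] v(2) unfolding sl2_irreducible_def by blast
  also have "\<dots> \<subseteq> vec.span {FF n v | n v. v \<in> wsp l \<and> \<phi> e *v v = 0}"
    by (rule vec.span_mono) (use v in blast)
  finally show "S \<subseteq> vec.span {FF n v | n v. v \<in> wsp l \<and> \<phi> e *v v = 0}" .
qed

text \<open>A string of highest weight k meets weight -k only in its last vector. This is the source
  of \<open>f w = 0\<close> for the vectors to which the Lax operator is applied.\<close>

lemma iso_lowest:
  assumes "w \<in> isoc k" "w \<in> wsp (- k)" shows "\<phi> f *v w = 0"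
proof -
  have "(\<phi> f ** WP {- k}) *v w = 0"
  proof (rule span_subset_kernel)
    show "w \<in> vec.span {FF n v | n v. v \<in> wsp k \<and> \<phi> e *v v = 0}" using assms(1) iso_subset by blast
    fix u assume "u \<in> {FF n v | n v. v \<in> wsp k \<and> \<phi> e *v v = 0}"
    then obtain n v where u: "u = FF n v" "v \<in> wsp k" "\<phi> e *v v = 0" by blast
    show "(\<phi> f ** WP {- k}) *v u = 0"
    proof (cases "k - real n = - k")
      case True
      then have "FF (Suc n) v = 0"
        using string_bound(1)[OF u(3), of k "Suc n"] u(2) by (auto simp: mem_wsp simp del: funpow.simps)
      then show ?thesis
        using WP_wsp[OF FF_wsp[OF u(2), of n]] True by (simp add: mult_mult_vec u(1))
    next
      case False
      then show ?thesis
        using WP_wsp[OF FF_wsp[OF u(2), of n]] by (simp add: mult_mult_vec u(1))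
    qed
  qed
  then show ?thesis using WP_wsp[OF assms(2)] by (simp add: mult_mult_vec)
qed

lemma iso_nonzero_weight:
  assumes "w \<in> isoc k" "w \<noteq> 0" shows "\<exists>v. v \<noteq> 0 \<and> v \<in> wsp k \<and> \<phi> e *v v = 0"
proof (rule ccontr)
  assume no: "\<not> ?thesis"
  have "mat 1 *v w = 0"
    by (rule span_subset_kernel[OF _ subsetD[OF iso_subset assms(1)]]) (use no in \<open>auto simp: matrix_pow_linear\<close>)
  then show False using assms(2) by simp
qed

text \<open>The Casimir operator separates the isotypic components, which shows that the two spaces in
  \<^const>\<open>proj_W\<close> are complementary.\<close>

lemma proj_W_wsp:
  assumes "m \<ge> 0" "v \<in> wsp j" "j \<noteq> - m"
  shows "proj_W \<phi> f x e m *v v = 0"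
proof -
  \<comment> \<open>The Casimir eigenvalues of the other possible highest weights. The restriction
    to nonnegative \<open>j\<close> matters, since j(j+1) takes equal values at j and at
    -1-j.\<close>
  define L where "L = map (\<lambda>j. complex_of_real (j * (j + 1))) (filter (\<lambda>j. j \<noteq> m \<and> j \<ge> 0) evs)"
  define kk where "kk = (\<Prod>c\<leftarrow>L. complex_of_real (m * (m + 1)) - c)"
  have "m * (m + 1) \<noteq> j * (j + 1)" if "j \<noteq> m" "j \<ge> 0" for j :: real
  proof -
    have "m * (m + 1) - j * (j + 1) = (m - j) * (m + j + 1)" by (simp add: algebra_simps)
    then show ?thesis using that assms(1) by auto
  qed
  then have kk: "kk \<noteq> 0"
    unfolding kk_def L_def by (auto simp: prod_list_zero_iff simp del: of_real_mult of_real_add)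
  define Q where "Q = mat (inverse kk) ** lin_prod Cas L ** WP {- m}"
  have Q: "Q *v v = inverse kk *s (lin_prod Cas L *v (WP {- m} *v v))" for v
    by (simp add: Q_def mult_mult_vec mat_mult_vec)
  have kill: "lin_prod Cas L *v u = 0" if "u \<in> vec.span (\<Union>j\<in>- {m}. isoc j)" for u
  proof (rule span_subset_kernel[OF _ that])
    fix u assume "u \<in> (\<Union>j\<in>- {m}. isoc j)"
    then obtain j where j: "j \<noteq> m" "u \<in> isoc j" by auto
    show "lin_prod Cas L *v u = 0"
    proof (rule span_subset_kernel[OF _ subsetD[OF iso_subset j(2)]])
      fix y assume "y \<in> {FF n v | n v. v \<in> wsp j \<and> \<phi> e *v v = 0}"
      then obtain n v where y: "y = FF n v" "v \<in> wsp j" "\<phi> e *v v = 0" by blast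
      show "lin_prod Cas L *v y = 0"
      proof (cases "v = 0")
        case True
        then show ?thesis using y(1) by (simp add: matrix_pow_linear)
      next
        case False
        then have "j \<in> set evs" "j \<ge> 0"
          using wsp_evs[OF y(2)] hw_string_real[OF y(3) y(2)[unfolded mem_wsp]] by auto
        then have "(\<Prod>c\<leftarrow>L. complex_of_real (j * (j + 1)) - c) = 0"
          using j(1) by (force simp: prod_list_zero_iff L_def)
        then show ?thesis
          using lin_prod_eigen[OF Cas_hw[OF y(2,3), of n], of L] by (simp add: y(1))
      qed
    qed
  qed
  let ?R = "lowest_space \<phi> f x (- m)"
  let ?S = "(\<Union>j\<in>-{-m}. wsp j) \<union> (wsp (- m) \<inter> vec.span (\<Union>j\<in>-{m}. isoc j))"
  have "proj_W \<phi> f x e m = Q"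
    unfolding proj_W_def
  proof (rule proj_along_eqI)
    show "Q *v v = v" if "v \<in> ?R" for v
      using that unfolding lowest_space_def
    proof (rule span_subset_fixed[rotated])
      fix v assume "v \<in> {v. lowest_weight_vec \<phi> f x (- m) v}"
      then have v: "v \<in> wsp (- m)" "\<phi> f *v v = 0" by (auto simp: lowest_weight_vec_def)
      show "Q *v v = v"
        unfolding Q using WP_wsp[OF v(1)] lin_prod_eigen[OF Cas_lowest[OF v], of L] kk 
        by (simp add: kk_def)
    qed
    show "Q *v v = 0" if "v \<in> vec.span ?S" for v
    proof (rule span_subset_kernel[OF _ that])
      fix u assume "u \<in> ?S"
      then have "WP {- m} *v u = 0 \<or> (WP {- m} *v u = u \<and> lin_prod Cas L *v u = 0)"
      proof
        assume "u \<in> (\<Union>j\<in>-{-m}. wsp j)"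
        then obtain j where "j \<noteq> - m" "u \<in> wsp j" by auto
        then show ?thesis using WP_wsp[of u j "{- m}"] by simp
      next
        assume "u \<in> wsp (- m) \<inter> vec.span (\<Union>j\<in>-{m}. isoc j)"
        then show ?thesis using WP_wsp[of u "- m" "{- m}"] kill[of u] by simp
      qed
      then show "Q *v u = 0"
        unfolding Q by (elim disjE conjE) simp_all
    qed
    have "strings \<subseteq> ?R \<union> vec.span ?S"
    proof
      fix u assume "u \<in> strings"
      then obtain n v l where u: "u = FF n v" "v \<in> wsp l" "\<phi> e *v v = 0"
        unfolding strings_def mem_wsp by blast
      have uw: "u \<in> wsp (l - real n)" using FF_wsp u by blast
      consider "l - real n \<noteq> - m" | "l - real n = - m" "l \<noteq> m" | "l - real n = - m" "l = m"
        by blast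
      then show "u \<in> ?R \<union> vec.span ?S"
      proof cases
        case 1
        then have "u \<in> ?S" using uw by auto
        then show ?thesis by (rule UnI2[OF vec.span_base])
      next
        case 2
        then have "u \<in> vec.span (\<Union>j\<in>-{m}. isoc j)"
          using string_in_iso[OF u(2,3), of n] u(1) by (intro vec.span_base) auto
        then show ?thesis using uw 2 by (intro UnI2 vec.span_base) auto
      next
        case 3
        then have "FF (Suc n) v = 0"
          using string_bound(1)[OF u(3), of l "Suc n"] u(2) by (auto simp: mem_wsp simp del: funpow.simps)
        then have "u = 0 \<or> lowest_weight_vec \<phi> f x (- m) u"
          using uw unfolding 3(1) by (auto simp: lowest_weight_vec_def u(1))
        then show ?thesis
          unfolding lowest_space_def by (auto intro: vec.span_base vec.span_zero)
      qed
    qed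
    then show "vec.span (?R \<union> vec.span ?S) = UNIV"
      using vec.span_mono span_strings by blast
  qed
  then show ?thesis using WP_wsp[OF assms(2)] assms(3) by (simp add: Q)
qed

end

section \<open>Faithful representations and invariant forms\<close>

lemma lie_0_right [simp]: "lie_bracket y 0 = (0 :: 'g::complex_lie_algebra)"
  using lie_bracket_add_right[of y 0 0] by simp

lemma lie_anticommute: "lie_bracket y z = - lie_bracket z (y :: 'g::complex_lie_algebra)"
proof -
  have "0 = lie_bracket (y + z) (y + z)" by (simp only: lie_bracket_self)
  also have "\<dots> = lie_bracket y z + lie_bracket z y"
    by (simp only: lie_bracket_add_left lie_bracket_add_right) (simp add: lie_bracket_self)
  finally show ?thesis by (simp add: eq_neg_iff_add_eq_0)
qed

lemma lie_minus_right: "lie_bracket y (- z) = - lie_bracket y (z :: 'g::complex_lie_algebra)"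
  using lie_bracket_add_right[of y z "- z"] by (simp add: eq_neg_iff_add_eq_0 add.commute)

lemma lie_diff_right: "lie_bracket y (z - z') = lie_bracket y z - lie_bracket y (z' :: 'g::complex_lie_algebra)"
  using lie_bracket_add_right[of y z "- z'"] by (simp add: lie_minus_right)

locale form_module = sl2_module \<phi> f x e
  for \<phi> :: "'g::complex_lie_algebra \<Rightarrow> complex^'n^'n" and f x e :: 'g +
  fixes B :: "'g \<Rightarrow> 'g \<Rightarrow> complex"
  assumes faithful: "faithful_rep \<phi>" and form: "invariant_form B"
begin

lemma rep_inj: "\<phi> y = \<phi> z \<longleftrightarrow> y = z"
  using faithful by (auto simp: faithful_rep_def inj_eq)

lemma rep_add: "\<phi> (y + z) = \<phi> y + \<phi> z"
  using faithful by (simp add: faithful_rep_def)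

lemma rep_0 [simp]: "\<phi> 0 = 0"
  using rep_add[of 0 0] by simp

lemma rep_minus: "\<phi> (- y) = - \<phi> y"
  using rep_add[of y "- y"] by (simp add: eq_neg_iff_add_eq_0 add.commute)

lemma rep_diff: "\<phi> (y - z) = \<phi> y - \<phi> z"
  using rep_add[of y "- z"] by (simp add: rep_minus)

lemma rep_scale: "\<phi> (c *\<^sub>L y) = mat c ** \<phi> y"
  using faithful by (simp add: faithful_rep_def)

lemma rep_scale_vec: "\<phi> (c *\<^sub>L y) *v v = c *s (\<phi> y *v v)"
  by (simp add: rep_scale mult_mult_vec mat_mult_vec)

lemma rep_sum: "\<phi> (\<Sum>i\<in>I. y i) = (\<Sum>i\<in>I. \<phi> (y i))"
  by (induction I rule: infinite_finite_induct) (simp_all add: rep_add)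

lemma rep_bracket: "\<phi> (lie_bracket y z) = \<phi> y ** \<phi> z - \<phi> z ** \<phi> y"
  using faithful by (simp add: faithful_rep_def)

lemma rep_bracket_vec: "\<phi> (lie_bracket y z) *v v = \<phi> y *v (\<phi> z *v v) - \<phi> z *v (\<phi> y *v v)"
  by (simp add: rep_bracket matrix_vector_mult_diff_rdistrib matrix_vector_mul_assoc)

lemma rep_eqI: "(\<And>v. \<phi> y *v v = \<phi> z *v v) \<Longrightarrow> y = z"
  by (simp add: rep_inj[symmetric] matrix_eq)

lemmas form' = form[unfolded invariant_form_def]

lemma form_sym: "B y z = B z y"
  by (rule form'[THEN conjunct1, rule_format])

lemma form_add_left: "B (y + y') z = B y z + B y' z"
  by (rule form'[THEN conjunct2, THEN conjunct1, rule_format])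

lemma form_scale_left: "B (c *\<^sub>L y) z = c * B y z"
  by (rule form'[THEN conjunct2, THEN conjunct2, THEN conjunct1, rule_format])

lemma form_invariant: "B (lie_bracket y z) v = B y (lie_bracket z v)"
  by (rule form'[THEN conjunct2, THEN conjunct2, THEN conjunct2, THEN conjunct1, rule_format])

lemma form_nondegenerate: "(\<And>z. B y z = 0) \<Longrightarrow> y = 0"
  using form'[THEN conjunct2, THEN conjunct2, THEN conjunct2, THEN conjunct2] by blast

lemma form_add_right: "B z (y + y') = B z y + B z y'"
  by (simp add: form_sym[of z] form_add_left)

lemma form_scale_right: "B z (c *\<^sub>L y) = c * B z y"
  by (simp add: form_sym[of z] form_scale_left)

lemma form_0_left [simp]: "B 0 z = 0"
  using form_add_left[of 0 0 z] by simp

lemma form_0_right [simp]: "B z 0 = 0"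
  by (simp add: form_sym[of z])

lemma form_diff_left: "B (y - y') z = B y z - B y' z"
  using form_add_left[of "y - y'" y' z] by simp

lemma form_minus_left: "B (- y) z = - B y z"
  using form_diff_left[of 0 y z] by simp

lemma form_sum_left: "B (\<Sum>i\<in>I. y i) z = (\<Sum>i\<in>I. B (y i) z)"
  by (induction I rule: infinite_finite_induct) (simp_all add: form_add_left)

lemma form_sum_right: "B z (\<Sum>i\<in>I. y i) = (\<Sum>i\<in>I. B z (y i))"
  by (simp add: form_sym[of z] form_sum_left)

lemma form_invariant': "B y (lie_bracket z v) = - B (lie_bracket z y) v"
  unfolding form_invariant[symmetric] lie_anticommute[of y z] form_minus_left ..

end

section \<open>Orthogonal and symplectic algebras\<close>

text \<open>The sign \<epsilon> is 1 or -1, which covers the orthogonal and symplectic cases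
  together. The weights \<open>m < k\<close> of V supply the auxiliary vectors in
  \<open>form_off_band\<close>.\<close>

locale ortho_module = form_module \<phi> f x e B
  for \<phi> :: "'g::complex_lie_algebra \<Rightarrow> complex^'n^'n" and f x e :: 'g and B +
  fixes Q :: "complex^'n^'n" and \<epsilon> :: complex and k m :: real
  assumes range: "range \<phi> = orthosymplectic Q" and Q_inv: "invertible Q"
    and Q_sym: "transpose Q = mat \<epsilon> ** Q" and eps: "\<epsilon> * \<epsilon> = 1"
    and km: "0 \<le> m" "m < k" and k_weight: "wsp k \<noteq> {0}" and m_weight: "wsp m \<noteq> {0}"
begin

text \<open>The bilinear form on V given by \<open>Q\<close>, for which the elements of the algebra
  are skew.\<close>

definition "bl v w = (\<Sum>i\<in>UNIV. v $ i * (Q *v w) $ i)"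

lemma bl_add_left: "bl (v + v') w = bl v w + bl v' w"
  and bl_add_right: "bl v (w + w') = bl v w + bl v w'"
  and bl_scale_left: "bl (c *s v) w = c * bl v w"
  and bl_scale_right: "bl v (c *s w) = c * bl v w"
  by (simp_all add: bl_def vec.add vec.scale sum.distrib sum_distrib_left distrib_left distrib_right mult_ac)

lemma bl_zero_left [simp]: "bl 0 w = 0" and bl_zero_right [simp]: "bl w 0 = 0"
  by (simp_all add: bl_def)

lemma bl_minus_left [simp]: "bl (- v) w = - bl v w" and bl_minus_right [simp]: "bl v (- w) = - bl v w"
  by (simp_all add: bl_def sum_negf vec.neg)

lemma bl_diff_left: "bl (v - v') w = bl v w - bl v' w" and bl_diff_right: "bl v (w - w') = bl v w - bl v w'"
  using bl_add_left[of v "- v'" w] bl_add_right[of v w "- w'"] by simp_all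

lemma bl_transpose: "bl v w = (\<Sum>i\<in>UNIV. (transpose Q *v v) $ i * w $ i)"
proof -
  have "bl v w = (\<Sum>i\<in>UNIV. \<Sum>j\<in>UNIV. v $ i * Q $ i $ j * w $ j)"
    by (simp add: bl_def matrix_vector_mult_def sum_distrib_left mult.assoc)
  also have "\<dots> = (\<Sum>j\<in>UNIV. \<Sum>i\<in>UNIV. v $ i * Q $ i $ j * w $ j)"
    by (rule sum.swap)
  also have "\<dots> = (\<Sum>i\<in>UNIV. (transpose Q *v v) $ i * w $ i)"
    by (simp add: matrix_vector_mult_def transpose_def sum_distrib_left mult_ac del: transpose_matrix_vector)
  finally show ?thesis .
qed

lemma bl_sym: "bl w v = \<epsilon> * bl v w"
  unfolding bl_transpose[of w v]
  by (simp add: Q_sym mult_mult_vec mat_mult_vec bl_def sum_distrib_left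
      mult_ac del: transpose_matrix_vector)

lemma bl_axis: "bl (axis i 1) w = (Q *v w) $ i"
  by (simp add: bl_def axis_def if_distrib if_distribR cong: if_cong)

lemma bl_nondegenerate: 
  assumes "\<And>v. bl v w = 0" shows "w = 0"
proof -
  have "Q *v w = 0" using bl_axis[of _ w] assms by (simp add: vec_eq_iff)
  moreover obtain Q' where "Q' ** Q = mat 1" using Q_inv by (auto simp: invertible_def)
  ultimately show ?thesis by (metis matrix_vector_mul_assoc matrix_vector_mul_lid matrix_vector_mult_0_right)
qed

definition "skew A \<longleftrightarrow> (\<forall>v w. bl (A *v v) w = - bl v (A *v w))"

lemma orthosymplectic_iff_skew: "A \<in> orthosymplectic Q \<longleftrightarrow> skew A"
proof -
  have *: "bl (A *v v) w = (\<Sum>i\<in>UNIV. v $ i * ((transpose A ** Q) *v w) $ i)" for v w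
  proof -
    have "bl (A *v v) w = (\<Sum>i\<in>UNIV. \<Sum>j\<in>UNIV. v $ j * A $ i $ j * (Q *v w) $ i)"
      unfolding bl_def by (simp add: matrix_vector_mult_def[of A] sum_distrib_left sum_distrib_right mult_ac)
    also have "\<dots> = (\<Sum>j\<in>UNIV. \<Sum>i\<in>UNIV. v $ j * A $ i $ j * (Q *v w) $ i)"
      by (rule sum.swap)
    also have "\<dots> = (\<Sum>i\<in>UNIV. v $ i * (transpose A *v (Q *v w)) $ i)"
    proof -
      have "(transpose A *v u) $ i = (\<Sum>j\<in>UNIV. A $ j $ i * u $ j)" for u i
        by (simp add: matrix_vector_mult_def transpose_def del: transpose_matrix_vector)
      then show ?thesis
        by (simp add: sum_distrib_left mult_ac del: transpose_matrix_vector)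
    qed
    finally show ?thesis by (simp only: matrix_vector_mul_assoc)
  qed
  have sum: "bl (A *v v) w + bl v (A *v w) = (\<Sum>i\<in>UNIV. v $ i * ((transpose A ** Q + Q ** A) *v w) $ i)" for v w
    unfolding * by (simp add: bl_def matrix_vector_mult_add_rdistrib matrix_vector_mul_assoc sum.distrib
        distrib_left)
  show ?thesis
  proof
    assume "A \<in> orthosymplectic Q"
    then have "bl (A *v v) w + bl v (A *v w) = 0" for v w
      unfolding sum by (simp add: orthosymplectic_def)
    then show "skew A" by (simp add: skew_def eq_neg_iff_add_eq_0)
  next
    assume "skew A"
    then have s: "(\<Sum>i\<in>UNIV. v $ i * ((transpose A ** Q + Q ** A) *v w) $ i) = 0" for v w
      unfolding sum[symmetric] by (simp add: skew_def)
    have "((transpose A ** Q + Q ** A) *v w) $ i = 0" for w i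
      using s[of "axis i 1" w] by (simp add: axis_def if_distrib if_distribR cong: if_cong)
    then have "transpose A ** Q + Q ** A = 0" by (simp add: matrix_eq vec_eq_iff)
    then show "A \<in> orthosymplectic Q" by (simp add: orthosymplectic_def)
  qed
qed

lemma skew_rep: "skew (\<phi> y)"
  using range orthosymplectic_iff_skew by blast

lemma rep_inv: "skew A \<Longrightarrow> \<phi> (inv \<phi> A) = A"
  using range orthosymplectic_iff_skew by (metis f_inv_into_f)

lemma bl_wsp: "v \<in> wsp i \<Longrightarrow> w \<in> wsp j \<Longrightarrow> i + j \<noteq> 0 \<Longrightarrow> bl v w = 0"
proof -
  assume v: "v \<in> wsp i" and w: "w \<in> wsp j" and "i + j \<noteq> 0"
  have "complex_of_real i * bl v w = - (complex_of_real j * bl v w)"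
    using skew_rep[of x, unfolded skew_def, rule_format, of v w] v w
    by (simp add: mem_wsp bl_scale_left bl_scale_right)
  then have "complex_of_real (i + j) * bl v w = 0" by (simp add: algebra_simps)
  then show ?thesis using \<open>i + j \<noteq> 0\<close> by (simp only: mult_eq_0_iff of_real_eq_0_iff) simp
qed

lemma bl_fc: "bl (fc g *v v) w = bl v (fc (\<lambda>j. g (- j)) *v w)"
proof (induction v rule: wsp_induct)
  case (wsp i v)
  show ?case
  proof (induction w rule: wsp_induct)
    case (wsp j w)
    then show ?case using \<open>v \<in> wsp i\<close> bl_wsp[OF \<open>v \<in> wsp i\<close> wsp]
      by (cases "i + j = 0") (auto simp: fc_wsp bl_scale_left bl_scale_right eq_neg_iff_add_eq_0[symmetric])
  qed (simp add: vec.add bl_add_right)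
qed (simp add: vec.add bl_add_left)

abbreviation "P \<equiv> WP {- k..k}"

lemma P_self_adjoint: "bl (P *v v) w = bl v (P *v w)"
proof -
  have "(\<lambda>j. if - j \<in> {- k..k} then 1 else 0) = (\<lambda>j. if j \<in> {- k..k} then (1::complex) else 0)"
    by auto
  then show ?thesis unfolding WP_def bl_fc by simp
qed

lemma dual_weight_vector:
  assumes "wsp s \<noteq> {0}" shows "\<exists>c d. c \<in> wsp s \<and> d \<in> wsp (- s) \<and> bl d c = 1"
proof -
  obtain c where c: "c \<in> wsp s" "c \<noteq> 0" using assms wsp_0 by blast
  then obtain d0 where d0: "bl d0 c \<noteq> 0" using bl_nondegenerate by blast
  have "bl (WP {- s} *v d0) c = bl d0 c"
    unfolding WP_def bl_fc using fc_wsp[OF c(1)] by simp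
  then have "bl (inverse (bl d0 c) *s (WP {- s} *v d0)) c = 1"
    using d0 by (simp add: bl_scale_left)
  then show ?thesis using c wsp_scale[OF WP_singleton_wsp] by blast
qed

section \<open>Elements of rank at most two\<close>

definition "rk a b = (\<chi> i j. a $ i * (transpose Q *v b) $ j)"

lemma rk_vec: "rk a b *v v = bl b v *s a"
  unfolding bl_transpose by (simp add: vec_eq_iff rk_def matrix_vector_mult_def[of "vec_lambda _"]
      sum_distrib_left mult_ac del: transpose_matrix_vector)

text \<open>The standard identification of the algebra with the exterior square of V for \<epsilon>
  = 1 and with the symmetric square for \<epsilon> = -1.\<close>

definition "skw a b = rk a b - mat \<epsilon> ** rk b a"

lemma skw_vec: "skw a b *v v = bl b v *s a - (\<epsilon> * bl a v) *s b"
  by (simp add: skw_def matrix_vector_mult_diff_rdistrib mult_mult_vec mat_mult_vec rk_vec)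

lemma skew_skw: "skew (skw a b)"
proof -
  have "\<epsilon> * (\<epsilon> * t) = t" for t by (simp add: eps mult.assoc[symmetric])
  then show ?thesis
    unfolding skew_def skw_vec bl_diff_left bl_diff_right bl_scale_left bl_scale_right
    by (auto simp: bl_sym[of _ a] bl_sym[of _ b] mult.left_commute mult.commute)
qed

definition "el a b = inv \<phi> (skw a b)"

lemma rep_el: "\<phi> (el a b) = skw a b"
  unfolding el_def by (rule rep_inv[OF skew_skw])

lemma el_add_left: "el (a + a') b = el a b + el a' b"
  and el_add_right: "el a (b + b') = el a b + el a b'"
  and el_scale_left: "el (c *s a) b = c *\<^sub>L el a b"
  and el_scale_right: "el a (c *s b) = c *\<^sub>L el a b"
proof -
  note skw = rep_add rep_scale_vec rep_el matrix_vector_mult_add_rdistrib skw_vec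
    bl_add_left bl_add_right bl_scale_left bl_scale_right
  show "el (a + a') b = el a b + el a' b" "el a (b + b') = el a b + el a b'"
    "el (c *s a) b = c *\<^sub>L el a b" "el a (c *s b) = c *\<^sub>L el a b"
    by (rule rep_eqI, simp only: skw, simp add: vec_eq_iff algebra_simps)+
qed

lemma el_swap: "el b a = (- \<epsilon>) *\<^sub>L el a b"
proof (rule rep_eqI)
  have "\<epsilon> * (\<epsilon> * t) = t" for t by (simp add: eps mult.assoc[symmetric])
  then show "\<phi> (el b a) *v v = \<phi> ((- \<epsilon>) *\<^sub>L el a b) *v v" for v
    by (simp add: rep_scale_vec rep_el skw_vec vec.scale_right_diff_distrib del: lie.scale_minus_left)
qed

lemma bracket_el: "lie_bracket y (el a b) = el (\<phi> y *v a) b + el a (\<phi> y *v b)"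
proof (rule rep_eqI)
  have s: "bl (\<phi> y *v v) w = - bl v (\<phi> y *v w)" for v w
    using skew_rep by (simp add: skew_def)
  show "\<phi> (lie_bracket y (el a b)) *v v = \<phi> (el (\<phi> y *v a) b + el a (\<phi> y *v b)) *v v" for v
    by (simp add: rep_bracket_vec rep_add rep_el matrix_vector_mult_add_rdistrib skw_vec vec.diff vec.scale s)
qed

end

context ortho_module begin

lemma P_P [simp]: "P *v (P *v v) = P *v v"
  by (simp add: WP_WP)

lemma skew_band: "skew (P ** \<phi> y ** P)"
  using skew_rep[of y] P_self_adjoint by (simp add: skew_def mult_mult_vec)

lemma skew_off_band: "skew ((mat 1 - P) ** \<phi> y ** (mat 1 - P))"
  using skew_rep[of y] P_self_adjoint
  by (simp add: skew_def mult_mult_vec matrix_vector_mult_diff_rdistrib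
      bl_diff_left bl_diff_right vec.diff)

lemma coordinates: "\<exists>c. \<forall>i v. bl (c i) v = v $ i"
proof -
  obtain Q' where Q': "Q' ** Q = mat 1" using Q_inv by (auto simp: invertible_def)
  have "transpose Q ** transpose Q' = mat 1"
    using Q' by (metis matrix_transpose_mul transpose_mat)
  then have "transpose Q *v (transpose Q' *v axis i 1) = axis i 1" for i
    by (simp only: matrix_vector_mul_assoc matrix_vector_mul_lid)
  then have "bl (transpose Q' *v axis i 1) v = v $ i" for i v
    unfolding bl_transpose by (simp add: axis_def if_distrib if_distribR cong: if_cong del: transpose_matrix_vector)
  then show ?thesis by (intro exI[of _ "\<lambda>i. transpose Q' *v axis i 1"]) simp
qed

lemma span_axis: "(\<Sum>i\<in>UNIV. (v $ i) *s (A *v axis i 1)) = A *v (v :: complex^'n)"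
  using vec.sum[of A "\<lambda>i. v $ i *s axis i 1" UNIV] basis_expansion[of v] by (simp add: vec.scale)

text \<open>The elements \<open>el a b\<close> span the algebra.\<close>

lemma form_zeroI:
  assumes u: "\<phi> u = P ** \<phi> u ** P"
    and zero: "\<And>a b. P *v a = a \<Longrightarrow> P *v b = b \<Longrightarrow> B y (el a b) = 0"
  shows "B y u = 0"
proof -
  obtain c where c: "\<And>i v. bl (c i) v = v $ i" using coordinates by blast
  have Pu: "P *v (\<phi> u *v v) = \<phi> u *v v" and uP: "\<phi> u *v (P *v v) = \<phi> u *v v" for v
    by (subst (1 2) u, simp add: mult_mult_vec)+
  \<comment> \<open>The vectors \<open>axis i 1\<close> and \<open>c i\<close> form dual bases for
    \<open>bl\<close>. Each of the two terms of \<open>skw\<close> contributes one copy of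
    \<open>u\<close>, hence the factor 2.\<close>
  define w where "w = (\<Sum>i\<in>UNIV. el (\<phi> u *v axis i 1) (P *v c i))"
  have "w = 2 *\<^sub>L u"
  proof (rule rep_eqI)
    fix v
    have 1: "(\<Sum>i\<in>UNIV. bl (P *v c i) v *s (\<phi> u *v axis i 1)) = \<phi> u *v v"
      unfolding P_self_adjoint c span_axis uP ..
    let ?t = "\<phi> u *v v"
    have "(\<Sum>i\<in>UNIV. bl ?t (axis i 1) *s c i) = ?t"
    proof -
      have "bl (\<Sum>i\<in>I. bl ?t (axis i 1) *s c i) w = (\<Sum>i\<in>I. bl ?t (axis i 1) * w $ i)" for w I
        by (induction I rule: infinite_finite_induct) (simp_all add: bl_add_left bl_scale_left c)
      moreover have "(\<Sum>i\<in>I. bl ?t (axis i 1) * w $ i) = bl ?t (\<Sum>i\<in>I. (w $ i) *s axis i 1)" for w I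
        by (induction I rule: infinite_finite_induct) (simp_all add: bl_add_right bl_scale_right)
      ultimately have "bl (\<Sum>i\<in>UNIV. bl ?t (axis i 1) *s c i) w = bl ?t w" for w
        by (simp add: basis_expansion)
      then have "bl w ((\<Sum>i\<in>UNIV. bl ?t (axis i 1) *s c i) - ?t) = 0" for w
        unfolding bl_sym[of w] bl_diff_left by simp
      then have "(\<Sum>i\<in>UNIV. bl ?t (axis i 1) *s c i) - ?t = 0" by (rule bl_nondegenerate)
      then show ?thesis by simp
    qed
    then have "P *v (\<Sum>i\<in>UNIV. bl ?t (axis i 1) *s c i) = ?t" by (simp add: Pu)
    then have 2: "(\<Sum>i\<in>UNIV. bl ?t (axis i 1) *s (P *v c i)) = ?t"
      by (simp add: vec.sum vec.scale)
    have e: "\<epsilon> * bl (\<phi> u *v axis i 1) v = - bl ?t (axis i 1)" for i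
      using skew_rep[of u] bl_sym[of ?t "axis i 1"] by (simp add: skew_def)
    have "\<phi> w *v v = (\<Sum>i\<in>UNIV. bl (P *v c i) v *s (\<phi> u *v axis i 1))
        + (\<Sum>i\<in>UNIV. bl ?t (axis i 1) *s (P *v c i))"
      by (simp add: w_def rep_sum sum_mult_vec rep_el skw_vec e sum.distrib[symmetric])
    also have "\<dots> = \<phi> (2 *\<^sub>L u) *v v"
      unfolding 1 2 rep_scale_vec by (simp add: vec_eq_iff)
    finally show "\<phi> w *v v = \<phi> (2 *\<^sub>L u) *v v" .
  qed
  moreover have "B y w = 0"
    unfolding w_def form_sum_right by (intro sum.neutral ballI zero) (simp_all add: Pu)
  ultimately show ?thesis by (simp add: form_scale_right)
qed

lemma form_el_eqI:
  assumes "\<And>i j a b. a \<in> wsp i \<Longrightarrow> b \<in> wsp j \<Longrightarrow> \<bar>i\<bar> \<le> k \<Longrightarrow> \<bar>j\<bar> \<le> k \<Longrightarrow> B y (el a b) = 0"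
  shows "P *v a = a \<Longrightarrow> P *v b = b \<Longrightarrow> B y (el a b) = 0"
proof -
  have el0: "el 0 v = 0" "el v 0 = 0" for v
    using el_scale_left[of 0 0 v] el_scale_right[of v 0 0] by simp_all
  have "B y (el (P *v a) (P *v b)) = 0" for a b
  proof (induction a rule: wsp_induct)
    case (wsp i a)
    show ?case
    proof (induction b rule: wsp_induct)
      case (wsp j b)
      show ?case using assms[OF \<open>a \<in> wsp i\<close> wsp] WP_wsp[OF \<open>a \<in> wsp i\<close>] WP_wsp[OF wsp]
        by (auto simp: el0 abs_le_iff)
    qed (simp add: vec.add el_add_right form_add_right)
  qed (simp add: vec.add el_add_left form_add_right)
  then show "P *v a = a \<Longrightarrow> P *v b = b \<Longrightarrow> B y (el a b) = 0" by metis
qed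

section \<open>Orthogonality of the band to elements without band component\<close>

lemma form_transfer: "lie_bracket y w = 0 \<Longrightarrow> B y (lie_bracket w v) = 0"
  by (simp add: form_invariant[symmetric])

text \<open>Such a \<open>y\<close> commutes with all band elements and so pairs to zero with their
  brackets. For weight vectors c, d with bl d c = 1, of weights s and -s that do not interfere with
  a and b, the bracket of \<open>el a d\<close> and \<open>el c b\<close> is \<open>el a b\<close>
  minus \<epsilon> bl a b times \<open>el c d\<close>. This settles the case bl a b = 0; otherwise
  the symmetry in a and b does.\<close>

lemma form_off_band:
  assumes y: "\<phi> y = (mat 1 - P) ** \<phi> y ** (mat 1 - P)" and u: "\<phi> u = P ** \<phi> u ** P"
  shows "B y u = 0"
proof (rule form_zeroI[OF u form_el_eqI])
  have yv: "\<phi> y *v v = (mat 1 - P) *v (\<phi> y *v ((mat 1 - P) *v v))" for v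
    by (subst y) (simp add: matrix_vector_mul_assoc matrix_mul_assoc)
  have y0: "\<phi> y *v v = 0" if "P *v v = v" for v
    by (subst yv) (simp add: matrix_vector_mult_diff_rdistrib that)
  have comm: "lie_bracket y (el a b) = 0" if "P *v a = a" "P *v b = b" for a b
  proof -
    have "el 0 v = 0" "el v 0 = 0" for v
      using el_scale_left[of 0 0 v] el_scale_right[of v 0 0] by simp_all
    then show ?thesis by (simp add: bracket_el y0 that)
  qed
  have PM: "P *v v = v" if "v \<in> wsp i" "\<bar>i\<bar> \<le> k" for v i
    using WP_wsp[OF that(1)] that(2) by (simp add: abs_le_iff)
  have key: "\<exists>\<beta>. \<forall>i j a b. a \<in> wsp i \<and> b \<in> wsp j \<and> \<bar>i\<bar> \<le> k \<and> \<bar>j\<bar> \<le> k \<and> s \<noteq> - i \<and> s \<noteq> j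
      \<longrightarrow> B y (el a b) = \<epsilon> * bl a b * \<beta>" if s: "wsp s \<noteq> {0}" "\<bar>s\<bar> \<le> k" for s
  proof -
    obtain c d where cd: "c \<in> wsp s" "d \<in> wsp (- s)" "bl d c = 1"
      using dual_weight_vector[OF s(1)] by blast
    show ?thesis
    proof (intro exI[of _ "B y (el c d)"] allI impI, elim conjE)
      fix i j a b
      assume ab: "a \<in> wsp i" "b \<in> wsp j" "\<bar>i\<bar> \<le> k" "\<bar>j\<bar> \<le> k" "s \<noteq> - i" "s \<noteq> j"
      have wc: "\<phi> (el a d) *v c = a"
        using bl_wsp[OF ab(1) cd(1)] ab(5) by (simp add: rep_el skw_vec cd(3))
      have wb: "\<phi> (el a d) *v b = (- \<epsilon> * bl a b) *s d"
        using bl_wsp[OF cd(2) ab(2)] ab(6) by (simp add: rep_el skw_vec)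
      have "B y (lie_bracket (el a d) (el c b)) = 0"
        using PM[OF ab(1,3)] PM[OF cd(2)] s(2) by (intro form_transfer comm) simp_all
      then have "B y (el a b) + (- \<epsilon> * bl a b) * B y (el c d) = 0"
        by (simp only: bracket_el wc wb el_scale_right form_add_right form_scale_right)
      then show "B y (el a b) = \<epsilon> * bl a b * B y (el c d)" by (simp add: add_eq_0_iff)
    qed
  qed
  fix i j a b
  assume ab: "a \<in> wsp i" "b \<in> wsp j" "\<bar>i\<bar> \<le> k" "\<bar>j\<bar> \<le> k"
  have "wsp (- k) \<noteq> {0}"
  proof -
    obtain c d where "d \<in> wsp (- k)" "bl d c = 1"
      using dual_weight_vector[OF k_weight] by blast
    then show ?thesis by (metis bl_zero_left singletonD zero_neq_one)
  qed
  then have ws: "wsp s \<noteq> {0}" "\<bar>s\<bar> \<le> k" if "s \<in> {k, - k, m}" for s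
  proof -
    from that consider "s = k" | "s = - k" | "s = m" by blast
    then show "wsp s \<noteq> {0}" "\<bar>s\<bar> \<le> k"
      by (cases; use \<open>wsp (- k) \<noteq> {0}\<close> k_weight m_weight km in simp)+
  qed
  show "B y (el a b) = 0"
  proof (cases "i + j = 0")
    case False
    \<comment> \<open>The three candidates are distinct because 0 \<le> m < k, and at most two
      values are excluded.\<close>
    have "\<exists>s \<in> {k, - k, m}. s \<noteq> - i \<and> s \<noteq> j"
      using km by (cases "k = - i \<or> k = j"; cases "- k = - i \<or> - k = j") auto
    then obtain s where s: "s \<in> {k, - k, m}" "s \<noteq> - i" "s \<noteq> j" by blast
    then show ?thesis
      using key[OF ws[OF s(1)]] ab bl_wsp[OF ab(1,2) False] by fastforce
  next
    case True
    have "\<exists>s \<in> {k, - k, m}. s \<noteq> i \<and> s \<noteq> - i"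
      using km by (cases "k = i \<or> k = - i") auto
    then obtain s where s: "s \<in> {k, - k, m}" "s \<noteq> i" "s \<noteq> - i" by blast
    have j: "j = - i" using True by simp
    obtain \<beta> where \<beta>: "\<And>i j a b. a \<in> wsp i \<Longrightarrow> b \<in> wsp j \<Longrightarrow> \<bar>i\<bar> \<le> k \<Longrightarrow> \<bar>j\<bar> \<le> k \<Longrightarrow> s \<noteq> - i \<Longrightarrow> s \<noteq> j
      \<Longrightarrow> B y (el a b) = \<epsilon> * bl a b * \<beta>"
      using key[OF ws[OF s(1)]] by blast
    have 1: "B y (el a b) = \<epsilon> * bl a b * \<beta>" using \<beta>[OF ab] s j by simp
    \<comment> \<open>Exchanging a and b multiplies the left side by -\<epsilon> and the right side
      by \<epsilon>, with the same \<beta>.\<close>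
    have "- \<epsilon> * B y (el a b) = \<epsilon> * (\<epsilon> * bl a b) * \<beta>"
      using \<beta>[OF ab(2,1,4,3)] s j by (simp add: el_swap[of b a] form_scale_right bl_sym[of b a] del: lie.scale_minus_left)
    then have "\<epsilon> * B y (el a b) = 0" unfolding 1 by (simp add: algebra_simps)
    then show ?thesis using eps by auto
  qed
qed

text \<open>Let \<open>T\<close> be X outside the band and 0 on it. It is invertible outside the
  band, where weights are nonzero, with partial inverse \<tau>. Hence a \<open>y\<close> with only
  off-diagonal blocks is a bracket of \<open>t\<close> with some \<open>y1\<close>, and invariance
  moves \<open>t\<close> onto band elements, with which it commutes. Both functions are odd, so the
  operators are skew and lie in the algebra.\<close>

lemma form_mixed:
  assumes y: "P ** \<phi> y ** P = 0" "(mat 1 - P) ** \<phi> y ** (mat 1 - P) = 0"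
    and u: "\<phi> u = P ** \<phi> u ** P"
  shows "B y u = 0"
proof -
  define \<tau> where "\<tau> = fc (\<lambda>j. if j \<in> {- k..k} then 0 else complex_of_real (1 / j))"
  define T where "T = fc (\<lambda>j. if j \<in> {- k..k} then 0 else complex_of_real j)"
  have k0: "k \<ge> 0" using km by simp
  have sw: "(- j \<in> {- k..k}) = (j \<in> {- k..k})" for j by auto
  have odd: "skew (fc (\<lambda>j. if j \<in> {- k..k} then 0 else complex_of_real (g j)))" if "\<And>j. g (- j) = - g j" for g
  proof -
    have "(\<lambda>j. if - j \<in> {- k..k} then 0 else complex_of_real (g (- j)))
        = (\<lambda>j. - (if j \<in> {- k..k} then 0 else complex_of_real (g j)))"
      unfolding sw that by auto
    moreover have "fc (\<lambda>j. - h j) *v v = - (fc h *v v)" for h v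
      by (induction v rule: wsp_induct) (simp_all add: fc_wsp vec.add)
    ultimately show ?thesis unfolding skew_def bl_fc by simp
  qed
  have sk\<tau>: "skew \<tau>" unfolding \<tau>_def by (rule odd) simp
  have skT: "skew T" unfolding T_def by (rule odd) simp
  have T\<tau>: "T *v (\<tau> *v v) = v - P *v v" and \<tau>T: "\<tau> *v (T *v v) = v - P *v v"
    and TP: "T *v (P *v v) = 0" and \<tau>P: "\<tau> *v (P *v v) = 0"
    and PT: "P *v (T *v v) = 0" and P\<tau>: "P *v (\<tau> *v v) = 0" for v
    by (induction v rule: wsp_induct; use k0 in \<open>auto simp: T_def \<tau>_def fc_wsp WP_wsp vec.add vec.scale\<close>)+
  let ?Y = "\<tau> ** \<phi> y ** P - P ** \<phi> y ** \<tau>"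
  have "skew ?Y"
    using skew_rep[of y] sk\<tau> P_self_adjoint
    by (simp add: skew_def mult_mult_vec matrix_vector_mult_diff_rdistrib
        bl_diff_left bl_diff_right)
  then obtain y1 where y1: "\<phi> y1 = ?Y" using rep_inv by blast
  obtain t where t: "\<phi> t = T" using rep_inv[OF skT] by blast
  have y1': "P *v (\<phi> y *v (P *v v)) = 0" for v
    using y(1) by (metis matrix_vector_mul_assoc matrix_vector_mult_0)
  have y2': "\<phi> y *v v - \<phi> y *v (P *v v) = P *v (\<phi> y *v v) - P *v (\<phi> y *v (P *v v))" for v
  proof -
    have "((mat 1 - P) ** \<phi> y ** (mat 1 - P)) *v v = 0" by (simp add: y(2))
    then show ?thesis
      by (simp add: mult_mult_vec matrix_vector_mult_diff_rdistrib vec.diff algebra_simps)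
  qed
  have yt: "lie_bracket t y1 = y"
  proof (rule rep_eqI)
    fix v
    have "\<phi> (lie_bracket t y1) *v v
        = (\<phi> y *v (P *v v) - P *v (\<phi> y *v (P *v v))) + (P *v (\<phi> y *v v) - P *v (\<phi> y *v (P *v v)))"
      by (simp add: rep_bracket_vec t y1 matrix_vector_mult_diff_rdistrib mult_mult_vec
          vec.diff T\<tau> TP PT \<tau>T)
    also have "\<dots> = \<phi> y *v v" using y1'[of v] y2'[of v] by (simp add: algebra_simps)
    finally show "\<phi> (lie_bracket t y1) *v v = \<phi> y *v v" .
  qed
  show ?thesis
  proof (rule form_zeroI[OF u])
    fix a b assume "P *v a = a" "P *v b = b"
    then have "T *v a = 0" "T *v b = 0" using TP by metis+
    moreover have "el 0 v = 0" "el v 0 = 0" for v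
      using el_scale_left[of 0 0 v] el_scale_right[of v 0 0] by simp_all
    ultimately have "lie_bracket t (el a b) = 0" by (simp add: bracket_el t)
    then have "B (lie_bracket y1 t) (el a b) = 0" by (simp add: form_invariant)
    then show "B y (el a b) = 0"
      unfolding yt[symmetric] lie_anticommute[of t y1] form_minus_left by simp
  qed
qed

lemma form_complement:
  assumes y: "P ** \<phi> y ** P = 0" and u: "\<phi> u = P ** \<phi> u ** P"
  shows "B y u = 0"
proof -
  let ?R = "mat 1 - P"
  obtain z where z: "\<phi> z = ?R ** \<phi> y ** ?R" using rep_inv[OF skew_off_band] by blast
  have R: "?R *v (?R *v v) = ?R *v v" "P *v (?R *v v) = 0" for v
    by (simp_all add: matrix_vector_mult_diff_rdistrib vec.diff)
  have zR: "?R ** \<phi> z ** ?R = \<phi> z"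
    unfolding matrix_eq by (simp add: z mult_mult_vec R)
  have "B z u = 0" by (rule form_off_band[OF zR[symmetric] u])
  moreover have "B (y - z) u = 0"
  proof (rule form_mixed[OF _ _ u])
    have "P *v (\<phi> y *v (P *v v)) = 0" for v
      using y by (metis matrix_vector_mul_assoc matrix_vector_mult_0)
    then show "P ** \<phi> (y - z) ** P = 0"
      unfolding matrix_eq by (simp add: rep_diff z mult_mult_vec
          matrix_vector_mult_diff_rdistrib vec.diff R)
    show "?R ** \<phi> (y - z) ** ?R = 0"
      unfolding matrix_eq
      by (simp add: rep_diff z mult_mult_vec vec.diff R
          matrix_vector_mult_diff_rdistrib[of "\<phi> y"])
  qed
  ultimately show ?thesis by (simp add: form_diff_left)
qed

end

section \<open>The truncated algebra\<close>

lemma trace_add: "trace (A + B :: complex^'n^'n) = trace A + trace B"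
  by (simp add: trace_def sum.distrib)

lemma matrix_add_rdistrib: "(A + B) ** C = A ** C + B ** (C :: complex^'n^'n)"
  by (simp add: matrix_eq mult_mult_vec matrix_vector_mult_add_rdistrib)

lemma trace_mult_eq_0_imp_scalar:
  fixes P :: "complex^'n^'n"
  assumes "\<And>A. trace A = 0 \<Longrightarrow> trace (A ** P) = 0"
  shows "\<exists>c. P = mat c"
proof -
  let ?E = "\<lambda>i j c. (\<chi> r s. if r = i \<and> s = j then c else 0) :: complex^'n^'n"
  have E: "trace (?E i j c ** P) = c * P $ j $ i" for i j c
  proof -
    have "trace (?E i j c ** P) = (\<Sum>r\<in>UNIV. \<Sum>s\<in>UNIV. if r = i \<and> s = j then c * P $ s $ r else 0)"
      by (simp add: trace_def matrix_matrix_mult_def if_distrib if_distribR cong: if_cong)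
    also have "\<dots> = (\<Sum>r\<in>UNIV. if r = i then c * P $ j $ r else 0)"
      by (intro sum.cong refl) (simp add: if_distrib cong: if_cong)
    finally show ?thesis by simp
  qed
  have tr: "trace (?E i j c) = (if i = j then c else 0)" for i j c
  proof -
    have "trace (?E i j c) = (\<Sum>r\<in>UNIV. if r = i then (if i = j then c else 0) else 0)"
      unfolding trace_def by (intro sum.cong refl) auto
    then show ?thesis by simp
  qed
  have off: "P $ j $ i = 0" if "i \<noteq> j" for i j
    using assms[of "?E i j 1"] that by (simp add: E tr)
  have diag: "P $ i $ i = P $ j $ j" for i j
    using assms[of "?E i i 1 + ?E j j (-1)"] by (simp add: E tr trace_add matrix_add_rdistrib)
  show ?thesis
    by (rule exI[of _ "P $ undefined $ undefined"]) (auto simp: vec_eq_iff mat_def off diag)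
qed

context form_module begin

text \<open>For sl, tr(P y) = tr(P y P) = 0 for all traceless y makes P scalar, and a vector of
  weight k shows P = 1. For gl, cyclicity of the trace gives orthogonality. The other two families
  go through \<open>form_complement\<close>.\<close>

lemma band_classical:
  fixes k m :: real
  defines "P \<equiv> WP {- k..k}"
  assumes classical: "classical_type (range \<phi>)"
    and km: "0 \<le> m" "m < k" and weights: "wsp k \<noteq> {0}" "wsp m \<noteq> {0}"
    and sl_case: "range \<phi> = {A. trace A = 0} \<Longrightarrow> \<forall>y. P ** \<phi> y ** P \<in> range \<phi>"
    and gl_case: "range \<phi> = UNIV \<Longrightarrow> P \<noteq> mat 1 \<Longrightarrow> \<exists>c. \<forall>y y'. B y y' = c * trace (\<phi> y ** \<phi> y')"
  shows "P ** \<phi> y ** P \<in> range \<phi>"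
    and "P ** \<phi> z ** P = 0 \<Longrightarrow> \<phi> u = P ** \<phi> u ** P \<Longrightarrow> B z u = 0"
proof -
  have PP: "P ** P = P" by (simp add: P_def matrix_eq mult_mult_vec WP_WP)
  have triv: "B z u = 0" if "P = mat 1" "P ** \<phi> z ** P = 0" for z u
    using that rep_inj[of z 0] by simp
  have ortho: "P ** \<phi> y ** P \<in> range \<phi> \<and> (P ** \<phi> z ** P = 0 \<longrightarrow> \<phi> u = P ** \<phi> u ** P \<longrightarrow> B z u = 0)"
    if "invertible Q" "transpose Q = mat \<epsilon> ** Q" "\<epsilon> * \<epsilon> = 1" "range \<phi> = orthosymplectic Q" for Q \<epsilon>
  proof -
    interpret ortho_module \<phi> f x e B Q \<epsilon> k m
      by unfold_locales (use that km weights in auto)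
    show ?thesis
      using orthosymplectic_iff_skew skew_band[of y] form_complement[of z u] that(4)
      unfolding P_def by blast
  qed
  have all: "P ** \<phi> y ** P \<in> range \<phi> \<and> (P ** \<phi> z ** P = 0 \<longrightarrow> \<phi> u = P ** \<phi> u ** P \<longrightarrow> B z u = 0)"
    using classical unfolding classical_type_def
  proof (elim disjE exE conjE)
    assume gl: "range \<phi> = UNIV"
    show ?thesis
    proof (intro conjI impI)
      assume z: "P ** \<phi> z ** P = 0" and u: "\<phi> u = P ** \<phi> u ** P"
      show "B z u = 0"
      proof (cases "P = mat 1")
        case True
        then show ?thesis using triv z by blast
      next
        case False
        then obtain c where c: "\<And>y y'. B y y' = c * trace (\<phi> y ** \<phi> y')" using gl_case gl by blast
        have "trace (\<phi> z ** \<phi> u) = trace ((\<phi> z ** P ** \<phi> u) ** P)"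
          by (subst u) (simp add: matrix_mul_assoc)
        also have "\<dots> = trace ((P ** \<phi> z ** P) ** \<phi> u)"
          by (subst trace_mul_sym) (simp add: matrix_mul_assoc)
        finally show ?thesis by (simp add: c z trace_def)
      qed
    qed (simp add: gl)
  next
    assume sl: "range \<phi> = {A. trace A = 0}"
    have "\<exists>c. P = mat c"
    proof (rule trace_mult_eq_0_imp_scalar)
      fix A :: "complex^'n^'n" assume "trace A = 0"
      then obtain y where y: "A = \<phi> y" using sl by blast
      have "trace (P ** \<phi> y ** P) = 0" using sl_case[OF sl] sl by blast
      then have "trace (P ** (P ** \<phi> y)) = 0" by (subst (asm) trace_mul_sym)
      then have "trace (P ** \<phi> y) = 0" by (simp add: matrix_mul_assoc PP)
      then show "trace (A ** P) = 0" unfolding y by (subst trace_mul_sym)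
    qed
    then obtain c where c: "P = mat c" by blast
    obtain v where v: "v \<in> wsp k" "v \<noteq> 0" using weights(1) wsp_0 by blast
    have "c *s v = v"
      using WP_wsp[OF v(1), of "{- k..k}"] km c by (simp add: P_def[symmetric] mat_mult_vec)
    then have "(c - 1) *s v = 0" by (simp add: vec.scale_left_diff_distrib)
    then have "c - 1 = 0" using v(2) by (simp only: vec.scale_eq_0_iff) simp
    then have "P = mat 1" using c by simp
    then show ?thesis using triv by auto
  next
    fix Q :: "complex^'n^'n"
    assume Q: "invertible Q" "transpose Q = Q" "range \<phi> = orthosymplectic Q"
    then have "transpose Q = mat 1 ** Q" by simp
    then show ?thesis by (intro ortho[of Q 1]) (use Q in auto)
  next
    fix Q :: "complex^'n^'n"
    assume Q: "invertible Q" "transpose Q = - Q" "range \<phi> = orthosymplectic Q"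
    then have "transpose Q = mat (-1) ** Q"
      by (simp add: matrix_eq mult_mult_vec mat_mult_vec minus_mult_vec del: transpose_matrix_vector)
    then show ?thesis by (intro ortho[of Q "-1"]) (use Q in auto)
  qed
  show "P ** \<phi> y ** P \<in> range \<phi>" using all by blast
  show "P ** \<phi> z ** P = 0 \<Longrightarrow> \<phi> u = P ** \<phi> u ** P \<Longrightarrow> B z u = 0" using all by blast
qed

section \<open>The grading by ad x\<close>

lemma ad_eigen_wsp:
  assumes "y \<in> ad_eigenspace x j" "v \<in> wsp i" shows "\<phi> y *v v \<in> wsp (i + j)"
proof -
  have "\<phi> (lie_bracket x y) *v v = complex_of_real j *s (\<phi> y *v v)"
    using assms(1) by (simp add: ad_eigenspace_def rep_scale_vec)
  then have "\<phi> x *v (\<phi> y *v v) = complex_of_real j *s (\<phi> y *v v) + \<phi> y *v (\<phi> x *v v)"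
    by (simp add: rep_bracket_vec algebra_simps)
  then show ?thesis
    using assms(2) by (simp add: mem_wsp vec.scale vec.scale_left_distrib)
qed

lemma ad_eigenI:
  assumes "\<And>i v. v \<in> wsp i \<Longrightarrow> \<phi> y *v v \<in> wsp (i + j)" shows "y \<in> ad_eigenspace x j"
proof -
  have "\<phi> (lie_bracket x y) = \<phi> (complex_of_real j *\<^sub>L y)"
  proof (rule matrix_eqI_wsp)
    fix i v assume v: "v \<in> wsp i"
    show "\<phi> (lie_bracket x y) *v v = \<phi> (complex_of_real j *\<^sub>L y) *v v"
      using assms[OF v] v
      by (simp add: rep_bracket_vec rep_scale_vec mem_wsp vec.scale vec.scale_left_distrib)
  qed
  then show ?thesis by (simp add: ad_eigenspace_def rep_inj)
qed

lemma WP_ad_eigen: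
  "y \<in> ad_eigenspace x j \<Longrightarrow> WP I *v (\<phi> y *v v) = \<phi> y *v (WP {i. i + j \<in> I} *v v)"
  by (rule WP_shift) (rule ad_eigen_wsp)

lemma ad_eigen_bracket:
  "y \<in> ad_eigenspace x i \<Longrightarrow> z \<in> ad_eigenspace x j \<Longrightarrow> lie_bracket y z \<in> ad_eigenspace x (i + j)"
proof (rule ad_eigenI)
  fix l v assume y: "y \<in> ad_eigenspace x i" and z: "z \<in> ad_eigenspace x j" and v: "v \<in> wsp l"
  have "\<phi> y *v (\<phi> z *v v) \<in> wsp (l + (i + j))" "\<phi> z *v (\<phi> y *v v) \<in> wsp (l + (i + j))"
    using ad_eigen_wsp[OF y ad_eigen_wsp[OF z v]] ad_eigen_wsp[OF z ad_eigen_wsp[OF y v]]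
    by (simp_all add: add_ac)
  then show "\<phi> (lie_bracket y z) *v v \<in> wsp (l + (i + j))"
    using wsp_add[of _ _ "- 1 *s (\<phi> z *v (\<phi> y *v v))"] wsp_scale[of _ _ "-1"]
    by (fastforce simp: rep_bracket_vec)
qed

lemma form_ad_eigen:
  assumes "y \<in> ad_eigenspace x i" "z \<in> ad_eigenspace x j" "i + j \<noteq> 0" shows "B y z = 0"
proof -
  have "complex_of_real j * B y z = - (complex_of_real i * B y z)"
    using form_invariant'[of y x z] assms(1,2)
    by (simp add: ad_eigenspace_def form_scale_left form_scale_right)
  then have "complex_of_real (i + j) * B y z = 0" by (simp add: algebra_simps)
  then show ?thesis using assms(3) by (simp only: mult_eq_0_iff of_real_eq_0_iff) simp
qed

lemma f_ad_eigen: "f \<in> ad_eigenspace x (- 1)"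
  by (rule ad_eigenI) (use F_wsp in simp)

end

text \<open>What the rest of the argument uses about a classical type: truncation stays in the
  algebra, the kernel of truncation is orthogonal to its image, and all weights lie in one class
  modulo the integers.\<close>

locale band_module = form_module \<phi> f x e B
  for \<phi> :: "'g::complex_lie_algebra \<Rightarrow> complex^'n^'n" and f x e :: 'g and B +
  fixes k :: real
  assumes band_in_range: "WP {- k..k} ** \<phi> y ** WP {- k..k} \<in> range \<phi>"
    and form_band_complement: "WP {- k..k} ** \<phi> y ** WP {- k..k} = 0
      \<Longrightarrow> \<phi> z = WP {- k..k} ** \<phi> z ** WP {- k..k} \<Longrightarrow> B y z = 0"
    and weights_integral: "v \<in> wsp i \<Longrightarrow> v \<noteq> 0 \<Longrightarrow> w \<in> wsp j \<Longrightarrow> w \<noteq> 0 \<Longrightarrow> i - j \<in> \<int>"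
begin

abbreviation "P \<equiv> WP {- k..k}"
abbreviation "bd \<equiv> band \<phi> x k"
text \<open>\<open>PL\<close> and \<open>PG\<close> are the projections onto V[<k] and V[>-k] inside
  the band: the rows and columns of the operator that is inverted in the Lax operator.\<close>

abbreviation "PL \<equiv> WP {- k..<k}"
abbreviation "PG \<equiv> WP {- k<..k}"

lemma band_proj_eq: "band_proj \<phi> x k = P"
  by (simp add: band_proj_def weight_proj_WP)

lemma P_P [simp]: "P *v (P *v v) = P *v v"
  by (simp add: WP_WP)

lemma rep_band: "\<phi> (bd y) = P ** \<phi> y ** P"
  unfolding band_def band_proj_eq by (rule f_inv_into_f[OF band_in_range])

lemma rep_band_vec: "\<phi> (bd y) *v v = P *v (\<phi> y *v (P *v v))"
  by (simp add: rep_band matrix_vector_mul_assoc matrix_mul_assoc)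

lemma band_eq_iff: "bd y = y \<longleftrightarrow> (\<forall>v. P *v (\<phi> y *v (P *v v)) = \<phi> y *v v)"
  unfolding rep_inj[symmetric] matrix_eq rep_band_vec ..

lemma band_band [simp]: "bd (bd y) = bd y"
  by (rule rep_eqI) (simp add: rep_band_vec)

lemma band_add: "bd (y + z) = bd y + bd z"
  by (rule rep_eqI) (simp add: rep_band_vec rep_add matrix_vector_mult_add_rdistrib vec.add)

lemma band_diff: "bd (y - z) = bd y - bd z"
  by (rule rep_eqI) (simp add: rep_band_vec rep_diff matrix_vector_mult_diff_rdistrib vec.diff)

lemma band_scale: "bd (c *\<^sub>L y) = c *\<^sub>L bd y"
  by (rule rep_eqI) (simp add: rep_band_vec rep_scale_vec vec.scale)

lemma mem_range_band: "y \<in> range bd \<longleftrightarrow> bd y = y"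
  by (metis band_band rangeE rangeI)

lemma rep_band_fixed:
  assumes "bd y = y" shows "P *v (\<phi> y *v v) = \<phi> y *v v" "\<phi> y *v (P *v v) = \<phi> y *v v"
  using assms unfolding band_eq_iff by (metis P_P)+

lemma band_bracket: "bd y = y \<Longrightarrow> bd z = z \<Longrightarrow> bd (lie_bracket y z) = lie_bracket y z"
  unfolding band_eq_iff[of "lie_bracket y z"] by (simp add: rep_bracket_vec vec.diff rep_band_fixed)

lemma form_band: "bd z = z \<Longrightarrow> B y z = B (bd y) z"
proof -
  assume z: "bd z = z"
  have "B (y - bd y) z = 0"
  proof (rule form_band_complement)
    show "P ** \<phi> (y - bd y) ** P = 0"
      unfolding matrix_eq by (simp add: mult_mult_vec rep_diff
          matrix_vector_mult_diff_rdistrib rep_band_vec vec.diff)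
    show "\<phi> z = P ** \<phi> z ** P" using z rep_band by metis
  qed
  then show ?thesis by (simp add: form_diff_left)
qed

lemma band_ad_eigen: "y \<in> ad_eigenspace x j \<Longrightarrow> bd y \<in> ad_eigenspace x j"
proof (rule ad_eigenI)
  fix i v assume y: "y \<in> ad_eigenspace x j" and v: "v \<in> wsp i"
  have *: "P *v u \<in> wsp l" if "u \<in> wsp l" for u l using WP_wsp[OF that, of "{- k..k}"] that by simp
  show "\<phi> (bd y) *v v \<in> wsp (i + j)"
    unfolding rep_band_vec by (intro * ad_eigen_wsp[OF y] v)
qed

lemma X_P: "\<phi> x *v (P *v v) = P *v (\<phi> x *v v)"
proof (induction v rule: wsp_induct)
  case (wsp j v)
  then show ?case using WP_wsp[OF wsp, of "{- k..k}"] by (auto simp: mem_wsp vec.scale)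
qed (simp add: vec.add)

text \<open>\<open>x\<close> and its truncation differ by an operator that vanishes on the band and
  so commutes with the truncated algebra. Degrees in that algebra may thus be computed with
  \<open>x\<close>.\<close>

lemma band_x_bracket: "bd y = y \<Longrightarrow> lie_bracket (bd x) y = lie_bracket x y"
proof (rule rep_eqI)
  fix v assume y: "bd y = y"
  then have "P *v (\<phi> x *v (\<phi> y *v v)) = \<phi> x *v (\<phi> y *v v)"
    using X_P[of "\<phi> y *v v"] rep_band_fixed(1)[OF y] by simp
  then show "\<phi> (lie_bracket (bd x) y) *v v = \<phi> (lie_bracket x y) *v v"
    by (simp add: rep_bracket_vec rep_band_vec X_P rep_band_fixed[OF y])
qed

lemma ad_eigen_integral:
  assumes "y \<in> ad_eigenspace x j" "y \<noteq> 0" shows "j \<in> \<int>"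
proof (rule ccontr)
  assume j: "j \<notin> \<int>"
  have "\<phi> y = 0"
  proof (rule matrix_eqI_wsp)
    fix i v assume v: "v \<in> wsp i"
    show "\<phi> y *v v = 0 *v v"
    proof (rule ccontr)
      assume n: "\<phi> y *v v \<noteq> 0 *v v"
      then have "v \<noteq> 0" by auto
      then have "(i + j) - i \<in> \<int>"
        using weights_integral[OF ad_eigen_wsp[OF assms(1) v] _ v] n by simp
      then show False using j by simp
    qed
  qed
  then show False using assms(2) rep_inj[of y 0] by simp
qed

end

section \<open>Dual bases of the truncated algebra\<close>

locale lax_basis = band_module \<phi> f x e B k
  for \<phi> :: "'g::complex_lie_algebra \<Rightarrow> complex^'n^'n" and f x e :: 'g and B k +
  fixes d :: nat and u u' :: "nat \<Rightarrow> 'g" and \<delta> :: "nat \<Rightarrow> real"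
  assumes dual: "dual_eigenbases B (range (band \<phi> x k)) (band \<phi> x k x) d u \<delta> u'"
begin

lemma u_band: "i < d \<Longrightarrow> bd (u i) = u i" and u'_band: "i < d \<Longrightarrow> bd (u' i) = u' i"
proof -
  assume i: "i < d"
  have "u i \<in> lie.span (u ` {..<d})" using i by (intro lie.span_base) simp
  then show "bd (u i) = u i" "bd (u' i) = u' i"
    using dual i unfolding dual_eigenbases_def mem_range_band[symmetric] by auto
qed

lemma dual_form: "i < d \<Longrightarrow> j < d \<Longrightarrow> B (u i) (u' j) = (if i = j then 1 else 0)"
  using dual by (auto simp: dual_eigenbases_def)

lemma u_ad_eigen: "i < d \<Longrightarrow> u i \<in> ad_eigenspace x (\<delta> i)"
proof -
  assume i: "i < d"
  then have "u i \<in> ad_eigenspace (bd x) (\<delta> i)" using dual by (auto simp: dual_eigenbases_def)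
  then show ?thesis using band_x_bracket[OF u_band[OF i]] by (simp add: ad_eigenspace_def)
qed

lemma delta_integral: "i < d \<Longrightarrow> \<delta> i \<in> \<int>"
  using ad_eigen_integral[OF u_ad_eigen] dual_form[of i i] by fastforce

lemma expand_u:
  assumes "bd y = y" shows "y = (\<Sum>i<d. B y (u' i) *\<^sub>L u i)"
proof -
  have "y \<in> lie.span (u ` {..<d})"
    using assms dual unfolding dual_eigenbases_def mem_range_band[symmetric] by blast
  then show ?thesis
  proof (induction rule: lie.span_induct_alt)
    case (step c w y)
    then obtain j where j: "j < d" "w = u j" by blast
    have "(\<Sum>i<d. B (c *\<^sub>L w + y) (u' i) *\<^sub>L u i)
        = c *\<^sub>L (\<Sum>i<d. (if i = j then u i else 0)) + (\<Sum>i<d. B y (u' i) *\<^sub>L u i)"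
      unfolding lie.scale_sum_right sum.distrib[symmetric]
      using j by (intro sum.cong refl)
        (auto simp: form_add_left form_scale_left dual_form lie.scale_left_distrib)
    then show ?case using step j by simp
  qed simp
qed

text \<open>The difference of both sides lies in the band and is orthogonal to all
  \<open>u j\<close>. By \<open>form_band\<close> it is then orthogonal to the whole algebra, so
  nondegeneracy of \<open>B\<close> suffices.\<close>

lemma expand_u':
  assumes "bd y = y" shows "y = (\<Sum>i<d. B y (u i) *\<^sub>L u' i)"
proof -
  define r where "r = y - (\<Sum>i<d. B y (u i) *\<^sub>L u' i)"
  have sum_band: "bd (\<Sum>i\<in>I. c i *\<^sub>L u' i) = (\<Sum>i\<in>I. c i *\<^sub>L u' i)" if "I \<subseteq> {..<d}" for I c
    using that
  proof (induction I rule: infinite_finite_induct)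
    case empty
    then show ?case by (simp add: band_eq_iff)
  next
    case (insert i I)
    then show ?case by (simp add: band_add band_scale u'_band)
  qed (simp add: band_eq_iff)
  have r_band: "bd r = r" unfolding r_def by (simp add: band_diff assms sum_band)
  have r0: "B r (u j) = 0" if "j < d" for j
  proof -
    have "(\<Sum>i<d. B y (u i) * B (u' i) (u j)) = (\<Sum>i<d. if i = j then B y (u j) else 0)"
      by (intro sum.cong refl) (use that in \<open>auto simp: form_sym[of "u' _"] dual_form\<close>)
    also have "\<dots> = B y (u j)" using that by simp
    finally show ?thesis by (simp add: r_def form_diff_left form_sum_left form_scale_left)
  qed
  have "B r z = 0" for z
  proof -
    have "B r z = B r (bd z)" using form_band[OF r_band, of z] by (simp add: form_sym)
    also have "\<dots> = 0"
      by (subst expand_u[of "bd z"]) (simp_all add: form_sum_right form_scale_right r0)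
    finally show ?thesis .
  qed
  then have "r = 0" by (rule form_nondegenerate)
  then show ?thesis by (simp add: r_def)
qed

lemma u'_ad_eigen:
  assumes i: "i < d" shows "u' i \<in> ad_eigenspace x (- \<delta> i)"
proof -
  have b: "bd (lie_bracket x (u' i)) = lie_bracket x (u' i)"
    using band_bracket[of "bd x" "u' i"] u'_band[OF i] band_x_bracket by simp
  have "B (lie_bracket x (u' i)) (u j) = (if j = i then - complex_of_real (\<delta> i) else 0)" if "j < d" for j
  proof -
    have "B (lie_bracket x (u' i)) (u j) = - B (u' i) (lie_bracket x (u j))"
      by (simp add: form_invariant')
    also have "\<dots> = - (complex_of_real (\<delta> j) * B (u j) (u' i))"
      using u_ad_eigen[OF that] by (simp add: ad_eigenspace_def form_scale_right form_sym[of "u' i"])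
    finally show ?thesis using that i by (simp add: dual_form)
  qed
  then have "lie_bracket x (u' i) = (\<Sum>j<d. if j = i then (- complex_of_real (\<delta> i)) *\<^sub>L u' i else 0)"
    by (subst expand_u'[OF b]) (intro sum.cong refl; simp del: lie.scale_minus_left)
  then show ?thesis using i by (simp add: ad_eigenspace_def)
qed

text \<open>The tensor \<open>\<Sum> u\<^sub>i \<otimes> u\<^sup>i\<close> is invariant under \<open>y\<close>; \<open>cf y\<close> is the matrix of \<open>ad y\<close>.\<close>

definition "cf y i l = B (lie_bracket y (u i)) (u' l)"

lemma bracket_u: "bd y = y \<Longrightarrow> i < d \<Longrightarrow> lie_bracket y (u i) = (\<Sum>l<d. cf y i l *\<^sub>L u l)"
  unfolding cf_def by (rule expand_u[OF band_bracket[OF _ u_band]])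

lemma bracket_u': "bd y = y \<Longrightarrow> l < d \<Longrightarrow> lie_bracket (u' l) y = (\<Sum>i<d. cf y i l *\<^sub>L u' i)"
  by (subst expand_u'[OF band_bracket[OF u'_band]])
    (simp_all add: cf_def form_invariant form_sym[of "u' l"])

lemma cf_eq_0: "y \<in> ad_eigenspace x j \<Longrightarrow> i < d \<Longrightarrow> l < d \<Longrightarrow> \<delta> l \<noteq> \<delta> i + j \<Longrightarrow> cf y i l = 0"
  unfolding cf_def by (rule form_ad_eigen[OF ad_eigen_bracket[OF _ u_ad_eigen] u'_ad_eigen]) auto

end

section \<open>Vectors over the enveloping algebra\<close>

lemma free_const_commute: "free_const c * p = p * (free_const c :: 'a free_alg)"
  unfolding free_const_def
proof (induction p rule: update_induct)
  case const
  show ?case by simp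
next
  case (update f a b)
  have "Poly_Mapping.update a b f = f + Poly_Mapping.single a b"
    by (rule poly_mapping_eqI)
      (use update in \<open>auto simp: lookup_update lookup_add lookup_single when_def in_keys_iff\<close>)
  then show ?case using update by (simp add: distrib_left distrib_right mult_single mult.commute)
qed

lemma uea_const_commute: "uea_const c * a = a * uea_const c"
  by transfer (simp add: uea_rel_def uea_ideal.zero free_const_commute)

lemma uea_const_add: "uea_const (c + c') = uea_const c + uea_const c'"
  by transfer (simp add: uea_rel_def uea_ideal.zero free_const_def single_add)

lemma uea_const_mult: "uea_const (c * c') = uea_const c * uea_const c'"
  by transfer (simp add: uea_rel_def uea_ideal.zero free_const_def mult_single)

lemma uea_const_0 [simp]: "uea_const 0 = 0"
  by transfer (simp add: uea_rel_def uea_ideal.zero free_const_def)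

lemma uea_const_1 [simp]: "uea_const 1 = 1"
  by transfer (simp add: uea_rel_def uea_ideal.zero free_const_def single_one[symmetric] del: single_one)

lemma uea_const_minus: "uea_const (- c) = - uea_const c"
  using uea_const_add[of c "- c"] by (simp add: eq_neg_iff_add_eq_0 add.commute)

lemma uea_const_sum: "uea_const (\<Sum>i\<in>I. c i) = (\<Sum>i\<in>I. uea_const (c i))"
  by (induction I rule: infinite_finite_induct) (simp_all add: uea_const_add)

lemma uea_gen_linear: "uea_gen (c *\<^sub>L y + y') = uea_const c * uea_gen y + uea_gen y'"
  by transfer (use uea_ideal.linear in \<open>simp add: uea_rel_def diff_diff_eq[symmetric]\<close>)

lemma uea_gen_add: "uea_gen (y + y') = uea_gen y + uea_gen y'"
  using uea_gen_linear[of 1 y y'] by (simp add: lie_scale_one)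

lemma uea_gen_0 [simp]: "uea_gen 0 = 0"
  using uea_gen_add[of 0 0] by simp

lemma uea_gen_scale: "uea_gen (c *\<^sub>L y) = uea_const c * uea_gen y"
  using uea_gen_linear[of c y 0] by simp

lemma uea_gen_bracket: "uea_gen (lie_bracket y y') = uea_gen y * uea_gen y' - uea_gen y' * uea_gen y"
proof -
  have "uea_gen y * uea_gen y' - uea_gen y' * uea_gen y = uea_gen (lie_bracket y y')"
    by transfer (use uea_ideal.bracket in \<open>simp add: uea_rel_def\<close>)
  then show ?thesis ..
qed

text \<open>Complex matrices act through \<open>mv\<close> and Lie algebra elements by left
  multiplication through \<open>ga\<close>. The two actions commute since constants are central, so
  noncommutativity is confined to \<open>ga_ga\<close>.\<close>

definition mv :: "complex^'n^'n \<Rightarrow> 'g::complex_lie_algebra uea^'n \<Rightarrow> 'g uea^'n"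
  where "mv A t = (\<chi> i. \<Sum>j\<in>UNIV. uea_const (A $ i $ j) * t $ j)"

definition ga :: "'g::complex_lie_algebra \<Rightarrow> 'g uea^'n \<Rightarrow> 'g uea^'n"
  where "ga y t = (\<chi> i. uea_gen y * t $ i)"

definition cv :: "complex^'n \<Rightarrow> 'g::complex_lie_algebra uea^'n"
  where "cv v = (\<chi> i. uea_const (v $ i))"

lemma mv_add_left: "mv (A + A') t = mv A t + mv A' t"
  by (simp add: mv_def vec_eq_iff uea_const_add distrib_right sum.distrib)

lemma mv_0_left [simp]: "mv 0 t = 0"
  by (simp add: mv_def vec_eq_iff)

lemma mv_add_right: "mv A (t + t') = mv A t + mv A t'"
  by (simp add: mv_def vec_eq_iff distrib_left sum.distrib)

lemma mv_0_right [simp]: "mv A 0 = 0"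
  by (simp add: mv_def vec_eq_iff)

lemma mv_minus_left: "mv (- A) t = - mv A t"
  by (simp add: mv_def vec_eq_iff uea_const_minus sum_negf)

lemma mv_minus_right: "mv A (- t) = - mv A t"
  by (simp add: mv_def vec_eq_iff sum_negf)

lemma mv_diff_left: "mv (A - A') t = mv A t - mv A' t"
  using mv_add_left[of A "- A'" t] by (simp add: mv_minus_left)

lemma mv_diff_right: "mv A (t - t') = mv A t - mv A t'"
  using mv_add_right[of A t "- t'"] by (simp add: mv_minus_right)

lemma mv_sum_left: "mv (\<Sum>i\<in>I. A i) t = (\<Sum>i\<in>I. mv (A i) t)"
  by (induction I rule: infinite_finite_induct) (simp_all add: mv_add_left)

lemma mv_sum_right: "mv A (\<Sum>i\<in>I. t i) = (\<Sum>i\<in>I. mv A (t i))"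
  by (induction I rule: infinite_finite_induct) (simp_all add: mv_add_right)

lemma mv_mult: "mv (A ** A') t = mv A (mv A' t)"
proof -
  have "mv (A ** A') t $ i = mv A (mv A' t) $ i" for i
  proof -
    have "mv (A ** A') t $ i = (\<Sum>l\<in>UNIV. \<Sum>j\<in>UNIV. uea_const (A $ i $ j) * uea_const (A' $ j $ l) * t $ l)"
      by (simp add: mv_def matrix_matrix_mult_def uea_const_sum uea_const_mult sum_distrib_right)
    also have "\<dots> = (\<Sum>j\<in>UNIV. \<Sum>l\<in>UNIV. uea_const (A $ i $ j) * uea_const (A' $ j $ l) * t $ l)"
      by (rule sum.swap)
    also have "\<dots> = mv A (mv A' t) $ i"
      by (simp add: mv_def sum_distrib_left mult.assoc)
    finally show ?thesis .
  qed
  then show ?thesis by (simp add: vec_eq_iff)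
qed

lemma mv_mat_nth: "mv (mat c) t $ i = uea_const c * t $ i"
proof -
  have "mv (mat c) t $ i = (\<Sum>j\<in>UNIV. uea_const (if i = j then c else 0) * t $ j)"
    by (simp add: mv_def mat_def)
  also have "\<dots> = (\<Sum>j\<in>UNIV. if j = i then uea_const c * t $ j else 0)"
    by (intro sum.cong refl) auto
  finally show ?thesis by simp
qed

text \<open>Matrix identities are verified on complex vectors, where weight arguments apply, and
  transferred to vectors over the enveloping algebra.\<close>

lemma mv_eqI2: "(\<And>v. A *v (A' *v v) = C *v v) \<Longrightarrow> mv A (mv A' t) = mv C t"
  unfolding mv_mult[symmetric] by (rule arg_cong[of _ _ "\<lambda>A. mv A t"]) (simp add: matrix_eq matrix_vector_mul_assoc)

lemma mv_eqI3: "(\<And>v. A *v (A' *v v) = C *v (C' *v v)) \<Longrightarrow> mv A (mv A' t) = mv C (mv C' t)"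
  by (subst mv_mult[symmetric], subst mv_mult[symmetric], rule arg_cong[of _ _ "\<lambda>A. mv A t"])
    (simp add: matrix_eq matrix_vector_mul_assoc)

lemma mv_scalar_commute: "mv A (mv (mat c) t) = mv (mat c) (mv A t)"
  by (rule mv_eqI3) (simp add: mat_mult_vec vec.scale)

lemma mv_cv: "mv A (cv v) = cv (A *v v)"
  by (simp add: mv_def cv_def vec_eq_iff matrix_vector_mult_def uea_const_sum uea_const_mult)

lemma cv_0 [simp]: "cv 0 = 0"
  by (simp add: cv_def vec_eq_iff)

lemma ga_add_left: "ga (y + y') t = ga y t + ga y' t"
  by (simp add: ga_def vec_eq_iff uea_gen_add distrib_right)

lemma ga_0_left [simp]: "ga 0 t = 0"
  by (simp add: ga_def vec_eq_iff)

lemma ga_0_right [simp]: "ga y 0 = 0"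
  by (simp add: ga_def vec_eq_iff)

lemma ga_add_right: "ga y (t + t') = ga y t + ga y t'"
  by (simp add: ga_def vec_eq_iff distrib_left)

lemma ga_diff_right: "ga y (t - t') = ga y t - ga y t'"
  by (simp add: ga_def vec_eq_iff right_diff_distrib)

lemma ga_sum_right: "ga y (\<Sum>i\<in>I. t i) = (\<Sum>i\<in>I. ga y (t i))"
  by (induction I rule: infinite_finite_induct) (simp_all add: ga_add_right)

lemma ga_sum_left: "ga (\<Sum>i\<in>I. y i) t = (\<Sum>i\<in>I. ga (y i) t)"
  by (induction I rule: infinite_finite_induct) (simp_all add: ga_add_left)

lemma ga_scale: "ga (c *\<^sub>L y) t = mv (mat c) (ga y t)"
  by (simp add: vec_eq_iff mv_mat_nth) (simp add: ga_def uea_gen_scale mult.assoc)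

lemma mv_ga: "mv A (ga y t) = ga y (mv A t)"
proof -
  have "uea_const c * (uea_gen y * a) = uea_gen y * (uea_const c * a)" for c and a :: "'a uea"
    by (metis uea_const_commute mult.assoc)
  then show ?thesis by (simp add: mv_def ga_def vec_eq_iff sum_distrib_left)
qed

lemma ga_ga: "ga y (ga z t) = ga z (ga y t) + ga (lie_bracket y z) t"
  by (simp add: ga_def vec_eq_iff uea_gen_bracket left_diff_distrib mult.assoc)

section \<open>Congruence modulo the left ideal\<close>

context form_module begin

text \<open>\<open>mv\<close> and \<open>ga\<close> multiply entries from the left, and
  \<open>J\<close> is a left ideal, so congruence modulo this set is compatible with both.\<close>

definition "VJ = {t :: 'g uea^'n. \<forall>i. t $ i \<in> W_J B f x}"

lemma W_J_closed:
  shows "0 \<in> W_J B f x" "a \<in> W_J B f x \<Longrightarrow> b \<in> W_J B f x \<Longrightarrow> a + b \<in> W_J B f x"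
    "a \<in> W_J B f x \<Longrightarrow> r * a \<in> W_J B f x"
  unfolding W_J_def by (auto intro: left_ideal.intros)

lemma W_J_minus: "a \<in> W_J B f x \<Longrightarrow> - a \<in> W_J B f x"
  using W_J_closed(3)[of a "- 1"] by simp

lemma W_J_diff: "a \<in> W_J B f x \<Longrightarrow> b \<in> W_J B f x \<Longrightarrow> a - b \<in> W_J B f x"
  using W_J_closed(2)[OF _ W_J_minus, of a b] by simp

lemma W_J_sum: "(\<And>i. i \<in> I \<Longrightarrow> a i \<in> W_J B f x) \<Longrightarrow> (\<Sum>i\<in>I. a i) \<in> W_J B f x"
  by (induction I rule: infinite_finite_induct) (auto intro: W_J_closed)

lemma VJ_0 [simp]: "0 \<in> VJ"
  by (simp add: VJ_def W_J_closed)

lemma VJ_add: "t \<in> VJ \<Longrightarrow> t' \<in> VJ \<Longrightarrow> t + t' \<in> VJ"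
  by (simp add: VJ_def W_J_closed)

lemma VJ_minus: "t \<in> VJ \<Longrightarrow> - t \<in> VJ"
  by (simp add: VJ_def W_J_minus)

lemma VJ_diff: "t \<in> VJ \<Longrightarrow> t' \<in> VJ \<Longrightarrow> t - t' \<in> VJ"
  by (simp add: VJ_def W_J_diff)

lemma VJ_sum: "(\<And>i. i \<in> I \<Longrightarrow> t i \<in> VJ) \<Longrightarrow> (\<Sum>i\<in>I. t i) \<in> VJ"
  by (simp add: VJ_def W_J_sum)

lemma VJ_mv: "t \<in> VJ \<Longrightarrow> mv A t \<in> VJ"
  by (simp add: VJ_def mv_def W_J_sum W_J_closed)

lemma VJ_ga: "t \<in> VJ \<Longrightarrow> ga y t \<in> VJ"
  by (simp add: VJ_def ga_def W_J_closed)

lemma W_J_gen: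
  assumes "y \<in> ad_eigenspace x j" "j \<ge> 1" shows "uea_gen y - uea_const (B f y) \<in> W_J B f x"
proof -
  have "y \<in> ad_ge x 1"
    unfolding ad_ge_def by (rule lie.span_base) (use assms in auto)
  then show ?thesis unfolding W_J_def by (intro left_ideal.gen) blast
qed

lemma VJ_cv:
  assumes "y \<in> ad_eigenspace x j" "j \<ge> 1" shows "ga y (cv v) - mv (mat (B f y)) (cv v) \<in> VJ"
proof -
  have "(ga y (cv v) - mv (mat (B f y)) (cv v)) $ i = uea_const (v $ i) * (uea_gen y - uea_const (B f y))" for i
    by (simp add: mv_mat_nth) (simp add: ga_def cv_def right_diff_distrib uea_const_commute[of "v $ i"])
  then show ?thesis by (simp add: VJ_def W_J_closed W_J_gen[OF assms])
qed

end

context form_module begin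

definition veq :: "'g uea^'n \<Rightarrow> 'g uea^'n \<Rightarrow> bool" (infix "\<simeq>" 50)
  where "a \<simeq> b \<longleftrightarrow> a - b \<in> VJ"

lemma veq_refl [simp]: "a \<simeq> a"
  by (simp add: veq_def)

lemma veq_trans [trans]: "a \<simeq> b \<Longrightarrow> b \<simeq> c \<Longrightarrow> a \<simeq> c"
  using VJ_add[of "a - b" "b - c"] by (simp add: veq_def)

lemma veq_add: "a \<simeq> b \<Longrightarrow> a' \<simeq> b' \<Longrightarrow> a + a' \<simeq> b + b'"
  using VJ_add[of "a - b" "a' - b'"] by (simp add: veq_def algebra_simps)

lemma veq_diff: "a \<simeq> b \<Longrightarrow> a' \<simeq> b' \<Longrightarrow> a - a' \<simeq> b - b'"
  using VJ_diff[of "a - b" "a' - b'"] by (simp add: veq_def algebra_simps)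

lemma veq_mv: "a \<simeq> b \<Longrightarrow> mv A a \<simeq> mv A b"
  using VJ_mv[of "a - b" A] by (simp add: veq_def mv_diff_right)

lemma veq_ga: "a \<simeq> b \<Longrightarrow> ga y a \<simeq> ga y b"
  using VJ_ga[of "a - b" y] by (simp add: veq_def ga_diff_right)

lemma veq_sum: "(\<And>i. i \<in> I \<Longrightarrow> a i \<simeq> b i) \<Longrightarrow> (\<Sum>i\<in>I. a i) \<simeq> (\<Sum>i\<in>I. b i)"
  using VJ_sum[of I "\<lambda>i. a i - b i"] by (simp add: veq_def sum_subtractf)

lemma veq_0_iff: "a \<simeq> 0 \<longleftrightarrow> a \<in> VJ"
  by (simp add: veq_def)

end

section \<open>Commutators with the coefficients of the Lax operator\<close>

text \<open>The exponents \<open>s\<close> are real, and in the application \<open>t s = 0\<close> unless \<open>s\<close> is a nonnegative half-integer, so that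
  shifts by the degrees \<open>\<delta> i\<close> need no side conditions.\<close>

locale lax_core = lax_basis \<phi> f x e B k d u u' \<delta>
  for \<phi> :: "'g::complex_lie_algebra \<Rightarrow> complex^'n^'n" and f x e :: 'g and B k d u u' \<delta> +
  fixes t :: "real \<Rightarrow> 'g uea^'n" and w :: "complex^'n" and D R0 :: "complex^'n^'n"
  assumes w: "w \<in> wsp (- k)" "\<phi> f *v w = 0" "w \<noteq> 0" and k: "k > 0" "2 * k \<in> \<int>"
    and D: "D = lax_D \<phi> d u \<delta> u'"
    and t_neg: "s < 0 \<Longrightarrow> t s = 0"
    and t_P: "mv (WP {- k..k}) (t s) = t s"
    and t_low: "mv (WP {- k}) (t s) = (if s = 0 then cv w else 0)"
    and t_eq: "mv (WP {- k..<k}) (mv (WP {- k..k} + \<phi> (band \<phi> x k f)) (t s) + mv D (t (s - 1))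
        + (\<Sum>i | i < d \<and> \<delta> i \<le> 0. ga (u i) (mv (\<phi> (u' i)) (t (s - 1 + \<delta> i))))) = 0"
    and R0: "WP {- k<..k} *v v = v \<Longrightarrow> R0 *v (WP {- k..<k} *v (v + \<phi> f *v v)) = v"
begin

abbreviation "S0 \<equiv> {i. i < d \<and> \<delta> i \<le> 0}"

definition "A = P + \<phi> (bd f)"

text \<open>The coefficient of z^-s in Y applied to the series with coefficients \<open>t\<close>;
  the power z^(\<delta> - 1) shifts the exponent by 1 - \<delta>.\<close>

definition "G s = mv A (t s) + mv D (t (s - 1))
  + (\<Sum>i\<in>S0. ga (u i) (mv (\<phi> (u' i)) (t (s - 1 + \<delta> i))))"

lemma PL_G: "mv PL (G s) = 0"
  using t_eq[of s] by (simp add: G_def A_def)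

lemma A_vec: "A *v v = P *v v + P *v (\<phi> f *v (P *v v))"
  by (simp add: A_def matrix_vector_mult_add_rdistrib rep_band_vec)

lemma PG_add_low: "P *v v = PG *v v + WP {- k} *v v"
proof -
  have "{- k<..k} \<union> {- k} = {- k..k}" using k(1) by auto
  then show ?thesis using WP_add[of "{- k<..k}" "{- k}" v] by simp
qed

lemma WP_absorb: "I \<subseteq> J \<Longrightarrow> WP I *v (WP J *v v) = WP I *v v" "I \<subseteq> J \<Longrightarrow> WP J *v (WP I *v v) = WP I *v v"
  by (simp_all add: WP_WP Int_absorb1 Int_absorb2)

text \<open>The leading coefficient \<open>PL A PG\<close> is invertible, so that \<open>Z \<simeq> 0\<close> can be tested after applying it.\<close>

lemma veq_0I:
  assumes "mv P Z = Z" "mv (WP {- k}) Z \<simeq> 0" "mv PL (mv A Z) \<simeq> 0"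
  shows "Z \<simeq> 0"
proof -
  have Z: "Z = mv PG Z + mv (WP {- k}) Z"
  proof -
    have "mv P Z = mv (PG + WP {- k}) Z"
      by (rule arg_cong[of _ _ "\<lambda>A. mv A Z"]) (simp add: matrix_eq matrix_vector_mult_add_rdistrib PG_add_low)
    then show ?thesis by (simp add: assms(1) mv_add_left)
  qed
  have "mv PL (mv A Z) - mv PL (mv A (mv (WP {- k}) Z)) \<simeq> 0 - 0"
    using veq_mv[OF veq_mv[OF assms(2)], of PL A] by (intro veq_diff assms(3)) simp
  also have "mv PL (mv A Z) - mv PL (mv A (mv (WP {- k}) Z)) = mv PL (mv A (mv PG Z))"
    by (subst Z) (simp add: mv_add_right)
  finally have "mv R0 (mv PL (mv A (mv PG Z))) \<simeq> mv R0 0" by (intro veq_mv) simp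
  moreover have "mv R0 (mv PL (mv A (mv PG Z))) = mv PG Z"
  proof -
    have "R0 *v (PL *v (A *v (PG *v v))) = PG *v v" for v
    proof -
      have "PL *v (A *v (PG *v v)) = PL *v (PG *v v + \<phi> f *v (PG *v v))"
      proof -
        have "{- k..<k} \<subseteq> {- k..k}" "{- k<..k} \<subseteq> {- k..k}" by auto
        then show ?thesis unfolding A_vec by (simp only: vec.add WP_absorb)
      qed
      then show ?thesis using R0[of "PG *v v"] by (simp add: WP_WP)
    qed
    then have "R0 ** (PL ** (A ** PG)) = PG"
      by (simp add: matrix_eq mult_mult_vec)
    then show ?thesis by (metis mv_mult)
  qed
  ultimately have "mv PG Z \<simeq> 0" by simp
  then have "mv PG Z + mv (WP {- k}) Z \<simeq> 0 + 0" using assms(2) by (rule veq_add)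
  then show ?thesis using Z by simp
qed

lemma PL_A_ga:
  "mv PL (mv A (ga y (t s))) = - mv PL (ga y (mv D (t (s - 1)))
     + (\<Sum>i\<in>S0. ga (u i) (mv (\<phi> (u' i)) (ga y (t (s - 1 + \<delta> i)))))
     + (\<Sum>i\<in>S0. ga (lie_bracket y (u i)) (mv (\<phi> (u' i)) (t (s - 1 + \<delta> i)))))"
proof -
  have "mv A (t s) = G s - (mv D (t (s - 1)) + (\<Sum>i\<in>S0. ga (u i) (mv (\<phi> (u' i)) (t (s - 1 + \<delta> i)))))"
    by (simp add: G_def)
  then have "mv A (ga y (t s)) = ga y (G s) - (ga y (mv D (t (s - 1)))
     + (\<Sum>i\<in>S0. ga (u i) (mv (\<phi> (u' i)) (ga y (t (s - 1 + \<delta> i)))))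
     + (\<Sum>i\<in>S0. ga (lie_bracket y (u i)) (mv (\<phi> (u' i)) (t (s - 1 + \<delta> i)))))"
    by (simp add: mv_ga ga_diff_right ga_add_right ga_sum_right ga_ga[of y "u _"] sum.distrib add.assoc)
  then show ?thesis by (simp add: mv_diff_right mv_ga PL_G)
qed

lemma low_ga:
  assumes "y \<in> ad_eigenspace x j" "j \<ge> 1"
  shows "ga y (mv (WP {- k}) (t s)) - mv (mat (B f y)) (mv (WP {- k}) (t s)) \<simeq> 0"
  using VJ_cv[OF assms] by (simp add: t_low veq_0_iff)

text \<open>Invariance of the tensor of dual bases moves \<open>y\<close> from \<open>u i\<close> to
  \<open>u' l\<close>. As \<open>cf y i l\<close> vanishes unless \<delta> l = \<delta> i + j, the
  condition \<delta> i \<le> 0 becomes \<delta> l \<le> j and the exponents agree. The range grows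
  beyond \<open>S0\<close>, and the extra terms are the ones to be cancelled later.\<close>

lemma bracket_u_sum:
  assumes "bd y = y" "y \<in> ad_eigenspace x j"
  shows "(\<Sum>i\<in>S0. ga (lie_bracket y (u i)) (mv (\<phi> (u' i)) (t (s - 1 + \<delta> i))))
    = (\<Sum>l | l < d \<and> \<delta> l \<le> j. ga (u l) (mv (\<phi> (lie_bracket (u' l) y)) (t (s - j - 1 + \<delta> l))))"
proof -
  let ?g = "\<lambda>i l. mv (mat (cf y i l)) (ga (u l) (mv (\<phi> (u' i)) (t (s - j - 1 + \<delta> l))))"
  have "(\<Sum>i\<in>S0. ga (lie_bracket y (u i)) (mv (\<phi> (u' i)) (t (s - 1 + \<delta> i))))
      = (\<Sum>i\<in>S0. \<Sum>l<d. mv (mat (cf y i l)) (ga (u l) (mv (\<phi> (u' i)) (t (s - 1 + \<delta> i)))))"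
    by (intro sum.cong refl) (simp add: bracket_u[OF assms(1)] ga_sum_left ga_scale)
  also have "\<dots> = (\<Sum>i\<in>S0. \<Sum>l<d. ?g i l)"
  proof (intro sum.cong refl)
    fix i l assume "i \<in> S0" "l \<in> {..<d}"
    then show "mv (mat (cf y i l)) (ga (u l) (mv (\<phi> (u' i)) (t (s - 1 + \<delta> i)))) = ?g i l"
      using cf_eq_0[OF assms(2), of i l] by (cases "\<delta> l = \<delta> i + j") (simp_all add: algebra_simps)
  qed
  also have "\<dots> = (\<Sum>l<d. \<Sum>i\<in>S0. ?g i l)" by (rule sum.swap)
  also have "\<dots> = (\<Sum>l<d. if \<delta> l \<le> j then \<Sum>i<d. ?g i l else 0)"
  proof (intro sum.cong refl)
    fix l assume l: "l \<in> {..<d}"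
    have c0: "cf y i l = 0" if "i < d" "\<not> (\<delta> i \<le> 0 \<longleftrightarrow> \<delta> l \<le> j)" for i
      using cf_eq_0[OF assms(2) that(1), of l] l that(2) by auto
    show "(\<Sum>i\<in>S0. ?g i l) = (if \<delta> l \<le> j then \<Sum>i<d. ?g i l else 0)"
    proof (cases "\<delta> l \<le> j")
      case True
      have "(\<Sum>i\<in>S0. ?g i l) = (\<Sum>i<d. ?g i l)"
        using True by (intro sum.mono_neutral_left) (auto simp: c0)
      then show ?thesis using True by simp
    next
      case False
      then show ?thesis by (auto intro!: sum.neutral simp: c0)
    qed
  qed
  also have "\<dots> = (\<Sum>l | l < d \<and> \<delta> l \<le> j. \<Sum>i<d. ?g i l)"
    using sum.inter_filter[of "{..<d}" "\<lambda>l. \<Sum>i<d. ?g i l" "\<lambda>l. \<delta> l \<le> j"] by simp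
  also have "\<dots> = (\<Sum>l | l < d \<and> \<delta> l \<le> j. ga (u l) (mv (\<phi> (lie_bracket (u' l) y)) (t (s - j - 1 + \<delta> l))))"
  proof (intro sum.cong refl)
    fix l assume "l \<in> {l. l < d \<and> \<delta> l \<le> j}"
    then have "\<phi> (lie_bracket (u' l) y) = (\<Sum>i<d. mat (cf y i l) ** \<phi> (u' i))"
      by (simp add: bracket_u'[OF assms(1)] rep_sum rep_scale)
    then show "(\<Sum>i<d. ?g i l) = ga (u l) (mv (\<phi> (lie_bracket (u' l) y)) (t (s - j - 1 + \<delta> l)))"
      by (simp add: mv_sum_left ga_sum_right mv_mult mv_ga)
  qed
  finally show ?thesis .
qed

lemma D_vec: "D *v v = - (\<Sum>i | i < d \<and> \<delta> i \<ge> 1. \<phi> (u' i) *v (\<phi> (u i) *v v))"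
  by (simp add: D lax_D_def minus_mult_vec sum_mult_vec matrix_vector_mul_assoc)

text \<open>Here the sign of \<open>D\<close> enters.\<close>

lemma D_bracket:
  assumes "bd y = y" "y \<in> ad_eigenspace x j" "j \<ge> 1"
  shows "D *v (\<phi> y *v v) - \<phi> y *v (D *v v)
    + (\<Sum>l | l < d \<and> 0 < \<delta> l \<and> \<delta> l \<le> j. \<phi> (lie_bracket (u' l) y) *v (\<phi> (u l) *v v)) = 0"
proof -
  let ?N = "{i. i < d \<and> \<delta> i \<ge> 1}" and ?M = "{l. l < d \<and> 0 < \<delta> l \<and> \<delta> l \<le> j}"
  have ge1: "\<delta> i \<ge> 1 \<longleftrightarrow> 0 < \<delta> i" if i: "i < d" for i
  proof -
    obtain r where "\<delta> i = of_int r" using delta_integral[OF i] by (rule Ints_cases)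
    then show ?thesis by auto
  qed
  let ?g = "\<lambda>i l. cf y i l *s (\<phi> (u' i) *v (\<phi> (u l) *v v))"
  have 1: "(\<Sum>i\<in>?N. \<phi> (u' i) *v (\<phi> (lie_bracket y (u i)) *v v))
      = (\<Sum>i\<in>?N. \<Sum>l<d. ?g i l)"
    by (intro sum.cong refl)
      (simp add: bracket_u[OF assms(1)] rep_sum sum_mult_vec rep_scale_vec vec.sum vec.scale)
  have 2: "(\<Sum>l | l < d \<and> \<delta> l > j. \<phi> (lie_bracket (u' l) y) *v (\<phi> (u l) *v v))
      = (\<Sum>l | l < d \<and> \<delta> l > j. \<Sum>i<d. ?g i l)"
    by (intro sum.cong refl)
      (simp add: bracket_u'[OF assms(1)] rep_sum sum_mult_vec rep_scale_vec)
  \<comment> \<open>A nonzero coefficient forces \<delta> l = \<delta> i + j, and integrality turns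
    \<delta> i > 0 into \<delta> i \<ge> 1. The two double sums then have the same support, and the
    degrees above \<open>j\<close> cancel.\<close>
  have g0: "\<delta> i \<ge> 1 \<longleftrightarrow> \<delta> l > j" if "i < d" "l < d" "cf y i l \<noteq> 0" for i l
  proof -
    have "\<delta> l = \<delta> i + j" using cf_eq_0[OF assms(2) that(1,2)] that(3) by blast
    then show ?thesis using ge1[OF that(1)] by auto
  qed
  have "(\<Sum>i\<in>?N. \<Sum>l<d. ?g i l) = (\<Sum>i\<in>?N. \<Sum>l | l < d \<and> \<delta> l > j. ?g i l)"
  proof (rule sum.cong[OF refl])
    fix i assume "i \<in> ?N"
    then show "(\<Sum>l<d. ?g i l) = (\<Sum>l | l < d \<and> \<delta> l > j. ?g i l)"
      by (intro sum.mono_neutral_right) (auto simp: g0)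
  qed
  also have "\<dots> = (\<Sum>l | l < d \<and> \<delta> l > j. \<Sum>i\<in>?N. ?g i l)"
    by (rule sum.swap)
  also have "\<dots> = (\<Sum>l | l < d \<and> \<delta> l > j. \<Sum>i<d. ?g i l)"
  proof (rule sum.cong[OF refl])
    fix l assume "l \<in> {l. l < d \<and> \<delta> l > j}"
    then show "(\<Sum>i\<in>?N. ?g i l) = (\<Sum>i<d. ?g i l)"
      by (intro sum.mono_neutral_left) (auto simp: g0)
  qed
  finally have 3: "(\<Sum>i\<in>?N. \<phi> (u' i) *v (\<phi> (lie_bracket y (u i)) *v v))
      = (\<Sum>l | l < d \<and> \<delta> l > j. \<phi> (lie_bracket (u' l) y) *v (\<phi> (u l) *v v))"
    unfolding 1 2 .
  have "?N = {l. l < d \<and> \<delta> l > j} \<union> ?M"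
    using ge1 assms(3) by auto
  then have 4: "(\<Sum>l\<in>?N. h l) = (\<Sum>l | l < d \<and> \<delta> l > j. h l) + (\<Sum>l\<in>?M. h l)" for h :: "nat \<Rightarrow> complex^'n"
    by (simp add: sum.union_disjoint[symmetric] disjoint_iff)
  have "D *v (\<phi> y *v v) - \<phi> y *v (D *v v)
      = (\<Sum>i\<in>?N. \<phi> y *v (\<phi> (u' i) *v (\<phi> (u i) *v v)) - \<phi> (u' i) *v (\<phi> (u i) *v (\<phi> y *v v)))"
    by (simp add: D_vec vec.sum vec.neg sum_subtractf)
  also have "\<dots> = (\<Sum>i\<in>?N. \<phi> (u' i) *v (\<phi> (lie_bracket y (u i)) *v v))
      - (\<Sum>i\<in>?N. \<phi> (lie_bracket (u' i) y) *v (\<phi> (u i) *v v))"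
    by (simp add: sum_subtractf[symmetric] rep_bracket_vec vec.diff)
  also have "\<dots> = - (\<Sum>l\<in>?M. \<phi> (lie_bracket (u' l) y) *v (\<phi> (u l) *v v))"
    unfolding 3 4[of "\<lambda>i. \<phi> (lie_bracket (u' i) y) *v (\<phi> (u i) *v v)"] by simp
  finally show ?thesis by simp
qed

text \<open>The projection in \<open>A\<close> commutes with \<phi> y, and the truncated
  \<open>f\<close> is expanded in the dual basis. Only \<delta> l = 1 contributes, since
  \<open>f\<close> has degree -1; the longer range of summation is chosen to match
  \<open>D_bracket\<close>.\<close>

lemma A_bracket:
  assumes "bd y = y" "y \<in> ad_eigenspace x j" "j \<ge> 1"
  shows "A *v (\<phi> y *v v) - \<phi> y *v (A *v v)
    = (\<Sum>l | l < d \<and> 0 < \<delta> l \<and> \<delta> l \<le> j. B f (u l) *s (\<phi> (lie_bracket (u' l) y) *v v))"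
proof -
  have "bd f = (\<Sum>l<d. B f (u l) *\<^sub>L u' l)"
    using expand_u'[OF band_band, of f] form_band[OF u_band, of _ f] by simp
  also have "\<dots> = (\<Sum>l | l < d \<and> 0 < \<delta> l \<and> \<delta> l \<le> j. B f (u l) *\<^sub>L u' l)"
    using form_ad_eigen[OF f_ad_eigen u_ad_eigen] assms(3)
    by (intro sum.mono_neutral_right) force+
  finally have "\<phi> (bd f) *v v = (\<Sum>l | l < d \<and> 0 < \<delta> l \<and> \<delta> l \<le> j. B f (u l) *s (\<phi> (u' l) *v v))" for v
    by (simp add: rep_sum sum_mult_vec rep_scale_vec)
  then show ?thesis
    by (simp add: A_def matrix_vector_mult_add_rdistrib vec.add rep_band_fixed[OF assms(1)]
        vec.sum vec.scale rep_bracket_vec sum_subtractf[symmetric] vec.scale_right_diff_distrib)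
qed

text \<open>\<open>y\<close> raises weights, so the row of weight k, about which the recursion says
  nothing, cannot contribute to rows below k.\<close>

lemma PL_raise:
  assumes "bd y = y" "y \<in> ad_eigenspace x j" "j \<ge> 1"
  shows "mv PL (mv (\<phi> y) (G s)) = 0"
proof -
  have "PL *v (\<phi> y *v v) = (PL ** \<phi> y) *v (PL *v v)" for v
  proof -
    have s: "{i. i + j \<in> {- k..<k}} \<inter> {- k..k} = {i. i + j \<in> {- k..<k}} \<inter> {- k..k} \<inter> {- k..<k}"
      using assms(3) by auto
    have "PL *v (\<phi> y *v v) = PL *v (\<phi> y *v (P *v v))"
      by (simp add: rep_band_fixed[OF assms(1)])
    also have "\<dots> = \<phi> y *v (WP ({i. i + j \<in> {- k..<k}} \<inter> {- k..k}) *v v)"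
      by (simp add: WP_ad_eigen[OF assms(2)] WP_WP)
    also have "\<dots> = PL *v (\<phi> y *v (P *v (PL *v v)))"
      by (subst s) (simp add: WP_ad_eigen[OF assms(2)] WP_WP Int_assoc)
    finally show ?thesis
      by (simp add: rep_band_fixed[OF assms(1)] mult_mult_vec)
  qed
  then have "mv PL (mv (\<phi> y) (G s)) = mv (PL ** \<phi> y) (mv PL (G s))"
    by (rule mv_eqI3)
  then show ?thesis by (simp add: PL_G)
qed

end

context lax_core begin

lemma A_bracket_mv:
  assumes "bd y = y" "y \<in> ad_eigenspace x j" "j \<ge> 1"
  shows "mv A (mv (\<phi> y) T) - mv (\<phi> y) (mv A T)
    = (\<Sum>l | l < d \<and> 0 < \<delta> l \<and> \<delta> l \<le> j. mv (mat (B f (u l))) (mv (\<phi> (lie_bracket (u' l) y)) T))"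
proof -
  have "A ** \<phi> y - \<phi> y ** A
    = (\<Sum>l | l < d \<and> 0 < \<delta> l \<and> \<delta> l \<le> j. mat (B f (u l)) ** \<phi> (lie_bracket (u' l) y))"
    using A_bracket[OF assms]
    by (simp add: matrix_eq matrix_vector_mult_diff_rdistrib sum_mult_vec mat_mult_vec
        mult_mult_vec)
  from arg_cong[OF this, of "\<lambda>M. mv M T"] show ?thesis
    by (simp add: mv_diff_left mv_mult mv_sum_left)
qed

lemma D_bracket_mv:
  assumes "bd y = y" "y \<in> ad_eigenspace x j" "j \<ge> 1"
  shows "mv D (mv (\<phi> y) T) - mv (\<phi> y) (mv D T)
    = - (\<Sum>l | l < d \<and> 0 < \<delta> l \<and> \<delta> l \<le> j. mv (\<phi> (lie_bracket (u' l) y)) (mv (\<phi> (u l)) T))"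
proof -
  have "D ** \<phi> y - \<phi> y ** D
    = - (\<Sum>l | l < d \<and> 0 < \<delta> l \<and> \<delta> l \<le> j. \<phi> (lie_bracket (u' l) y) ** \<phi> (u l))"
    using D_bracket[OF assms]
    by (simp add: matrix_eq matrix_vector_mult_diff_rdistrib sum_mult_vec minus_mult_vec
        mult_mult_vec eq_neg_iff_add_eq_0)
  from arg_cong[OF this, of "\<lambda>M. mv M T"] show ?thesis
    by (simp add: mv_diff_left mv_mult mv_sum_left mv_minus_left)
qed

lemma real_step_induct:
  fixes s :: real
  assumes "\<And>s. s < 0 \<Longrightarrow> Q s" "\<And>s. (\<And>s'. s' \<le> s - 1 \<Longrightarrow> Q s') \<Longrightarrow> Q s"
  shows "Q s"
proof -
  have "\<forall>s. s < real n \<longrightarrow> Q s" for n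
    by (induction n) (auto intro: assms)
  moreover have "s < real (nat \<lceil>s\<rceil> + 1)" by linarith
  ultimately show ?thesis by blast
qed

text \<open>The induction step common to elements in the band and without band component.
  \<open>V\<close> is the conjectured correction, and \<open>main\<close> says that it satisfies the
  recursion of \<open>t\<close> with the brackets of \<open>y\<close> and \<open>u i\<close> as
  source term.\<close>

lemma ga_step:
  assumes y: "y \<in> ad_eigenspace x j" "j \<ge> 1"
    and V: "mv P (V s) = V s" "mv (WP {- k}) (V s) = 0"
    and IH: "\<And>s'. s' \<le> s - 1 \<Longrightarrow> ga y (t s') \<simeq> mv (mat (B f y)) (t s') - V s'"
    and main: "mv PL (mv A (V s) + mv D (V (s - 1))
        + (\<Sum>i\<in>S0. ga (u i) (mv (\<phi> (u' i)) (V (s - 1 + \<delta> i))))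
        - (\<Sum>i\<in>S0. ga (lie_bracket y (u i)) (mv (\<phi> (u' i)) (t (s - 1 + \<delta> i))))) \<simeq> 0"
  shows "ga y (t s) \<simeq> mv (mat (B f y)) (t s) - V s"
proof -
  define c where "c = B f y"
  define Z where "Z = ga y (t s) - mv (mat c) (t s) + V s"
  define X where "X i = t (s - 1 + \<delta> i)" for i
  define N where "N = (\<Sum>i\<in>S0. ga (lie_bracket y (u i)) (mv (\<phi> (u' i)) (X i)))"
  have "Z \<simeq> 0"
  proof (rule veq_0I)
    show "mv P Z = Z"
      by (simp add: Z_def mv_add_right mv_diff_right mv_ga mv_scalar_commute t_P V)
    have "mv (WP {- k}) Z = ga y (mv (WP {- k}) (t s)) - mv (mat c) (mv (WP {- k}) (t s))"
      by (simp add: Z_def mv_add_right mv_diff_right mv_ga mv_scalar_commute V)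
    then show "mv (WP {- k}) Z \<simeq> 0"
      using low_ga[OF y] by (simp add: c_def)
    have "mv A (t s) = G s - (mv D (t (s - 1)) + (\<Sum>i\<in>S0. ga (u i) (mv (\<phi> (u' i)) (X i))))"
      by (simp add: G_def X_def)
    then have PA: "mv PL (mv A (t s)) = - mv PL (mv D (t (s - 1)) + (\<Sum>i\<in>S0. ga (u i) (mv (\<phi> (u' i)) (X i))))"
      by (simp add: mv_diff_right PL_G)
    \<comment> \<open>What remains of \<open>A\<close> applied to \<open>Z\<close> in rows below k
      once the recursion has replaced \<open>t s\<close> by coefficients of smaller
      exponent.\<close>
    define R where "R = mv (mat c) (mv D (t (s - 1))) - mv D (ga y (t (s - 1)))
      + ((\<Sum>i\<in>S0. ga (u i) (mv (\<phi> (u' i)) (mv (mat c) (X i))))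
          - (\<Sum>i\<in>S0. ga (u i) (mv (\<phi> (u' i)) (ga y (X i))))) - N + mv A (V s)"
    have "mv PL (mv A Z) = mv PL (mv A (ga y (t s))) - mv (mat c) (mv PL (mv A (t s))) + mv PL (mv A (V s))"
      by (simp add: Z_def mv_add_right mv_diff_right mv_scalar_commute)
    also have "\<dots> = mv PL R"
      unfolding PL_A_ga PA X_def[symmetric] N_def[symmetric]
      by (simp add: R_def mv_add_right mv_diff_right mv_scalar_commute mv_ga mv_sum_right mv_minus_right)
    finally have PLR: "mv PL (mv A Z) = mv PL R" .
    have "R \<simeq> mv (mat c) (mv D (t (s - 1))) - mv D (mv (mat c) (t (s - 1)) - V (s - 1))
      + ((\<Sum>i\<in>S0. ga (u i) (mv (\<phi> (u' i)) (mv (mat c) (X i))))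
          - (\<Sum>i\<in>S0. ga (u i) (mv (\<phi> (u' i)) (mv (mat c) (X i) - V (s - 1 + \<delta> i))))) - N + mv A (V s)"
      unfolding R_def
    proof (intro veq_add veq_diff veq_refl veq_mv veq_sum veq_ga)
      show "ga y (t (s - 1)) \<simeq> mv (mat c) (t (s - 1)) - V (s - 1)"
        using IH[of "s - 1"] by (simp add: c_def)
      show "ga y (X i) \<simeq> mv (mat c) (X i) - V (s - 1 + \<delta> i)" if "i \<in> S0" for i
        using IH[of "s - 1 + \<delta> i"] that by (simp add: X_def c_def)
    qed
    also have "\<dots> = mv A (V s) + mv D (V (s - 1)) + (\<Sum>i\<in>S0. ga (u i) (mv (\<phi> (u' i)) (V (s - 1 + \<delta> i)))) - N"
      by (simp add: mv_diff_right mv_scalar_commute ga_diff_right sum_subtractf)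
    finally have "mv PL R \<simeq> mv PL \<dots>" by (rule veq_mv)
    also have "\<dots> \<simeq> 0" using main by (simp add: N_def X_def)
    finally show "mv PL (mv A Z) \<simeq> 0" by (simp add: PLR)
  qed
  then show ?thesis by (simp add: Z_def c_def veq_def algebra_simps)
qed

text \<open>Subtract \<phi> y applied to the recursion at exponent s - j. The excess consists of the
  commutators of \<phi> y with \<open>A\<close> and \<open>D\<close> and of the terms 0 < \<delta> l
  \<le> j of the bracket sum; these three cancel modulo \<open>J\<close>.\<close>

lemma ga_band:
  assumes "bd y = y" "y \<in> ad_eigenspace x j" "j \<ge> 1"
  shows "ga y (t s) \<simeq> mv (mat (B f y)) (t s) - mv (\<phi> y) (t (s - j))"
  using assms
proof (induction s arbitrary: y j rule: real_step_induct)
  case (1 s)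
  then show ?case by (simp add: t_neg)
next
  case (2 s y j)
  note IH = 2(1) and y = 2(2-4)
  define T1 where "T1 = t (s - j)"
  define T2 where "T2 = t (s - j - 1)"
  define Y where "Y i = t (s - j - 1 + \<delta> i)" for i
  define K where "K l = \<phi> (lie_bracket (u' l) y)" for l
  define M where "M = {l. l < d \<and> 0 < \<delta> l \<and> \<delta> l \<le> j}"
  show ?case
  proof (rule ga_step[OF y(2,3), where V = "\<lambda>s. mv (\<phi> y) (t (s - j))"])
    show "mv P (mv (\<phi> y) (t (s - j))) = mv (\<phi> y) (t (s - j))"
      by (rule mv_eqI2) (rule rep_band_fixed[OF y(1)])
    have "{i. i + j \<in> {- k}} \<inter> {- k..k} = {}" using y(3) by auto
    then have "WP {- k} *v (\<phi> y *v (P *v v)) = 0" for v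
      by (simp add: WP_ad_eigen[OF y(2)] WP_WP)
    then have "WP {- k} ** (\<phi> y ** P) = 0"
      by (simp add: matrix_eq mult_mult_vec)
    then have "mv (WP {- k}) (mv (\<phi> y) (mv P (t (s - j)))) = 0"
      by (metis mv_mult mv_0_left)
    then show "mv (WP {- k}) (mv (\<phi> y) (t (s - j))) = 0"
      by (simp add: t_P)
    show "ga y (t s') \<simeq> mv (mat (B f y)) (t s') - mv (\<phi> y) (t (s' - j))" if "s' \<le> s - 1" for s'
      by (rule IH[OF that y])
    define N where "N = (\<Sum>i\<in>S0. ga (lie_bracket y (u i)) (mv (\<phi> (u' i)) (t (s - 1 + \<delta> i))))"
    have swap: "t (s - 1 - j) = T2" "\<And>i. t (s - 1 + \<delta> i - j) = Y i"
      unfolding T2_def Y_def by (rule arg_cong[of _ _ t], simp)+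
    have "(\<Sum>i\<in>S0. ga (u i) (mv (\<phi> (u' i)) (mv (\<phi> y) (Y i))))
        - mv (\<phi> y) (\<Sum>i\<in>S0. ga (u i) (mv (\<phi> (u' i)) (Y i))) = (\<Sum>i\<in>S0. ga (u i) (mv (K i) (Y i)))"
      by (simp add: K_def rep_bracket mv_diff_left mv_mult mv_sum_right sum_subtractf[symmetric] ga_diff_right mv_ga)
    moreover have "{l. l < d \<and> \<delta> l \<le> j} = S0 \<union> M" using y(3) by (auto simp: M_def)
    then have "N = (\<Sum>i\<in>S0. ga (u i) (mv (K i) (Y i))) + (\<Sum>l\<in>M. mv (K l) (ga (u l) (Y l)))"
      unfolding N_def bracket_u_sum[OF y(1,2)] K_def[symmetric] Y_def[symmetric] mv_ga
      by (simp add: sum.union_disjoint M_def disjoint_iff)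
    moreover have "G (s - j) = mv A T1 + mv D T2 + (\<Sum>i\<in>S0. ga (u i) (mv (\<phi> (u' i)) (Y i)))"
      by (simp add: G_def T1_def T2_def Y_def)
    ultimately have "mv A (mv (\<phi> y) T1) + mv D (mv (\<phi> y) T2)
        + (\<Sum>i\<in>S0. ga (u i) (mv (\<phi> (u' i)) (mv (\<phi> y) (Y i)))) - N - mv (\<phi> y) (G (s - j))
      = (mv A (mv (\<phi> y) T1) - mv (\<phi> y) (mv A T1)) + (mv D (mv (\<phi> y) T2) - mv (\<phi> y) (mv D T2))
        - (\<Sum>l\<in>M. mv (K l) (ga (u l) (Y l)))"
      by (simp add: mv_add_right algebra_simps)
    also have "\<dots> = (\<Sum>l\<in>M. mv (mat (B f (u l))) (mv (K l) T1)) - (\<Sum>l\<in>M. mv (K l) (mv (\<phi> (u l)) T2))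
        - (\<Sum>l\<in>M. mv (K l) (ga (u l) (Y l)))"
      unfolding A_bracket_mv[OF y] D_bracket_mv[OF y] K_def M_def by simp
    \<comment> \<open>Here the induction hypothesis is applied to \<open>u l\<close> instead of
      \<open>y\<close>, at exponent s - j - 1 + \<delta> l \<le> s - 1. Its degree is at least 1 by
      integrality.\<close>
    also have "\<dots> \<simeq> (\<Sum>l\<in>M. mv (mat (B f (u l))) (mv (K l) T1)) - (\<Sum>l\<in>M. mv (K l) (mv (\<phi> (u l)) T2))
        - (\<Sum>l\<in>M. mv (K l) (mv (mat (B f (u l))) (Y l) - mv (\<phi> (u l)) T2))"
    proof (intro veq_diff veq_refl veq_sum veq_mv)
      fix l assume l: "l \<in> M"
      then obtain r where "\<delta> l = of_int r" using delta_integral[of l] by (auto simp: M_def elim: Ints_cases)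
      then have d1: "\<delta> l \<ge> 1" using l by (auto simp: M_def)
      have "s - j - 1 + \<delta> l \<le> s - 1" using l by (simp add: M_def)
      from IH[OF this u_band u_ad_eigen d1] l
      show "ga (u l) (Y l) \<simeq> mv (mat (B f (u l))) (Y l) - mv (\<phi> (u l)) T2"
        by (simp add: M_def Y_def T2_def)
    qed
    also have "\<dots> = 0"
    proof -
      \<comment> \<open>The scalar is zero unless \<delta> l = 1, and then \<open>Y l\<close> and
        \<open>T1\<close> are the same coefficient.\<close>
      have "mv (mat (B f (u l))) (mv (K l) T1) = mv (K l) (mv (mat (B f (u l))) (Y l))" if "l \<in> M" for l
      proof (cases "\<delta> l = 1")
        case True
        then show ?thesis by (simp add: Y_def T1_def mv_scalar_commute)
      next
        case False
        then have "B f (u l) = 0" using that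
          by (intro form_ad_eigen[OF f_ad_eigen u_ad_eigen]) (auto simp: M_def)
        then show ?thesis by simp
      qed
      then show ?thesis by (simp add: mv_diff_right sum_subtractf)
    qed
    finally have "mv PL (mv A (mv (\<phi> y) T1) + mv D (mv (\<phi> y) T2)
        + (\<Sum>i\<in>S0. ga (u i) (mv (\<phi> (u' i)) (mv (\<phi> y) (Y i)))) - N - mv (\<phi> y) (G (s - j))) \<simeq> mv PL 0"
      by (rule veq_mv)
    then show "mv PL (mv A (mv (\<phi> y) (t (s - j))) + mv D (mv (\<phi> y) (t (s - 1 - j)))
        + (\<Sum>i\<in>S0. ga (u i) (mv (\<phi> (u' i)) (mv (\<phi> y) (t (s - 1 + \<delta> i - j)))))
        - (\<Sum>i\<in>S0. ga (lie_bracket y (u i)) (mv (\<phi> (u' i)) (t (s - 1 + \<delta> i))))) \<simeq> 0"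
      unfolding swap by (simp add: N_def T1_def mv_diff_right PL_raise[OF y])
  qed
qed

section \<open>Elements without band component\<close>

lemma off_band:
  assumes "bd y = 0" shows "P *v (\<phi> y *v (P *v v)) = 0"
  using assms rep_band_vec[of y v] by simp

lemma bracket_off_band:
  assumes "bd y = 0" "bd z = z" shows "bd (lie_bracket y z) = 0"
proof (rule rep_eqI)
  show "\<phi> (bd (lie_bracket y z)) *v v = \<phi> 0 *v v" for v
    using off_band[OF assms(1), of "\<phi> z *v v"]
    by (simp add: rep_band_vec rep_bracket_vec vec.diff rep_band_fixed[OF assms(2)])
      (metis off_band[OF assms(1)] rep_band_fixed[OF assms(2)] matrix_vector_mult_0_right)
qed

text \<open>With i \<le> 0 and i + j \<le> 0 < j, the weight at which \<open>y\<close> starts and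
  the one at which it arrives both lie in the band whenever \<open>z\<close> acts nontrivially.
  There \<open>y\<close> has no component, so both products vanish.\<close>

lemma bracket_off_band_0:
  assumes y: "bd y = 0" "y \<in> ad_eigenspace x j" "j \<ge> 1"
    and z: "bd z = z" "z \<in> ad_eigenspace x i" "i \<le> 0" "i + j \<le> 0"
  shows "lie_bracket y z = 0"
proof -
  have "\<phi> (lie_bracket y z) = 0"
  proof (rule matrix_eqI_wsp)
    fix a v assume v: "v \<in> wsp a"
    have inP: "P *v v' = (if \<bar>a'\<bar> \<le> k then v' else 0)" if "v' \<in> wsp a'" for a' v'
      using WP_wsp[OF that, of "{- k..k}"] by (auto simp: abs_le_iff)
    have 1: "\<phi> y *v (\<phi> z *v v) = 0"
    proof (cases "\<bar>a\<bar> \<le> k \<and> \<bar>a + i\<bar> \<le> k")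
      case True
      have "\<phi> y *v (\<phi> z *v v) \<in> wsp (a + i + j)"
        by (intro ad_eigen_wsp[OF y(2)] ad_eigen_wsp[OF z(2)] v)
      then have "P *v (\<phi> y *v (\<phi> z *v v)) = \<phi> y *v (\<phi> z *v v)"
        using inP True y(3) z(4) by (auto simp: abs_le_iff)
      moreover have "P *v (\<phi> y *v (\<phi> z *v v)) = 0"
        using off_band[OF y(1), of "\<phi> z *v v"] by (simp add: rep_band_fixed[OF z(1)])
      ultimately show ?thesis by simp
    next
      case False
      then have "\<phi> z *v v = 0"
        using inP[OF v] inP[OF ad_eigen_wsp[OF z(2) v]] rep_band_fixed[OF z(1), of v] by (auto split: if_splits)
      then show ?thesis by simp
    qed
    have yv: "\<phi> y *v v \<in> wsp (a + j)" by (rule ad_eigen_wsp[OF y(2) v])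
    have 2: "\<phi> z *v (\<phi> y *v v) = 0"
    proof (cases "\<bar>a + j\<bar> \<le> k \<and> \<bar>a + j + i\<bar> \<le> k")
      case True
      then have "P *v v = v" using inP[OF v] y(3) z(4) by (auto simp: abs_le_iff)
      then have "P *v (\<phi> y *v v) = 0" using off_band[OF y(1), of v] by simp
      then show ?thesis using rep_band_fixed(2)[OF z(1), of "\<phi> y *v v"] by simp
    next
      case False
      then show ?thesis
        using inP[OF yv] inP[OF ad_eigen_wsp[OF z(2) yv]] rep_band_fixed[OF z(1), of "\<phi> y *v v"]
        by (auto split: if_splits)
    qed
    show "\<phi> (lie_bracket y z) *v v = 0 *v v"
      by (simp add: rep_bracket_vec 1 2)
  qed
  then show ?thesis using rep_inj[of _ 0] by simp
qed

text \<open>The only contribution of the missing part of \<open>f\<close> goes through \<open>f w = 0\<close>.\<close>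

lemma PL_band_bracket_f:
  assumes y: "bd y = 0" "y \<in> ad_eigenspace x j" "j \<ge> 1"
  shows "mv PL (mv (\<phi> (bd (lie_bracket f y))) (t s)) = 0"
proof -
  have integral: "i + k \<in> \<int>" if "v \<in> wsp i" "v \<noteq> 0" for i v
    using weights_integral[OF that w(1,3)] by simp
  \<comment> \<open>Vectors that \<open>y\<close> takes out of the band leave it at the top, by
    integrality at weight at least k + 1. One application of \<open>f\<close> leaves them at weight
    at least k, where \<open>PL\<close> vanishes.\<close>
  have 1: "PL *v (\<phi> f *v (\<phi> y *v (P *v v))) = 0" for v
  proof (induction v rule: wsp_induct)
    case (wsp i v)
    show ?case
    proof (cases "\<bar>i\<bar> \<le> k \<and> \<phi> y *v v \<noteq> 0")
      case False
      then show ?thesis using WP_wsp[OF wsp, of "{- k..k}"] by (auto simp: abs_le_iff)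
    next
      case True
      then have Pv: "P *v v = v" using WP_wsp[OF wsp, of "{- k..k}"] by (auto simp: abs_le_iff)
      have yv: "\<phi> y *v v \<in> wsp (i + j)" by (rule ad_eigen_wsp[OF y(2) wsp])
      have "P *v (\<phi> y *v v) = 0" using off_band[OF y(1), of v] Pv by simp
      then have "i + j \<notin> {- k..k}" using WP_wsp[OF yv, of "{- k..k}"] True by (auto split: if_splits)
      then have gt: "i + j > k" using True y(3) by (auto simp: abs_le_iff)
      have "(i + j + k) - 2 * k \<in> \<int>" using integral[OF yv] True k(2) by (intro Ints_diff) auto
      then have "i + j - k \<in> \<int>" by (simp add: algebra_simps)
      then obtain r where "i + j - k = of_int r" by (rule Ints_cases)
      then have "i + j - k \<ge> 1" using gt by auto
      then show ?thesis
        using WP_wsp[OF F_wsp[OF yv], of "{- k..<k}"] by (simp add: Pv)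
    qed
  qed (simp add: vec.add)
  \<comment> \<open>In the other order \<open>f\<close> stays inside the band except from the bottom
    weight -k, and inside the band \<open>y\<close> contributes nothing.\<close>
  have 2: "P *v (\<phi> y *v (\<phi> f *v (P *v v))) = P *v (\<phi> y *v (\<phi> f *v (WP {- k} *v v)))" for v
  proof (induction v rule: wsp_induct)
    case (wsp i v)
    show ?case
    proof (cases "\<bar>i\<bar> \<le> k \<and> i \<noteq> - k \<and> v \<noteq> 0")
      case False
      then show ?thesis using WP_wsp[OF wsp, of "{- k..k}"] WP_wsp[OF wsp, of "{- k}"] k(1)
        by (auto simp: abs_le_iff)
    next
      case True
      then have Pv: "P *v v = v" using WP_wsp[OF wsp, of "{- k..k}"] by (auto simp: abs_le_iff)
      obtain r where "i + k = of_int r" using integral[OF wsp] True by (auto elim: Ints_cases)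
      moreover have "i + k > 0" using True by (auto simp: abs_le_iff)
      ultimately have "i + k \<ge> 1" by auto
      then have "P *v (\<phi> f *v v) = \<phi> f *v v"
        using WP_wsp[OF F_wsp[OF wsp], of "{- k..k}"] True by (auto simp: abs_le_iff)
      then show ?thesis
        using off_band[OF y(1), of "\<phi> f *v v"] WP_wsp[OF wsp, of "{- k}"] True by (simp add: Pv)
    qed
  qed (simp add: vec.add)
  have "PL ** \<phi> (bd (lie_bracket f y)) = - (PL ** \<phi> y ** \<phi> f) ** WP {- k}"
  proof -
    have "{- k..<k} \<subseteq> {- k..k}" by auto
    note PLP = WP_absorb(1)[OF this]
    have "PL *v (P *v (\<phi> y *v (\<phi> f *v (P *v v)))) = PL *v (P *v (\<phi> y *v (\<phi> f *v (WP {- k} *v v))))" for v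
      by (simp only: 2)
    then show ?thesis
      by (simp add: matrix_eq mult_mult_vec minus_mult_vec rep_band_vec
          rep_bracket_vec vec.diff 1 PLP)
  qed
  from arg_cong[OF this, of "\<lambda>M. mv M (t s)"]
  have "mv PL (mv (\<phi> (bd (lie_bracket f y))) (t s)) = - mv (PL ** \<phi> y) (mv (\<phi> f) (mv (WP {- k}) (t s)))"
    by (simp add: mv_mult mv_minus_left)
  also have "\<dots> = 0" by (simp add: t_low mv_cv w(2))
  finally show ?thesis .
qed

text \<open>The correction is zero. The brackets of \<open>y\<close> with \<open>u i\<close> again
  have no band component: in degree \<le> 0 they vanish, in degree \<ge> 1 the induction hypothesis
  replaces them by scalars. By invariance the scalars are the dual basis coefficients of the
  truncated bracket of \<open>f\<close> and \<open>y\<close>, which \<open>PL_band_bracket_f\<close>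
  kills.\<close>

lemma ga_off_band:
  assumes "bd y = 0" "y \<in> ad_eigenspace x j" "j \<ge> 1"
  shows "ga y (t s) \<simeq> mv (mat (B f y)) (t s)"
  using assms
proof (induction s arbitrary: y j rule: real_step_induct)
  case (1 s)
  then show ?case by (simp add: t_neg)
next
  case (2 s y j)
  note IH = 2(1) and y = 2(2-4)
  have "ga y (t s) \<simeq> mv (mat (B f y)) (t s) - 0"
  proof (rule ga_step[OF y(2,3), where V = "\<lambda>_. 0"])
    show "ga y (t s') \<simeq> mv (mat (B f y)) (t s') - 0" if "s' \<le> s - 1" for s'
      using IH[OF that y] by simp
    define N where "N = (\<Sum>i\<in>S0. ga (lie_bracket y (u i)) (mv (\<phi> (u' i)) (t (s - 1 + \<delta> i))))"
    have N: "N \<simeq> mv (\<phi> (bd (lie_bracket f y))) (t (s - j))"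
    proof -
      have "N = (\<Sum>i\<in>S0. mv (\<phi> (u' i)) (ga (lie_bracket y (u i)) (t (s - 1 + \<delta> i))))"
        by (simp add: N_def mv_ga)
      also have "\<dots> \<simeq> (\<Sum>i\<in>S0. mv (\<phi> (u' i)) (mv (mat (B f (lie_bracket y (u i)))) (t (s - 1 + \<delta> i))))"
      proof (intro veq_sum veq_mv)
        fix i assume i: "i \<in> S0"
        then have i': "i < d" "\<delta> i \<le> 0" by auto
        show "ga (lie_bracket y (u i)) (t (s - 1 + \<delta> i)) \<simeq> mv (mat (B f (lie_bracket y (u i)))) (t (s - 1 + \<delta> i))"
        proof (cases "\<delta> i + j \<le> 0 \<or> lie_bracket y (u i) = 0")
          case True
          then have "lie_bracket y (u i) = 0"
            using bracket_off_band_0[OF y u_band[OF i'(1)] u_ad_eigen[OF i'(1)] i'(2)] by blast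
          then show ?thesis by simp
        next
          case False
          have e: "lie_bracket y (u i) \<in> ad_eigenspace x (j + \<delta> i)"
            by (rule ad_eigen_bracket[OF y(2) u_ad_eigen[OF i'(1)]])
          obtain r where "j + \<delta> i = of_int r" using ad_eigen_integral[OF e] False by (auto elim: Ints_cases)
          then have "j + \<delta> i \<ge> 1" using False by (auto simp: add.commute)
          moreover have "s - 1 + \<delta> i \<le> s - 1" using i'(2) by simp
          ultimately show ?thesis
            using IH[OF _ bracket_off_band[OF y(1) u_band[OF i'(1)]] e] by blast
        qed
      qed
      also have "(\<Sum>i\<in>S0. mv (\<phi> (u' i)) (mv (mat (B f (lie_bracket y (u i)))) (t (s - 1 + \<delta> i))))
          = (\<Sum>i\<in>S0. mv (mat (B (bd (lie_bracket f y)) (u i))) (mv (\<phi> (u' i)) (t (s - j))))"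
      proof (intro sum.cong refl)
        fix i assume i: "i \<in> S0"
        then have i': "i < d" by auto
        have b: "B f (lie_bracket y (u i)) = B (bd (lie_bracket f y)) (u i)"
          using form_band[OF u_band[OF i']] by (simp add: form_invariant)
        show "mv (\<phi> (u' i)) (mv (mat (B f (lie_bracket y (u i)))) (t (s - 1 + \<delta> i)))
            = mv (mat (B (bd (lie_bracket f y)) (u i))) (mv (\<phi> (u' i)) (t (s - j)))"
        proof (cases "\<delta> i = 1 - j")
          case True
          then show ?thesis unfolding b by (simp add: mv_scalar_commute)
        next
          case False
          then have "B (bd (lie_bracket f y)) (u i) = 0"
            by (intro form_ad_eigen[OF band_ad_eigen[OF ad_eigen_bracket[OF f_ad_eigen y(2)]] u_ad_eigen[OF i']]) auto
          then show ?thesis unfolding b by simp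
        qed
      qed
      also have "\<dots> = (\<Sum>i<d. mv (mat (B (bd (lie_bracket f y)) (u i))) (mv (\<phi> (u' i)) (t (s - j))))"
      proof (rule sum.mono_neutral_left)
        show "\<forall>i\<in>{..<d} - S0. mv (mat (B (bd (lie_bracket f y)) (u i))) (mv (\<phi> (u' i)) (t (s - j))) = 0"
        proof
          fix i assume i: "i \<in> {..<d} - S0"
          then have "B (bd (lie_bracket f y)) (u i) = 0" using y(3)
            by (intro form_ad_eigen[OF band_ad_eigen[OF ad_eigen_bracket[OF f_ad_eigen y(2)]] u_ad_eigen]) auto
          then show "mv (mat (B (bd (lie_bracket f y)) (u i))) (mv (\<phi> (u' i)) (t (s - j))) = 0" by simp
        qed
      qed auto
      also have "\<dots> = mv (\<phi> (bd (lie_bracket f y))) (t (s - j))"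
        by (subst (2) expand_u'[OF band_band])
          (simp add: rep_sum rep_scale mv_sum_left mv_mult)
      finally show ?thesis .
    qed
    from veq_mv[OF veq_diff[OF veq_refl[of 0] N], of PL]
    show "mv PL (mv A 0 + mv D 0 + (\<Sum>i\<in>S0. ga (u i) (mv (\<phi> (u' i)) 0))
        - (\<Sum>i\<in>S0. ga (lie_bracket y (u i)) (mv (\<phi> (u' i)) (t (s - 1 + \<delta> i))))) \<simeq> 0"
      by (simp add: N_def mv_minus_right PL_band_bracket_f[OF y])
  qed simp_all
  then show ?case by simp
qed

section \<open>Vanishing of coefficients at weights near the bottom\<close>

lemma PL_row:
  assumes "r < k" "- k \<le> r" shows "mv (WP {r}) (G s) = 0"
proof -
  have "mv (WP {r}) (mv PL (G s)) = mv (WP {r}) (G s)"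
    by (rule mv_eqI2) (rule WP_absorb(1), use assms in auto)
  then show ?thesis by (simp add: PL_G)
qed

text \<open>The coefficients in weights between \<open>- k\<close> and \<open>- m\<close> are polynomial in \<open>z\<close>.\<close>

lemma t_weight_vanishes:
  assumes inj: "\<And>i v. m < i \<Longrightarrow> i < k \<Longrightarrow> v \<in> wsp (- i) \<Longrightarrow> \<phi> f *v v = 0 \<Longrightarrow> v = 0" and m: "0 \<le> m"
  shows "m < k - real r \<Longrightarrow> real r < s \<Longrightarrow> mv (WP {- k + real r}) (t s) = 0"
proof (induction r arbitrary: s rule: less_induct)
  case (less r)
  show ?case
  proof (cases r)
    case 0
    then show ?thesis using less.prems by (simp add: t_low)
  next
    case (Suc q)
    \<comment> \<open>The weight just below the target. Row \<open>a\<close> of the recursion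
      expresses \<open>f\<close> applied to the component of weight a + 1 through components of
      weight at most \<open>a\<close>.\<close>
    define a where "a = - k + real q"
    have a: "- k \<le> a" "a < k" using less.prems m Suc by (auto simp: a_def)
    have below: "mv (WP {a}) (t s') = 0" if "real q < s'" for s'
      unfolding a_def using less.IH[of q s'] less.prems Suc that by simp
    have D_wsp: "D *v v \<in> wsp (i + 0)" if "v \<in> wsp i" for v i
    proof -
      have "\<phi> (u' l) *v (\<phi> (u l) *v v) \<in> wsp i" if "l < d" for l
        using ad_eigen_wsp[OF u'_ad_eigen[OF that] ad_eigen_wsp[OF u_ad_eigen[OF that] \<open>v \<in> wsp i\<close>]] by simp
      then have "(\<Sum>l\<in>I. \<phi> (u' l) *v (\<phi> (u l) *v v)) \<in> wsp i" if "I \<subseteq> {..<d}" for I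
        using that by (induction I rule: infinite_finite_induct) (auto intro: wsp_add)
      from this[of "{l. l < d \<and> \<delta> l \<ge> 1}"]
      have "(\<Sum>l | l < d \<and> \<delta> l \<ge> 1. \<phi> (u' l) *v (\<phi> (u l) *v v)) \<in> wsp i" by blast
      then show ?thesis unfolding D_vec using wsp_scale[of _ i "- 1"] by fastforce
    qed
    have "mv (WP {a}) (mv D (t (s - 1))) = mv D (mv (WP {a}) (t (s - 1)))"
      by (rule mv_eqI3) (use WP_shift[OF D_wsp, of "{a}"] in simp)
    also have "\<dots> = 0" using less.prems Suc by (subst below) auto
    finally have 1: "mv (WP {a}) (mv D (t (s - 1))) = 0" .
    \<comment> \<open>\<open>u' l\<close> raises the weight by n while the exponent drops by n + 1.
      The target has index q + 1 and s > q + 1, so the required bound s - 1 - n > q - n holds for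
      the source.\<close>
    have 2: "mv (WP {a}) (ga (u l) (mv (\<phi> (u' l)) (t (s - 1 + \<delta> l)))) = 0" if "l \<in> S0" for l
    proof -
      have l: "l < d" "\<delta> l \<le> 0" using that by auto
      obtain i where i: "\<delta> l = of_int i" "l < d" "\<delta> l \<le> 0"
        using delta_integral[OF l(1)] l by (auto elim: Ints_cases)
      define n where "n = nat (- i)"
      have n: "\<delta> l = - real n" using i by (simp add: n_def)
      have "mv (WP {a}) (mv (\<phi> (u' l)) T) = mv (\<phi> (u' l)) (mv (WP {a - real n}) T)" for T :: "'g uea^'n"
      proof (rule mv_eqI3)
        have "{i. i + - \<delta> l \<in> {a}} = {a - real n}" using n by auto
        then show "WP {a} *v (\<phi> (u' l) *v v) = \<phi> (u' l) *v (WP {a - real n} *v v)" for v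
          by (simp only: WP_ad_eigen[OF u'_ad_eigen[OF i(2)]])
      qed
      moreover have "mv (WP {a - real n}) (t (s - 1 + \<delta> l)) = 0"
      proof (cases "n \<le> q")
        case True
        then have "a - real n = - k + real (q - n)" by (simp add: a_def of_nat_diff)
        moreover have "mv (WP {- k + real (q - n)}) (t (s - 1 + \<delta> l)) = 0"
          using less.prems Suc True n by (intro less.IH) (auto simp: of_nat_diff)
        ultimately show ?thesis by simp
      next
        case False
        have "mv (WP {a - real n}) (mv P (t (s - 1 + \<delta> l))) = mv (WP {}) (t (s - 1 + \<delta> l))"
          by (rule mv_eqI2) (use False in \<open>simp add: WP_WP a_def\<close>)
        moreover have "mv (WP {}) T = 0" for T :: "'g uea^'n"
          using mv_eqI2[of "WP {}" "WP {}" 0 T] by (metis WP_empty matrix_eq matrix_vector_mult_0 mv_0_left)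
        ultimately show ?thesis by (simp add: t_P)
      qed
      ultimately show ?thesis by (simp add: mv_ga)
    qed
    have "mv (WP {a}) (mv A (t s)) = mv (WP {a}) (G s) - mv (WP {a}) (mv D (t (s - 1)))
        - (\<Sum>l\<in>S0. mv (WP {a}) (ga (u l) (mv (\<phi> (u' l)) (t (s - 1 + \<delta> l)))))"
      by (simp add: G_def mv_add_right mv_sum_right)
    then have A0: "mv (WP {a}) (mv A (t s)) = 0"
      using 1 2 PL_row[OF a(2,1)] by simp
    have AA: "mv (WP {a}) (mv A (t s)) = mv (WP {a}) (t s) + mv (\<phi> f) (mv (WP {a + 1}) (t s))"
    proof -
      have "WP {a} ** A = WP {a} + \<phi> f ** WP {a + 1}"
      proof -
        have "{i. i + - 1 \<in> {a}} = {a + 1}" by auto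
        moreover have "{a} \<subseteq> {- k..k}" "{a + 1} \<subseteq> {- k..k}" using a less.prems Suc m by (auto simp: a_def)
        ultimately show ?thesis
          by (simp add: matrix_eq mult_mult_vec matrix_vector_mult_add_rdistrib
              A_vec vec.add WP_absorb WP_ad_eigen[OF f_ad_eigen] del: WP_ad_eigen)
      qed
      from arg_cong[OF this, of "\<lambda>M. mv M (t s)"] show ?thesis by (simp add: mv_mult mv_add_left)
    qed
    have F0: "mv (\<phi> f) (mv (WP {a + 1}) (t s)) = 0"
      using A0 AA below[of s] less.prems Suc by simp
    obtain g where g: "Vector_Spaces.linear (*s) (*s) g" "\<And>v. v \<in> wsp (a + 1) \<Longrightarrow> g (\<phi> f *v v) = v"
    proof -
      have sub: "vec.subspace (wsp (a + 1))"
        by (rule vec.subspaceI) (auto intro: wsp_add wsp_scale)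
      have "inj_on ((*v) (\<phi> f)) (wsp (a + 1))"
      proof (rule inj_onI)
        fix v v' assume v: "v \<in> wsp (a + 1)" "v' \<in> wsp (a + 1)" "\<phi> f *v v = \<phi> f *v v'"
        have e: "a + 1 = - (k - real r)" by (simp add: a_def Suc)
        have "v - v' \<in> wsp (- (k - real r))"
          using vec.subspace_diff[OF sub v(1,2)] by (simp only: e)
        moreover have "\<phi> f *v (v - v') = 0" using v(3) by (simp add: vec.diff)
        moreover have "k - real r < k" using Suc by simp
        ultimately have "v - v' = 0" using inj[OF less.prems(1)] by blast
        then show "v = v'" by simp
      qed
      from vec.linear_exists_left_inverse_on[OF matrix_vector_mul_linear_gen sub this]
      show ?thesis using that by blast
    qed
    have "mv (matrix g) (mv (\<phi> f) (mv (WP {a + 1}) (t s))) = mv (WP {a + 1}) (t s)"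
    proof -
      have "matrix g ** (\<phi> f ** WP {a + 1}) = WP {a + 1}"
        by (simp add: matrix_eq mult_mult_vec matrix_works[OF g(1)] g(2) WP_singleton_wsp)
      then show ?thesis by (metis mv_mult)
    qed
    then have "mv (WP {a + 1}) (t s) = 0" by (simp add: F0)
    moreover have "a + 1 = - k + real r" by (simp add: a_def Suc)
    ultimately show ?thesis by metis
  qed
qed

text \<open>Removes the special form of the weight: a weight of V in the band differs from -k by a
  natural number, and everything below -k is cut off by \<open>t_P\<close>.\<close>

lemma t_weight_vanishes':
  assumes inj: "\<And>i v. m < i \<Longrightarrow> i < k \<Longrightarrow> v \<in> wsp (- i) \<Longrightarrow> \<phi> f *v v = 0 \<Longrightarrow> v = 0" and m: "0 \<le> m"
    and i: "m < i" "k - i < s"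
  shows "mv (WP {- i}) (t s) = 0"
proof (cases "i \<le> k \<and> wsp (- i) \<noteq> {0}")
  case True
  then obtain v where "v \<in> wsp (- i)" "v \<noteq> 0" using wsp_0 by blast
  then have "- i - - k \<in> \<int>" using weights_integral w by blast
  then obtain l where l: "k - i = of_int l" by (auto elim: Ints_cases)
  then have "k - i = real (nat l)" using True by simp
  then show ?thesis
    using t_weight_vanishes[where r = "nat l" and s = s, OF inj m] i by (simp add: algebra_simps)
next
  case False
  have "WP {- i} *v (P *v v) = 0" for v
  proof (cases "i \<le> k")
    case True
    then show ?thesis using False WP_singleton_wsp[of "- i" "P *v v"] by simp
  next
    case False
    then show ?thesis by (simp add: WP_WP)
  qed
  then have "WP {- i} ** P = 0" by (simp add: matrix_eq mult_mult_vec)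
  then have "mv (WP {- i}) (mv P (t s)) = 0" by (metis mv_mult mv_0_left)
  then show ?thesis by (simp add: t_P)
qed

theorem ga_coefficient:
  assumes inj: "\<And>i v. m < i \<Longrightarrow> i < k \<Longrightarrow> v \<in> wsp (- i) \<Longrightarrow> \<phi> f *v v = 0 \<Longrightarrow> v = 0" and m: "0 \<le> m"
    and PW: "\<And>v. PW *v v = PW *v (WP {- m} *v v)"
    and b: "k - m < b" and y: "y \<in> ad_eigenspace x j" "j \<ge> 1"
  shows "ga y (mv PW (t b)) \<simeq> mv (mat (B f y)) (mv PW (t b))"
proof -
  define z where "z = y - bd y"
  have z: "bd z = 0" "z \<in> ad_eigenspace x j" "y = bd y + z"
    using y(1) band_ad_eigen[OF y(1)]
    by (auto simp: z_def band_diff ad_eigenspace_def lie_diff_right lie.scale_right_diff_distrib)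
  have "PW *v (\<phi> (bd y) *v v) = (PW ** \<phi> (bd y)) *v (WP {- (m + j)} *v v)" for v
  proof -
    have "{i. i + j \<in> {- m}} = {- (m + j)}" by auto
    then have E: "WP {- m} *v (\<phi> (bd y) *v v) = \<phi> (bd y) *v (WP {- (m + j)} *v v)"
      by (simp add: WP_ad_eigen[OF band_ad_eigen[OF y(1)]])
    have "PW *v (\<phi> (bd y) *v v) = PW *v (WP {- m} *v (\<phi> (bd y) *v v))" by (rule PW)
    then show ?thesis by (simp add: E mult_mult_vec)
  qed
  then have "mv PW (mv (\<phi> (bd y)) (t (b - j))) = mv (PW ** \<phi> (bd y)) (mv (WP {- (m + j)}) (t (b - j)))"
    by (rule mv_eqI3)
  \<comment> \<open>The exponent condition b - j > k - (m + j) is equivalent to b > k - m, for every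
    degree \<open>j\<close>.\<close>
  also have "\<dots> = 0"
    using t_weight_vanishes'[where i = "m + j" and s = "b - j", OF inj m] b y(2) by simp
  finally have 0: "mv PW (mv (\<phi> (bd y)) (t (b - j))) = 0" .
  have "ga y (mv PW (t b)) = mv PW (ga (bd y) (t b)) + mv PW (ga z (t b))"
    by (subst z(3)) (simp add: ga_add_left mv_ga)
  also have "\<dots> \<simeq> mv PW (mv (mat (B f (bd y))) (t b) - mv (\<phi> (bd y)) (t (b - j))) + mv PW (mv (mat (B f z)) (t b))"
    by (intro veq_add veq_mv ga_band ga_off_band[OF z(1,2) y(2)] band_band band_ad_eigen y)
  also have "\<dots> = mv (mat (B f (bd y)) + mat (B f z)) (mv PW (t b))"
    by (simp add: mv_diff_right 0 mv_scalar_commute mv_add_left)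
  also have "mat (B f (bd y)) + mat (B f z) = (mat (B f y) :: complex^'n^'n)"
  proof -
    have "B f y = B f (bd y) + B f z" by (subst z(3)) (rule form_add_right)
    then show ?thesis by (simp add: mat_def vec_eq_iff)
  qed
  finally show ?thesis .
qed

end

section \<open>Matrices of power series\<close>

lemma matrix_mult_distrib_right: "(A + B) ** C = A ** C + B ** (C :: 'a::semiring_1^'n^'m)"
  by (vector matrix_matrix_mult_def sum.distrib distrib_right)

lemma matrix_mult_diff_right: "(A - B) ** C = A ** C - B ** (C :: 'a::ring_1^'n^'m)"
  by (vector matrix_matrix_mult_def sum_subtractf left_diff_distrib)

lemma matrix_mult_diff_left: "C ** (A - B) = C ** A - C ** (B :: 'a::ring_1^'n^'m)"
  by (vector matrix_matrix_mult_def sum_subtractf right_diff_distrib)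

definition cfm :: "nat \<Rightarrow> ('a::ring_1 fps)^'n^'n \<Rightarrow> 'a^'n^'n"
  where "cfm n M = (\<chi> i j. fps_nth (M $ i $ j) n)"

lemma cfm_eqI: "(\<And>n. cfm n M = cfm n M') \<Longrightarrow> M = M'"
  by (simp add: cfm_def vec_eq_iff fps_eq_iff)

lemma cfm_1: "cfm n (mat 1) = (if n = 0 then mat 1 else 0)"
  by (simp add: cfm_def vec_eq_iff mat_def)

lemma cfm_mult: "cfm n (M ** M') = (\<Sum>i\<le>n. cfm i M ** cfm (n - i) M')"
proof -
  have "cfm n (M ** M') $ r $ s = (\<Sum>i\<le>n. cfm i M ** cfm (n - i) M') $ r $ s" for r s
  proof -
    have "cfm n (M ** M') $ r $ s = (\<Sum>l\<in>UNIV. \<Sum>i\<le>n. fps_nth (M $ r $ l) i * fps_nth (M' $ l $ s) (n - i))"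
      by (simp add: cfm_def matrix_matrix_mult_def fps_sum_nth fps_mult_nth atLeast0AtMost)
    also have "\<dots> = (\<Sum>i\<le>n. \<Sum>l\<in>UNIV. fps_nth (M $ r $ l) i * fps_nth (M' $ l $ s) (n - i))"
      by (rule sum.swap)
    also have "\<dots> = (\<Sum>i\<le>n. cfm i M ** cfm (n - i) M') $ r $ s"
      by (simp add: cfm_def matrix_matrix_mult_def)
    finally show ?thesis .
  qed
  then show ?thesis by (simp add: vec_eq_iff)
qed

function left_inverse_coeff :: "(nat \<Rightarrow> 'a::ring_1^'n^'n) \<Rightarrow> nat \<Rightarrow> 'a^'n^'n" where
  "left_inverse_coeff a n = (if n = 0 then mat 1
     else - (\<Sum>i\<in>{..<n}. left_inverse_coeff a i ** a (n - i)))"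
  by auto
termination by (relation "Wellfounded.measure snd") auto

declare left_inverse_coeff.simps [simp del]

lemma fps_matrix_left_inverse:
  fixes M :: "('a::ring_1 fps)^'n^'n"
  assumes "cfm 0 M = mat 1"
  shows "\<exists>R. R ** M = mat 1 \<and> cfm 0 R = mat 1"
proof -
  let ?l = "left_inverse_coeff (\<lambda>n. cfm n M)"
  define R :: "('a fps)^'n^'n" where "R = (\<chi> i j. Abs_fps (\<lambda>n. ?l n $ i $ j))"
  have R: "cfm n R = ?l n" for n by (simp add: cfm_def R_def vec_eq_iff)
  have "R ** M = mat 1"
  proof (rule cfm_eqI)
    fix n
    have "cfm n (R ** M) = (\<Sum>i<n. ?l i ** cfm (n - i) M) + ?l n"
      unfolding cfm_mult R by (simp add: lessThan_Suc_atMost[symmetric] assms)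
    also have "\<dots> = cfm n (mat 1)"
      by (subst (2) left_inverse_coeff.simps) (simp add: cfm_1)
    finally show "cfm n (R ** M) = cfm n (mat 1)" .
  qed
  moreover have "cfm 0 R = mat 1" by (simp add: R left_inverse_coeff.simps)
  ultimately show ?thesis by blast
qed

text \<open>The coefficients do not commute, so only left inverses come from the recursion. A left
  inverse \<open>R\<close> has constant term 1 and thus a left inverse of its own, which must equal
  \<open>M\<close>.\<close>

lemma fps_matrix_inverse:
  fixes M :: "('a::ring_1 fps)^'n^'n"
  assumes "cfm 0 M = mat 1"
  shows "\<exists>R. R ** M = mat 1 \<and> M ** R = mat 1"
proof -
  obtain R where R: "R ** M = mat 1" "cfm 0 R = mat 1"
    using fps_matrix_left_inverse[OF assms] by blast
  obtain R' where R': "R' ** R = mat 1" using fps_matrix_left_inverse[OF R(2)] by blast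
  have "R' = R' ** (R ** M)" by (simp add: R)
  also have "\<dots> = M" by (simp add: matrix_mul_assoc R')
  finally show ?thesis using R(1) R' by blast
qed

lemma scal_mat_mult: "(scal_mat (A ** A') :: ('g::complex_lie_algebra uea fps)^'n^'n) = scal_mat A ** scal_mat A'"
proof -
  have "fps_const (\<Sum>l\<in>UNIV. g l) = (\<Sum>l\<in>UNIV. fps_const (g l))" for g :: "'n \<Rightarrow> 'g uea"
    by (simp add: fps_eq_iff fps_sum_nth)
  then show ?thesis
    by (simp add: tensor_mat_def vec_eq_iff matrix_matrix_mult_def uea_const_sum uea_const_mult)
qed

lemma scal_mat_1 [simp]: "scal_mat (mat 1) = mat 1"
  by (simp add: tensor_mat_def vec_eq_iff mat_def)

lemma scal_mat_0 [simp]: "scal_mat 0 = 0"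
  by (simp add: tensor_mat_def vec_eq_iff)

lemma cfm_0_scal_mat: "cfm 0 (scal_mat A) = (\<chi> i j. uea_const (A $ i $ j))"
  by (simp add: cfm_def tensor_mat_def vec_eq_iff)

lemma cfm_0_scal_mult: "cfm 0 (scal_mat A ** M ** scal_mat A')
    = (\<chi> i j. uea_const (A $ i $ j)) ** cfm 0 M ** (\<chi> i j. uea_const (A' $ i $ j))"
  by (simp add: cfm_mult cfm_0_scal_mat)

text \<open>The coefficient of \<open>z\<^sup>-\<^sup>n\<^sup>/\<^sup>2\<close> in a vector.\<close>

definition co :: "nat \<Rightarrow> ('g::complex_lie_algebra uea fps)^'n \<Rightarrow> 'g uea^'n"
  where "co n v = (\<chi> i. fps_nth (v $ i) n)"

lemma co_eqI: "(\<And>n. co n v = co n v') \<Longrightarrow> v = v'"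
  by (simp add: co_def vec_eq_iff fps_eq_iff)

lemma co_0 [simp]: "co n 0 = 0"
  by (simp add: co_def vec_eq_iff)

lemma co_add: "co n (v + v') = co n v + co n v'"
  by (simp add: co_def vec_eq_iff)

lemma co_sum: "co n (\<Sum>i\<in>I. v i) = (\<Sum>i\<in>I. co n (v i))"
  by (induction I rule: infinite_finite_induct) (simp_all add: co_add)

lemma co_scal_mat: "co n (scal_mat A *v v) = mv A (co n v)"
  by (simp add: co_def vec_eq_iff tensor_mat_def matrix_vector_mult_def mv_def fps_sum_nth)

lemma co_scal_vec: "co n (scal_vec w) = (if n = 0 then cv w else 0)"
  by (simp add: co_def scal_vec_def cv_def vec_eq_iff)

lemma co_tensor_gen: "co n (tensor_mat (fps_X ^ N * fps_const (uea_gen y)) A *v v)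
    = (if n < N then 0 else ga y (mv A (co (n - N) v)))"
  by (simp add: co_def vec_eq_iff tensor_mat_def matrix_vector_mult_def mv_def ga_def fps_sum_nth
      fps_X_power_mult_nth mult.assoc sum_distrib_left)

lemma co_tensor_X: "co n (tensor_mat (fps_X ^ N) A *v v) = (if n < N then 0 else mv A (co (n - N) v))"
  by (simp add: co_def vec_eq_iff tensor_mat_def matrix_vector_mult_def mv_def fps_sum_nth
      fps_X_power_mult_nth mult.assoc)

lemma sum_matrix_mult_vec: "(\<Sum>i\<in>I. M i) *v v = (\<Sum>i\<in>I. M i *v (v :: 'a::ring_1^'n))"
  by (induction I rule: infinite_finite_induct) (simp_all add: matrix_vector_mult_add_rdistrib)

lemma cfm_add: "cfm n (M + M') = cfm n M + cfm n M'"
  by (simp add: cfm_def vec_eq_iff)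

lemma cfm_diff: "cfm n (M - M') = cfm n M - cfm n M'"
  by (simp add: cfm_def vec_eq_iff)

lemma cfm_sum: "cfm n (\<Sum>i\<in>I. M i) = (\<Sum>i\<in>I. cfm n (M i))"
  by (induction I rule: infinite_finite_induct) (simp_all add: cfm_add cfm_def vec_eq_iff)

text \<open>Uniqueness for the definite description: any candidate satisfies R = R A R0 = P1 R0 =
  R0, with the support condition used for the first and last equality.\<close>

lemma op_inverse_works:
  fixes A :: "('g::complex_lie_algebra uea fps)^'n^'n"
  assumes P: "P\<^sub>1 ** P\<^sub>1 = P\<^sub>1" "P\<^sub>2 ** P\<^sub>2 = P\<^sub>2"
    and ex: "R0 = scal_mat P\<^sub>1 ** R0 ** scal_mat P\<^sub>2" "R0 ** A = scal_mat P\<^sub>1" "A ** R0 = scal_mat P\<^sub>2"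
  shows "op_inverse P\<^sub>1 P\<^sub>2 A = R0"
  unfolding op_inverse_def
proof (rule the_equality)
  fix R assume R: "R = scal_mat P\<^sub>1 ** R ** scal_mat P\<^sub>2 \<and> R ** A = scal_mat P\<^sub>1 \<and> A ** R = scal_mat P\<^sub>2"
  have 2: "R ** scal_mat P\<^sub>2 = R"
    using R P(2) by (metis matrix_mul_assoc scal_mat_mult)
  have 1: "scal_mat P\<^sub>1 ** R0 = R0"
    using ex(1) P(1) by (metis matrix_mul_assoc scal_mat_mult)
  have "R = R ** (A ** R0)" using 2 ex(3) by simp
  also have "\<dots> = scal_mat P\<^sub>1 ** R0" using R by (simp add: matrix_mul_assoc)
  finally show "R = R0" using 1 by simp
qed (use ex in blast)

section \<open>The leading coefficient of the Lax operator\<close>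

context band_module begin

lemma sum_WP_evs: "(\<Sum>j\<in>set evs. WP {j} *v v) = v"
proof -
  have "(\<Sum>j\<in>set evs. WP {j}) = mat 1"
  proof (rule matrix_eqI_wsp)
    fix i v assume v: "v \<in> wsp i"
    have "(\<Sum>j\<in>set evs. WP {j}) *v v = (\<Sum>j\<in>set evs. if j = i then v else 0)"
      unfolding sum_mult_vec by (intro sum.cong refl) (use WP_wsp[OF v] in auto)
    also have "\<dots> = v" using wsp_evs[OF v] by (cases "v = 0") simp_all
    finally show "(\<Sum>j\<in>set evs. WP {j}) *v v = mat 1 *v v" by simp
  qed
  from arg_cong[OF this, of "\<lambda>M. M *v v"] show ?thesis by (simp add: sum_mult_vec)
qed

text \<open>The rows k - r of v + f v = 0 give the component of weight k - r as (-1)^r F^r applied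
  to the top component. The component of weight -k is zero, so F^(2k) kills the top component, which
  vanishes by \<open>FF_inj\<close>, and all others with it.\<close>

lemma leading_injective:
  assumes k: "k > 0" "2 * k = real N" "wsp k \<noteq> {0}"
    and v: "PG *v v = v" "PL *v (v + \<phi> f *v v) = 0"
  shows "v = 0"
proof -
  have rec: "r \<le> N \<Longrightarrow> WP {k - real r} *v v = (-1) ^ r *s FF r (WP {k} *v v)" for r
  proof (induction r)
    case (Suc r)
    let ?j = "k - real (Suc r)"
    have "?j \<in> {- k..<k}" using Suc(2) k by simp
    then have "WP {?j} *v (PL *v (v + \<phi> f *v v)) = WP {?j} *v v + WP {?j} *v (\<phi> f *v v)"
      by (simp add: WP_WP vec.add)
    moreover have "{i. i + - 1 \<in> {?j}} = {k - real r}" by auto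
    ultimately have "WP {?j} *v v + \<phi> f *v (WP {k - real r} *v v) = 0"
      using v(2) by (simp only: WP_ad_eigen[OF f_ad_eigen] vec.zero)
    then have "WP {?j} *v v = - (\<phi> f *v (WP {k - real r} *v v))"
      by (simp add: eq_neg_iff_add_eq_0)
    also have "\<dots> = (-1) ^ Suc r *s FF (Suc r) (WP {k} *v v)"
      using Suc by (simp add: vec.scale)
    finally show ?case .
  qed simp
  have low: "WP {- k} *v v = 0"
    by (subst v(1)[symmetric]) (simp add: WP_WP)
  have e: "k - real N = - k" using k by simp
  have "(-1) ^ N *s FF N (WP {k} *v v) = 0" using rec[of N] low unfolding e by simp
  then have "FF N (WP {k} *v v) = 0" by (simp add: vec.scale_eq_0_iff)
  then have top: "WP {k} *v v = 0"
    using FF_inj[of N k "WP {k} *v v"] k WP_singleton_wsp by simp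
  have "WP {j} *v v = 0" for j
  proof (rule ccontr)
    assume n: "WP {j} *v v \<noteq> 0"
    obtain w where w: "w \<in> wsp k" "w \<noteq> 0" using k(3) wsp_0 by blast
    have "k - j \<in> \<int>" using weights_integral[OF w WP_singleton_wsp n] .
    moreover have "j \<in> {- k<..k}"
    proof (rule ccontr)
      assume "j \<notin> {- k<..k}"
      then have "WP {j} *v (PG *v v) = 0" by (simp add: WP_WP)
      then show False using n v(1) by simp
    qed
    ultimately obtain l where l: "k - j = of_int l" "0 \<le> l" by (auto elim!: Ints_cases)
    then have "j = k - real (nat l)" by simp
    moreover have "nat l \<le> N" using l k \<open>j \<in> {- k<..k}\<close> by (simp add: nat_le_iff)
    ultimately have "WP {j} *v v = 0" using rec[of "nat l"] top by (simp add: matrix_pow_linear)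
    then show False using n by simp
  qed
  then show ?thesis using sum_WP_evs[of v] by simp
qed

text \<open>The leading coefficient goes from V[>-k] to V[<k] inside the band. It is completed to an
  invertible matrix on all of V by E^(2k) from V[-k] to V[k] and by the identity outside the band,
  so that ordinary matrix inversion applies.\<close>

lemma leading_invertible:
  assumes k: "k > 0" "2 * k = real N" "wsp k \<noteq> {0}"
  shows "\<exists>N' R. R ** N' = mat 1 \<and> N' ** R = mat 1
    \<and> N' ** PG = PL ** (P + \<phi> (bd f)) ** PG \<and> PL ** N' = PL ** (P + \<phi> (bd f)) ** PG
    \<and> (\<forall>v. PG *v v = v \<longrightarrow> N' *v v = PL *v (v + \<phi> f *v v))"
proof -
  define Em where "Em = matrix (EE N :: complex^'n \<Rightarrow> complex^'n)"
  have Em: "Em *v v = EE N v" for v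
    unfolding Em_def
    by (rule matrix_works) (unfold_locales; simp add: matrix_pow_linear vec.scale_right_distrib vec.scale_left_distrib)
  define N' where "N' = PL ** (mat 1 + \<phi> f) ** PG + Em ** WP {- k} + (mat 1 - P)"
  have sub: "{- k..<k} \<subseteq> {- k..k}" "{- k<..k} \<subseteq> {- k..k}" by auto
  have PLP: "PL *v (P *v v) = PL *v v" "P *v (PL *v v) = PL *v v" "P *v (PG *v v) = PG *v v" "PG *v (P *v v) = PG *v v" for v
    using sub by (simp_all add: WP_WP Int_absorb1 Int_absorb2)
  have N': "N' *v v = PL *v (PG *v v + \<phi> f *v (PG *v v)) + EE N (WP {- k} *v v) + (v - P *v v)" for v
    by (simp add: N'_def mult_mult_vec matrix_vector_mult_add_rdistrib
        matrix_vector_mult_diff_rdistrib Em)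
  have EEk: "EE N (WP {- k} *v v) \<in> wsp k" for v
  proof -
    have "- k + real N = k" using k(2) by simp
    then show ?thesis using EE_wsp[OF WP_singleton_wsp[of "- k" v], of N] by metis
  qed
  have PLE: "PL *v EE N (WP {- k} *v v) = 0" for v
    using WP_wsp[OF EEk] by simp
  have PE: "P *v EE N (WP {- k} *v v) = EE N (WP {- k} *v v)" for v
    using WP_wsp[OF EEk] k by simp
  have "v = 0" if v: "N' *v v = 0" for v
  proof -
    have "P *v (N' *v v) = PL *v (PG *v v + \<phi> f *v (PG *v v)) + EE N (WP {- k} *v v)"
      by (simp add: N' vec.add vec.diff PLP PE)
    then have 1: "PL *v (PG *v v + \<phi> f *v (PG *v v)) + EE N (WP {- k} *v v) = 0" by (simp add: v)
    then have "v = P *v v" using v N' by simp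
    have "PL *v (PL *v (PG *v v + \<phi> f *v (PG *v v)) + EE N (WP {- k} *v v)) = PL *v (PG *v v + \<phi> f *v (PG *v v))"
      by (simp add: vec.add[of PL _ "EE N _"] PLE WP_WP del: vec.add)
    then have 2: "PL *v (PG *v v + \<phi> f *v (PG *v v)) = 0" using 1 by simp
    then have "EE N (WP {- k} *v v) = 0" using 1 by simp
    then have low: "WP {- k} *v v = 0"
      using EE_inj[of N k] k WP_singleton_wsp by simp
    have "{- k<..k} \<union> {- k} = {- k..k}" using k by auto
    then have "P *v v = PG *v v" using WP_add[of "{- k<..k}" "{- k}" v] low by simp
    then have "PG *v v = v" using \<open>v = P *v v\<close> by simp
    then show "v = 0" using leading_injective[OF k] 2 by metis
  qed
  then obtain R where R: "R ** N' = mat 1"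
    using matrix_left_invertible_ker[of N'] by blast
  then have R': "N' ** R = mat 1" by (simp add: matrix_left_right_inverse)
  have "N' ** PG = PL ** (P + \<phi> (bd f)) ** PG"
    unfolding matrix_eq
    by (simp add: mult_mult_vec matrix_vector_mult_add_rdistrib N' vec.add
        rep_band_vec PLP WP_WP[of "{- k<..k}" "{- k<..k}"] WP_WP[of "{- k}"] matrix_pow_linear)
  moreover have "PL ** N' = PL ** (P + \<phi> (bd f)) ** PG"
    unfolding matrix_eq
    by (simp add: mult_mult_vec matrix_vector_mult_add_rdistrib N' vec.add vec.diff
        rep_band_vec PLP PLE WP_WP[of "{- k..<k}" "{- k..<k}"])
  moreover have "N' *v v = PL *v (v + \<phi> f *v v)" if "PG *v v = v" for v
  proof -
    have "P *v v = v" using PLP(3)[of v] that by simp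
    moreover have "WP {- k} *v v = 0"
      by (subst that[symmetric]) (simp add: WP_WP)
    ultimately show ?thesis by (simp add: N' that matrix_pow_linear)
  qed
  ultimately show ?thesis using R R' by blast
qed

end

section \<open>The Lax operator of the truncated algebra\<close>

context lax_basis begin

lemma weight_space_band: "weight_space P (\<phi> (bd x)) j = (if j \<in> {- k..k} then wsp j else {0})"
proof -
  have "P *v (\<phi> x *v v) = \<phi> x *v v" if "P *v v = v" for v
    using X_P[of v] that by simp
  then have "weight_space P (\<phi> (bd x)) j = {v. P *v v = v \<and> v \<in> wsp j}"
    unfolding weight_space_def by (auto simp: rep_band_vec vec.scale)
  then show ?thesis using WP_wsp[of _ j "{- k..k}"] by (auto split: if_splits)
qed

lemma weight_proj_band: "weight_proj P (\<phi> (bd x)) I = WP (I \<inter> {- k..k})"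
  unfolding weight_proj_def
proof (rule proj_along_eqI)
  let ?R = "\<Union>j\<in>I. weight_space P (\<phi> (bd x)) j"
  let ?K = "(\<Union>j\<in>-I. weight_space P (\<phi> (bd x)) j) \<union> {v. P *v v = 0}"
  show "WP (I \<inter> {- k..k}) *v v = v" if "v \<in> vec.span ?R" for v
    by (rule span_subset_fixed[OF _ that]) (auto simp: weight_space_band WP_wsp split: if_splits)
  show "WP (I \<inter> {- k..k}) *v v = 0" if "v \<in> vec.span ?K" for v
  proof (rule span_subset_kernel[OF _ that])
    fix v assume v: "v \<in> ?K"
    show "WP (I \<inter> {- k..k}) *v v = 0"
    proof (cases "P *v v = 0")
      case True
      have "WP (I \<inter> {- k..k}) *v v = WP I *v (P *v v)" by (simp add: WP_WP)
      then show ?thesis using True by simp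
    next
      case False
      then obtain j where "j \<notin> I" "v \<in> weight_space P (\<phi> (bd x)) j" using v by auto
      then show ?thesis by (auto simp: weight_space_band WP_wsp split: if_splits)
    qed
  qed
  have "(\<Union>j. wsp j) \<subseteq> vec.span ?R \<union> vec.span ?K"
  proof
    fix v assume "v \<in> (\<Union>j. wsp j)"
    then obtain j where v: "v \<in> wsp j" by blast
    show "v \<in> vec.span ?R \<union> vec.span ?K"
    proof (cases "j \<in> {- k..k} \<and> j \<in> I")
      case True
      then have "v \<in> ?R" using v by (auto simp: weight_space_band)
      then show ?thesis by (rule UnI1[OF vec.span_base])
    next
      case False
      then have "v \<in> ?K" using v WP_wsp[OF v, of "{- k..k}"] by (auto simp: weight_space_band)
      then show ?thesis by (rule UnI2[OF vec.span_base])
    qed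
  qed
  then show "vec.span (vec.span ?R \<union> vec.span ?K) = UNIV"
    using vec.span_mono span_wsp by blast
qed

lemma top_weight_band:
  assumes "0 \<le> k" "wsp k \<noteq> {0}" shows "top_weight P (\<phi> (bd x)) = k"
  unfolding top_weight_def
proof (rule Max_eqI)
  have "{j. weight_space P (\<phi> (bd x)) j \<noteq> {0}} \<subseteq> set evs"
    using wsp_evs wsp_0 by (fastforce simp: weight_space_band split: if_splits)
  then show "finite {j. weight_space P (\<phi> (bd x)) j \<noteq> {0}}" by (rule finite_subset) simp
qed (use assms in \<open>auto simp: weight_space_band split: if_splits\<close>)

definition "Y = (lax_Y \<phi> P (bd f) d u \<delta> u' :: ('g uea fps)^'n^'n)"
definition "L = (lax_R \<phi> P (bd f) (bd x) d u \<delta> u' :: ('g uea fps)^'n^'n)"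

lemma L_eq:
  assumes "0 < k" "wsp k \<noteq> {0}"
  shows "L = op_inverse PG PL (scal_mat PL ** Y ** scal_mat PG) ** (scal_mat PL ** Y ** scal_mat (WP {- k}))"
proof -
  have "{..<k} \<inter> {- k..k} = {- k..<k}" "{- k<..} \<inter> {- k..k} = {- k<..k}" "{- k} \<inter> {- k..k} = {- k}"
    using assms(1) by auto
  then show ?thesis
    unfolding L_def lax_R_def Let_def Y_def[symmetric]
    using top_weight_band assms by (simp add: weight_proj_band)
qed

lemma delta_le_half: "i < d \<Longrightarrow> \<delta> i \<le> 1 / 2 \<longleftrightarrow> \<delta> i \<le> 0"
proof -
  assume "i < d"
  then obtain r where "\<delta> i = of_int r" using delta_integral by (auto elim: Ints_cases)
  then show ?thesis by auto
qed

lemma Y_eq: "Y = scal_mat P + scal_mat (\<phi> (bd f))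
    + (\<Sum>i | i < d \<and> \<delta> i \<le> 0. tensor_mat (fps_X ^ nat \<lfloor>2 * (1 - \<delta> i)\<rfloor> * fps_const (uea_gen (u i))) (\<phi> (u' i)))
    + tensor_mat (fps_X ^ 2) (lax_D \<phi> d u \<delta> u')"
proof -
  have "{i. i < d \<and> \<delta> i \<le> 1 / 2} = {i. i < d \<and> \<delta> i \<le> 0}" using delta_le_half by auto
  then show ?thesis by (simp add: Y_def lax_Y_def zinv_def)
qed

lemma cfm_0_Y: "cfm 0 Y = (\<chi> i j. uea_const ((P + \<phi> (bd f)) $ i $ j))"
proof -
  have "cfm 0 (tensor_mat (fps_X ^ nat \<lfloor>2 * (1 - \<delta> i)\<rfloor> * fps_const (uea_gen (u i))) (\<phi> (u' i)) :: ('g uea fps)^'n^'n) = 0"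
    if "\<delta> i \<le> 0" for i
  proof -
    have "0 < nat \<lfloor>2 * (1 - \<delta> i)\<rfloor>" using that by simp
    then show ?thesis by (simp add: cfm_def tensor_mat_def vec_eq_iff fps_mult_nth_0)
  qed
  moreover have "cfm 0 (tensor_mat (fps_X ^ 2) (lax_D \<phi> d u \<delta> u') :: ('g uea fps)^'n^'n) = 0"
    by (simp add: cfm_def tensor_mat_def vec_eq_iff)
  ultimately show ?thesis
    by (simp add: Y_eq cfm_add cfm_sum cfm_0_scal_mat vec_eq_iff uea_const_add)
qed

lemma P_idem: "PL ** PL = PL" "PG ** PG = PG" "WP {- k} ** WP {- k} = WP {- k}"
  by (simp_all add: matrix_eq mult_mult_vec WP_WP)

text \<open>\<open>M\<close> adds to the series to be inverted the completion of its leading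
  coefficient. It has invertible constant term \<open>N'\<close> and agrees with \<open>Q\<close>
  after multiplication by \<open>PG\<close> on the right or \<open>PL\<close> on the left.
  Compressing the inverse of \<open>M\<close> therefore yields the operator inverse of
  \<open>Q\<close>.\<close>

lemma L_properties:
  assumes k: "0 < k" "2 * k = real N" "wsp k \<noteq> {0}"
  shows "scal_mat PG ** L = L"
    and "scal_mat PL ** Y ** L = scal_mat PL ** Y ** scal_mat (WP {- k})"
proof -
  define Q where "Q = scal_mat PL ** Y ** scal_mat PG"
  define A0 where "A0 = PL ** (P + \<phi> (bd f)) ** PG"
  obtain N' R where NR: "R ** N' = mat 1" "N' ** R = mat 1" "N' ** PG = A0" "PL ** N' = A0"
    using leading_invertible[OF k] unfolding A0_def by blast
  define M where "M = scal_mat N' + (Q - scal_mat A0)"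
  note hom = scal_mat_mult[symmetric]
  have uc: "(\<chi> i j. uea_const ((A ** A') $ i $ j)) = (\<chi> i j. uea_const (A $ i $ j)) ** (\<chi> i j. uea_const (A' $ i $ j))"
    for A A' :: "complex^'n^'n"
    by (simp add: vec_eq_iff matrix_matrix_mult_def uea_const_sum uea_const_mult)
  have "cfm 0 Q = cfm 0 (scal_mat A0)"
    unfolding Q_def A0_def cfm_0_scal_mult cfm_0_Y by (simp add: cfm_0_scal_mat uc)
  then have cfM: "cfm 0 M = cfm 0 (scal_mat N')" by (simp add: M_def cfm_add cfm_diff)
  have "cfm 0 (scal_mat R ** M) = cfm 0 (scal_mat R ** scal_mat N')"
    by (simp add: cfm_mult cfM)
  also have "\<dots> = mat 1" by (simp add: hom NR(1) cfm_1)
  finally obtain K where K: "K ** (scal_mat R ** M) = mat 1" "(scal_mat R ** M) ** K = mat 1"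
    using fps_matrix_inverse by blast
  define Mi where "Mi = K ** scal_mat R"
  have Mi1: "Mi ** M = mat 1" using K(1) by (simp add: Mi_def matrix_mul_assoc)
  have "M = scal_mat N' ** (scal_mat R ** M)"
    unfolding matrix_mul_assoc hom NR(2) by simp
  then have "M ** Mi = scal_mat N' ** ((scal_mat R ** M) ** K) ** scal_mat R"
    by (metis Mi_def matrix_mul_assoc)
  then have Mi2: "M ** Mi = mat 1" by (simp add: K(2) hom NR(2))
  have idem: "scal_mat PG ** scal_mat PG = (scal_mat PG :: ('g uea fps)^'n^'n)"
    "scal_mat PL ** scal_mat PL = (scal_mat PL :: ('g uea fps)^'n^'n)"
    by (simp_all only: hom P_idem)
  have A0P: "A0 ** PG = A0" "PL ** A0 = A0"
    by (simp_all add: A0_def matrix_mul_assoc[symmetric] P_idem) (simp add: matrix_mul_assoc P_idem)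
  have QG: "Q ** scal_mat PG = Q" by (simp add: Q_def matrix_mul_assoc[symmetric] idem)
  have QL: "scal_mat PL ** Q = Q" by (simp add: Q_def matrix_mul_assoc idem)
  have MPG: "M ** scal_mat PG = Q"
    by (simp add: M_def matrix_mult_distrib_right matrix_mult_diff_right QG hom NR(3) A0P)
  have PLM: "scal_mat PL ** M = Q"
    by (simp add: M_def matrix_add_ldistrib matrix_mult_diff_left QL hom NR(4) A0P)
  define R1 where "R1 = scal_mat PG ** Mi ** scal_mat PL"
  have "R1 ** Q = scal_mat PG ** (Mi ** (scal_mat PL ** Q))"
    by (simp add: R1_def matrix_mul_assoc)
  also have "\<dots> = scal_mat PG ** (Mi ** (M ** scal_mat PG))"
    by (simp only: QL MPG)
  also have "\<dots> = scal_mat PG ** ((Mi ** M) ** scal_mat PG)"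
    by (simp add: matrix_mul_assoc)
  finally have R1Q: "R1 ** Q = scal_mat PG" by (simp add: Mi1 idem)
  have "Q ** R1 = (Q ** scal_mat PG) ** (Mi ** scal_mat PL)"
    by (simp add: R1_def matrix_mul_assoc)
  also have "\<dots> = (scal_mat PL ** M) ** (Mi ** scal_mat PL)"
    by (simp only: QG PLM)
  also have "\<dots> = scal_mat PL ** (M ** Mi) ** scal_mat PL"
    by (simp add: matrix_mul_assoc)
  finally have QR1: "Q ** R1 = scal_mat PL" by (simp add: Mi2 idem)
  have R1: "R1 = scal_mat PG ** R1 ** scal_mat PL"
  proof -
    have "scal_mat PG ** R1 ** scal_mat PL
        = (scal_mat PG ** scal_mat PG) ** Mi ** (scal_mat PL ** scal_mat PL)"
      by (simp add: R1_def matrix_mul_assoc)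
    then show ?thesis by (simp add: idem R1_def)
  qed
  have L: "L = R1 ** (scal_mat PL ** Y ** scal_mat (WP {- k}))"
    unfolding L_eq[OF k(1,3)] Q_def[symmetric]
    using op_inverse_works[OF P_idem(2,1) R1 R1Q QR1] by simp
  have GR1: "scal_mat PG ** R1 = R1" by (simp add: R1_def matrix_mul_assoc idem)
  then show GL: "scal_mat PG ** L = L" unfolding L matrix_mul_assoc by simp
  have "scal_mat PL ** Y ** L = Q ** L"
    by (subst GL[symmetric]) (simp add: Q_def matrix_mul_assoc)
  also have "\<dots> = scal_mat PL ** (scal_mat PL ** Y ** scal_mat (WP {- k}))"
    by (simp add: L matrix_mul_assoc QR1)
  also have "\<dots> = scal_mat PL ** Y ** scal_mat (WP {- k})"
    by (simp add: matrix_mul_assoc idem)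
  finally show "scal_mat PL ** Y ** L = scal_mat PL ** Y ** scal_mat (WP {- k})" .
qed

section \<open>The coefficients of w - L w\<close>

definition "Tv w = scal_vec w - L *v (scal_vec w :: ('g uea fps)^'n)"

definition "tc w (s :: real) = (if s \<ge> 0 \<and> 2 * s \<in> \<int> then co (nat \<lfloor>2 * s\<rfloor>) (Tv w) else 0)"

lemma scal_vec_mult: "scal_mat A *v scal_vec w = scal_vec (A *v w)"
  by (rule co_eqI) (simp add: co_scal_mat co_scal_vec mv_cv)

lemma tc_shift:
  assumes "0 \<le> q" "2 * q \<in> \<int>" 
  shows "tc w (real n / 2 - q) = (if n < nat \<lfloor>2 * q\<rfloor> then 0 else co (n - nat \<lfloor>2 * q\<rfloor>) (Tv w))"
proof -
  obtain r where r: "2 * q = of_int r" using assms(2) by (rule Ints_cases)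
  define N where "N = nat r"
  have "0 \<le> r" using assms(1) r by linarith
  then have N: "2 * q = real N" using r by (simp add: N_def)
  have e: "2 * (real n / 2 - q) = real n - real N" using N by simp
  have i: "2 * (real n / 2 - q) \<in> \<int>" unfolding e by simp
  show ?thesis
  proof (cases "n < N")
    case True
    then have "real n / 2 - q < 0" using N by simp
    then show ?thesis using True N by (simp add: tc_def)
  next
    case False
    then have eq: "2 * (real n / 2 - q) = real (n - N)" unfolding e by (simp add: of_nat_diff)
    then have "0 \<le> 2 * (real n / 2 - q)" by (metis of_nat_0_le_iff)
    then have ge: "real n / 2 - q \<ge> 0" by (simp only: zero_le_mult_iff) simp
    have "tc w (real n / 2 - q) = co (nat \<lfloor>2 * (real n / 2 - q)\<rfloor>) (Tv w)"
      unfolding tc_def by (rule if_P) (use ge i in blast)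
    also have "nat \<lfloor>2 * (real n / 2 - q)\<rfloor> = n - N" unfolding eq by simp
    finally show ?thesis using False N by simp
  qed
qed

text \<open>Since \<open>w\<close> has weight -k, the second part of \<open>L_properties\<close>
  says that the rows of Y below weight k annihilate \<open>Tv w\<close>; comparing coefficients of
  z^(-n/2) gives the recursion.\<close>

lemma lax_core_tc:
  assumes k: "0 < k" "2 * k = real N" "wsp k \<noteq> {0}"
    and w: "w \<in> wsp (- k)" "\<phi> f *v w = 0" "w \<noteq> 0"
  shows "\<exists>R0. lax_core \<phi> f x e B k d u u' \<delta> (tc w) w (lax_D \<phi> d u \<delta> u') R0"
proof -
  obtain N' R where NR: "R ** N' = mat 1"
    "\<And>v. PG *v v = v \<Longrightarrow> N' *v v = PL *v (v + \<phi> f *v v)"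
    using leading_invertible[OF k] by blast
  let ?D = "lax_D \<phi> d u \<delta> u'"
  have wP: "P *v w = w" "WP {- k} *v w = w" using WP_wsp[OF w(1)] k(1) by auto
  have PGL: "P ** PG = PG" "WP {- k} ** PG = 0"
  proof -
    have "{- k..k} \<inter> {- k<..k} = {- k<..k}" by auto
    then show "P ** PG = PG" by (simp add: matrix_eq mult_mult_vec WP_WP)
    show "WP {- k} ** PG = 0" by (simp add: matrix_eq mult_mult_vec WP_WP)
  qed
  have "scal_mat P ** L = L"
    using L_properties(1)[OF k] by (metis matrix_mul_assoc scal_mat_mult PGL(1))
  then have TP: "scal_mat P *v Tv w = Tv w"
    by (simp add: Tv_def matrix_vector_mult_diff_distrib scal_vec_mult wP matrix_vector_mul_assoc)
  have "scal_mat (WP {- k}) ** L = 0"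
  proof -
    have "scal_mat (WP {- k}) ** (scal_mat PG ** L) = 0"
      unfolding matrix_mul_assoc scal_mat_mult[symmetric] PGL(2) by (simp add: vec_eq_iff matrix_matrix_mult_def)
    then show ?thesis by (simp add: L_properties(1)[OF k])
  qed
  then have Tlow: "scal_mat (WP {- k}) *v Tv w = scal_vec w"
    by (simp add: Tv_def matrix_vector_mult_diff_distrib scal_vec_mult wP matrix_vector_mul_assoc)
  have "scal_mat PL ** Y *v Tv w = scal_mat PL ** Y *v (scal_mat (WP {- k}) *v scal_vec w)
      - scal_mat PL ** Y *v (L *v scal_vec w)"
    by (simp add: Tv_def matrix_vector_mult_diff_distrib scal_vec_mult wP)
  also have "\<dots> = 0"
    by (simp add: matrix_vector_mul_assoc L_properties(2)[OF k])
  finally have TY: "scal_mat PL *v (Y *v Tv w) = 0" by (simp add: matrix_vector_mul_assoc)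
  have coY: "mv PL (mv (P + \<phi> (bd f)) (tc w (real n / 2)) + mv ?D (tc w (real n / 2 - 1))
        + (\<Sum>i | i < d \<and> \<delta> i \<le> 0. ga (u i) (mv (\<phi> (u' i)) (tc w (real n / 2 - 1 + \<delta> i))))) = 0" for n
  proof -
    have 1: "tc w (real n / 2 - 1) = (if n < 2 then 0 else co (n - 2) (Tv w))"
      using tc_shift[of 1 w n] by simp
    have 2: "tc w (real n / 2) = co n (Tv w)"
      using tc_shift[of 0 w n] by simp
    have 3: "tc w (real n / 2 - 1 + \<delta> i)
        = (if n < nat \<lfloor>2 * (1 - \<delta> i)\<rfloor> then 0 else co (n - nat \<lfloor>2 * (1 - \<delta> i)\<rfloor>) (Tv w))"
      if i: "i < d" "\<delta> i \<le> 0" for i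
    proof -
      have "2 * (1 - \<delta> i) \<in> \<int>" using delta_integral[OF i(1)] by (intro Ints_mult Ints_diff) auto
      moreover have e: "real n / 2 - 1 + \<delta> i = real n / 2 - (1 - \<delta> i)" by simp
      ultimately show ?thesis unfolding e using i(2) by (intro tc_shift) simp_all
    qed
    have 4: "(\<Sum>i | i < d \<and> \<delta> i \<le> 0. ga (u i) (mv (\<phi> (u' i)) (tc w (real n / 2 - 1 + \<delta> i))))
        = (\<Sum>i | i < d \<and> \<delta> i \<le> 0. if n < nat \<lfloor>2 * (1 - \<delta> i)\<rfloor> then 0
            else ga (u i) (mv (\<phi> (u' i)) (co (n - nat \<lfloor>2 * (1 - \<delta> i)\<rfloor>) (Tv w))))"
      by (intro sum.cong refl) (simp add: 3 del: right_diff_distrib_numeral)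
    have "co n (Y *v Tv w) = mv (P + \<phi> (bd f)) (tc w (real n / 2)) + mv ?D (tc w (real n / 2 - 1))
        + (\<Sum>i | i < d \<and> \<delta> i \<le> 0. ga (u i) (mv (\<phi> (u' i)) (tc w (real n / 2 - 1 + \<delta> i))))"
      unfolding 1 2 4
      by (simp add: Y_eq matrix_vector_mult_add_rdistrib co_add co_scal_mat sum_matrix_mult_vec co_sum
          co_tensor_gen co_tensor_X mv_add_left cong: if_cong)
    moreover have "mv PL (co n (Y *v Tv w)) = 0"
      using arg_cong[OF TY, of "co n"] by (simp add: co_scal_mat)
    ultimately show ?thesis by simp
  qed
  have half: "\<exists>n. s = real n / 2" if s: "0 \<le> s" "2 * s \<in> \<int>" for s :: real
  proof -
    obtain r where "2 * s = of_int r" using s(2) by (rule Ints_cases)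
    then have "s = real (nat r) / 2" using s(1) by simp
    then show ?thesis by blast
  qed
  have tc0: "tc w s = 0" if "\<not> (0 \<le> s \<and> 2 * s \<in> \<int>)" for s
    using that by (auto simp: tc_def)
  show ?thesis
  proof (intro exI[of _ R], unfold_locales)
    show "2 * k \<in> \<int>" using k(2) by simp
    show "mv P (tc w s) = tc w s" for s
      using arg_cong[OF TP, of "co _"] by (simp add: tc_def co_scal_mat)
    show "mv (WP {- k}) (tc w s) = (if s = 0 then cv w else 0)" for s
    proof (cases "0 \<le> s \<and> 2 * s \<in> \<int>")
      case True
      then obtain n where n: "s = real n / 2" using half by blast
      have "tc w s = co n (Tv w)" unfolding n using tc_shift[of 0 w n] by simp
      then show ?thesis
        unfolding n using arg_cong[OF Tlow, of "co n"] by (simp add: co_scal_mat co_scal_vec)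
    qed (auto simp: tc0)
    show "mv PL (mv (P + \<phi> (bd f)) (tc w s) + mv ?D (tc w (s - 1))
        + (\<Sum>i | i < d \<and> \<delta> i \<le> 0. ga (u i) (mv (\<phi> (u' i)) (tc w (s - 1 + \<delta> i))))) = 0" for s
    proof (cases "0 \<le> s \<and> 2 * s \<in> \<int>")
      case True
      then show ?thesis using half coY by blast
    next
      case False
      \<comment> \<open>If \<open>s\<close> is not a nonnegative half-integer, neither is s - q for
        an integer q \<ge> 0. All shifts in the recursion are such integers, so every term
        vanishes.\<close>
      have z: "tc w (s - q) = 0" if q: "q \<in> \<int>" "0 \<le> q" for q
      proof (rule tc0)
        show "\<not> (0 \<le> s - q \<and> 2 * (s - q) \<in> \<int>)"
        proof
          assume a: "0 \<le> s - q \<and> 2 * (s - q) \<in> \<int>"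
          then have "2 * (s - q) + 2 * q \<in> \<int>"
            using Ints_add[of "2 * (s - q)" "2 * q"] Ints_mult[OF Ints_numeral q(1)] by blast
          then show False using False a q by (simp add: algebra_simps)
        qed
      qed
      have "tc w (s - 1 + \<delta> i) = 0" if "i < d" "\<delta> i \<le> 0" for i
      proof -
        have e: "s - 1 + \<delta> i = s - (1 - \<delta> i)" by simp
        show ?thesis unfolding e
          by (rule z) (use delta_integral[OF that(1)] that(2) in \<open>auto intro: Ints_diff\<close>)
      qed
      then show ?thesis using z[of 0] z[of 1] by simp
    qed
    show "R *v (PL *v (v + \<phi> f *v v)) = v" if "PG *v v = v" for v
      using NR that by (metis matrix_vector_mul_assoc matrix_vector_mul_lid)
    show "tc w s = 0" if "s < 0" for s using that by (simp add: tc_def)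
  qed (use k w in simp_all)
qed

end

section \<open>Membership in the W-algebra\<close>

context form_module begin

lemma W_algebraI:
  assumes "\<And>y j. y \<in> ad_eigenspace x j \<Longrightarrow> 1 / 2 \<le> j \<Longrightarrow> uea_gen y * a - a * uea_gen y \<in> W_J B f x"
  shows "W_bar B f x a \<in> W_algebra B f x"
proof -
  have "uea_gen y * a - a * uea_gen y \<in> W_J B f x" if "y \<in> ad_ge x (1 / 2)" for y
    using that unfolding ad_ge_def
  proof (induction rule: lie.span_induct_alt)
    case base
    show ?case by (simp add: W_J_closed)
  next
    case (step c z y)
    then have "uea_gen z * a - a * uea_gen z \<in> W_J B f x" using assms by auto
    then have "uea_const c * (uea_gen z * a - a * uea_gen z) + (uea_gen y * a - a * uea_gen y) \<in> W_J B f x"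
      using step by (intro W_J_closed)
    moreover have "a * (uea_const c * uea_gen z) = uea_const c * (a * uea_gen z)"
      by (metis mult.assoc uea_const_commute)
    ultimately show ?case
      by (simp add: uea_gen_add uea_gen_scale distrib_left distrib_right right_diff_distrib mult.assoc
          add_diff_add)
  qed
  moreover have "W_bar B f x c = W_bar B f x 0" if "c \<in> W_J B f x" for c
  proof -
    have "b - c \<in> W_J B f x \<longleftrightarrow> b \<in> W_J B f x" for b
      using W_J_closed(2)[OF _ that, of "b - c"] W_J_diff[OF _ that, of b] by auto
    then show ?thesis by (simp add: W_bar_def)
  qed
  ultimately show ?thesis unfolding W_algebra_def by blast
qed

text \<open>The product \<open>a * (uea_gen y - uea_const (B f y))\<close> lies in the left ideal
  for any \<open>a\<close>. Hence invariance of \<open>a\<close> modulo \<open>J\<close> amounts to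
  \<open>y\<close> acting on it from the left by the scalar B f y.\<close>

lemma W_J_commutator:
  assumes y: "y \<in> ad_eigenspace x j" "1 \<le> j"
    and a: "uea_gen y * a - uea_const (B f y) * a \<in> W_J B f x"
  shows "uea_gen y * a - a * uea_gen y \<in> W_J B f x"
proof -
  have "uea_gen y * a - a * uea_gen y = (uea_gen y * a - uea_const (B f y) * a)
      - a * (uea_gen y - uea_const (B f y))"
    by (simp add: right_diff_distrib uea_const_commute[of "B f y" a])
  then show ?thesis by (simp only:) (rule W_J_diff[OF a W_J_closed(3)[OF W_J_gen[OF y]]])
qed

end

lemma sl2_rep_of_triple:
  assumes "faithful_rep \<phi>" "nilpotent_matrix (\<phi> f)" "sl2_triple f x e"
  shows "sl2_rep (\<phi> f) (\<phi> x) (\<phi> e)"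
proof -
  have br: "\<phi> (lie_bracket y z) *v v = \<phi> y *v (\<phi> z *v v) - \<phi> z *v (\<phi> y *v v)" for y z v
    using assms(1) by (simp add: faithful_rep_def matrix_vector_mult_diff_rdistrib matrix_vector_mul_assoc)
  have sc: "\<phi> (c *\<^sub>L y) *v v = c *s (\<phi> y *v v)" for c y v
    using assms(1) by (simp add: faithful_rep_def mult_mult_vec mat_mult_vec)
  have neg: "\<phi> (- y) *v v = - (\<phi> y *v v)" for y v
    using sc[of "- 1" y v] by (simp add: lie_scale_one)
  have t: "lie_bracket x e = e" "lie_bracket x f = - f" "lie_bracket e f = 2 *\<^sub>L x"
  proof -
    have 2: "a = b" if "2 *\<^sub>L a = 2 *\<^sub>L b" for a b :: 'a
      using that lie.scale_left_imp_eq[of 2 a b] by simp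
    show "lie_bracket x e = e" "lie_bracket x f = - f"
      by (rule 2, use assms(3) in \<open>simp add: sl2_triple_def lie_bracket_scale_left Let_def\<close>)+
    show "lie_bracket e f = 2 *\<^sub>L x"
      using assms(3) by (simp add: sl2_triple_def Let_def)
  qed
  obtain N where N: "((**) (\<phi> f) ^^ N) (mat 1) = 0"
    using assms(2) by (auto simp: nilpotent_matrix_def)
  have "((*v) (\<phi> f) ^^ n) v = ((**) (\<phi> f) ^^ n) (mat 1) *v v" for n v
    by (induction n) (simp_all add: matrix_vector_mul_assoc)
  then have nil: "((*v) (\<phi> f) ^^ N) v = 0" for v by (simp add: N)
  show ?thesis
  proof
    show "\<phi> x *v (\<phi> e *v v) = \<phi> e *v (\<phi> x *v v) + \<phi> e *v v" for v
      using br[of x e v] by (simp add: t eq_diff_eq add.commute)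
    show "\<phi> x *v (\<phi> f *v v) = \<phi> f *v (\<phi> x *v v) - \<phi> f *v v" for v
      using br[of x f v] by (simp add: t neg eq_diff_eq diff_eq_eq add.commute)
    show "\<phi> e *v (\<phi> f *v v) = \<phi> f *v (\<phi> e *v v) + 2 *s (\<phi> x *v v)" for v
      using br[of e f v] by (simp add: t sc eq_diff_eq add.commute)
    show "\<exists>N. \<forall>v. ((*v) (\<phi> f) ^^ N) v = 0" using nil by blast
  qed
qed

theorem theorem1p3:
  fixes \<phi> :: "'g::complex_lie_algebra \<Rightarrow> complex^'n^'n"
    and B :: "'g \<Rightarrow> 'g \<Rightarrow> complex"
    and f x e :: 'g
    and k m b :: real
    and u u' :: "nat \<Rightarrow> 'g" and \<delta> :: "nat \<Rightarrow> real" and d :: nat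
    and ps :: "nat list"
  assumes "faithful_rep \<phi>" and "classical_type (range \<phi>)"
    and "invariant_form B"
    and "nilpotent_matrix (\<phi> f)"
    and "jordan_type (\<phi> f) ps" and "(\<forall>p\<in>set ps. even p) \<or> (\<forall>p\<in>set ps. odd p)"
    and "sl2_triple f x e"
    and "k \<ge> 0" and "2 * k \<in> \<int>"
    and "2 * m \<in> \<int>" and "m < k" and "\<exists>v. highest_weight_vec \<phi> x e m v"
    and "\<And>m' v. m' < k \<Longrightarrow> highest_weight_vec \<phi> x e m' v \<Longrightarrow> m' \<le> m"
    and "2 * b \<in> \<int>" and "b > k - m"
    and sl_case: "range \<phi> = {A. trace A = 0} \<Longrightarrow>
      \<forall>y. band_proj \<phi> x k ** \<phi> y ** band_proj \<phi> x k \<in> range \<phi>"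
    and gl_case: "range \<phi> = UNIV \<Longrightarrow> band_proj \<phi> x k \<noteq> mat 1 \<Longrightarrow>
      \<exists>c. \<forall>y y'. B y y' = c * trace (\<phi> y ** \<phi> y')"
    and "dual_eigenbases B (range (band \<phi> x k)) (band \<phi> x k x) d u \<delta> u'"
  shows "\<forall>w \<in> isotypic \<phi> f x e k \<inter> weight_space (mat 1) (\<phi> x) (-k). \<forall>i.
    W_bar B f x (zinv_coeff b
      ((scal_mat (proj_W \<phi> f x e m) ** lax_kR \<phi> f x k d u \<delta> u' *v scal_vec w) $ i))
      \<in> W_algebra B f x"
proof (intro ballI allI)
  fix w i
  assume w': "w \<in> isotypic \<phi> f x e k \<inter> weight_space (mat 1) (\<phi> x) (-k)"
  interpret sl2_module \<phi> f x e
    unfolding sl2_module_def by (rule sl2_rep_of_triple) fact+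
  interpret form_module \<phi> f x e B
    by unfold_locales fact+
  let ?PW = "proj_W \<phi> f x e m"
  show "W_bar B f x (zinv_coeff b ((scal_mat ?PW ** lax_kR \<phi> f x k d u \<delta> u' *v scal_vec w) $ i))
      \<in> W_algebra B f x"
  \<comment> \<open>The zero vector is set aside because a nonzero \<open>w\<close> guarantees that
    k is a weight of V.\<close>
  proof (cases "w = 0")
    case True
    have "(scal_vec 0 :: ('g uea fps)^'n) = 0" by (simp add: scal_vec_def vec_eq_iff)
    then have "zinv_coeff b ((scal_mat ?PW ** lax_kR \<phi> f x k d u \<delta> u' *v scal_vec w) $ i) = 0"
      by (simp add: True zinv_coeff_def)
    then show ?thesis by (simp only:) (rule W_algebraI, simp add: W_J_closed)
  next
    case False
    then have w: "w \<in> wsp (- k)" "\<phi> f *v w = 0" "w \<noteq> 0"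
      using w' iso_lowest by auto
    have k_wt: "wsp k \<noteq> {0}"
      using iso_nonzero_weight[of w k] w' False by blast
    obtain v0 where v0: "v0 \<noteq> 0" "v0 \<in> wsp m" "\<phi> e *v v0 = 0"
      using \<open>\<exists>v. highest_weight_vec \<phi> x e m v\<close> by (auto simp: highest_weight_vec_iff)
    have m: "0 \<le> m"
      using hw_string_real[OF v0(3) v0(2)[unfolded mem_wsp] v0(1)] by auto
    have m_wt: "wsp m \<noteq> {0}" using v0 by blast
    have k0: "0 < k" using m \<open>m < k\<close> by simp
    obtain N where N: "2 * k = real N"
      using \<open>2 * k \<in> \<int>\<close> k0 by (metis Ints_cases of_int_0_less_iff of_int_of_nat_eq zero_less_imp_eq_int zero_less_mult_iff zero_less_numeral)
    have bp: "band_proj \<phi> x k = WP {- k..k}" by (simp add: band_proj_def weight_proj_WP)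
    interpret band_module \<phi> f x e B k
    proof unfold_locales
      show "WP {- k..k} ** \<phi> y ** WP {- k..k} \<in> range \<phi>" for y
        using band_classical(1)[OF \<open>classical_type (range \<phi>)\<close> m \<open>m < k\<close> k_wt m_wt] sl_case gl_case
        unfolding bp by blast
      show "B y z = 0" if "WP {- k..k} ** \<phi> y ** WP {- k..k} = 0" "\<phi> z = WP {- k..k} ** \<phi> z ** WP {- k..k}" for y z
        using band_classical(2)[OF \<open>classical_type (range \<phi>)\<close> m \<open>m < k\<close> k_wt m_wt _ _ that] sl_case gl_case
        unfolding bp by blast
      show "i - j \<in> \<int>" if "v \<in> wsp i" "v \<noteq> 0" "w \<in> wsp j" "w \<noteq> 0" for v w i j
        by (rule weights_congruent(1)) fact+
    qed
    interpret lax_basis \<phi> f x e B k d u u' \<delta>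
      by unfold_locales fact
    obtain R0 where "lax_core \<phi> f x e B k d u u' \<delta> (tc w) w (lax_D \<phi> d u \<delta> u') R0"
      using lax_core_tc[OF k0 N k_wt w] by blast
    then interpret lax_core \<phi> f x e B k d u u' \<delta> "tc w" w "lax_D \<phi> d u \<delta> u'" R0 .
    \<comment> \<open>A vector of weight -i killed by \<open>f\<close> generates a string whose
      highest weight is \<open>i\<close>, which would contradict maximality of \<open>m\<close>
      below \<open>k\<close>.\<close>
    have inj: "v = 0" if i: "m < i" "i < k" and v: "v \<in> wsp (- i)" "\<phi> f *v v = 0" for i v
    proof (rule ccontr)
      assume "v \<noteq> 0"
      then obtain v1 where "highest_weight_vec \<phi> x e i v1"
        using lowest_imp_highest(1)[OF v] by (auto simp: highest_weight_vec_iff)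
      then have "i \<le> m" using assms(13) i(2) by blast
      then show False using i(1) by simp
    qed
    have PW: "?PW *v v = ?PW *v (WP {- m} *v v)" for v
    proof (induction v rule: wsp_induct)
      case (wsp j v)
      then show ?case using proj_W_wsp[OF m wsp] WP_wsp[OF wsp, of "{- m}"] by (cases "j = - m") auto
    qed (simp add: vec.add)
    define a where "a = mv ?PW (tc w b) $ i"
    have b0: "0 \<le> b" using \<open>b > k - m\<close> \<open>m < k\<close> by simp
    have "zinv_coeff b ((scal_mat ?PW ** lax_kR \<phi> f x k d u \<delta> u' *v scal_vec w) $ i) = - a"
    proof -
      have "lax_kR \<phi> f x k d u \<delta> u' = L" by (simp add: lax_kR_def L_def band_proj_eq)
      then have "scal_mat ?PW ** lax_kR \<phi> f x k d u \<delta> u' *v scal_vec w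
          = scal_vec (?PW *v w) - scal_mat ?PW *v Tv w"
        by (simp add: Tv_def matrix_vector_mult_diff_distrib scal_vec_mult matrix_vector_mul_assoc)
      \<comment> \<open>Since m < k, the vector \<open>w\<close> of weight -k is invisible to the
        projection, so replacing L w by w - L w changes only the sign.\<close>
      moreover have "?PW *v w = 0" using proj_W_wsp[OF m w(1)] \<open>m < k\<close> by simp
      moreover have "scal_vec 0 = (0 :: ('g uea fps)^'n)" by (simp add: scal_vec_def vec_eq_iff)
      ultimately have "zinv_coeff b ((scal_mat ?PW ** lax_kR \<phi> f x k d u \<delta> u' *v scal_vec w) $ i)
          = - (co (nat \<lfloor>2 * b\<rfloor>) (scal_mat ?PW *v Tv w) $ i)"
        by (simp add: zinv_coeff_def co_def)
      also have "\<dots> = - a"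
        using \<open>2 * b \<in> \<int>\<close> b0 by (simp add: a_def tc_def co_scal_mat)
      finally show ?thesis .
    qed
    moreover have "W_bar B f x (- a) \<in> W_algebra B f x"
    proof (rule W_algebraI)
      fix y j assume y: "y \<in> ad_eigenspace x j" "1 / 2 \<le> j"
      show "uea_gen y * - a - - a * uea_gen y \<in> W_J B f x"
      proof (cases "y = 0")
        case True
        then show ?thesis by (simp add: W_J_closed)
      next
        case False
        then obtain r where "j = of_int r" using ad_eigen_integral[OF y(1)] by (auto elim: Ints_cases)
        then have j: "1 \<le> j" using y(2) by auto
        have "ga y (mv ?PW (tc w b)) \<simeq> mv (mat (B f y)) (mv ?PW (tc w b))"
          by (rule ga_coefficient[OF inj m PW \<open>b > k - m\<close> y(1) j])
        then have "uea_gen y * a - uea_const (B f y) * a \<in> W_J B f x"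
          by (simp add: veq_def VJ_def mv_mat_nth a_def) (simp add: ga_def)
        from W_J_minus[OF W_J_commutator[OF y(1) j this]] show ?thesis
          by simp
      qed
    qed
    ultimately show ?thesis by simp
  qed
qed

end
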